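(* Let $(K,\ast_K)$ be a commutative hypergroup with identity $e$, with Haar measure $\lambda$, and with a quasi-metric $\rho$ on $K$, and let $N>0$ and $A>0$ be constants such that $\lambda(B(e,s))=A s^N$ for all $s>0$, where $B(e,s)=\{y\in K:\rho(e,y)<s\}$. Assume that $1\le q\le\infty$, $1\le p<\infty$, $0<\alpha<\frac Np$, and let $r$ be defined by $\frac1r=\frac1p-\frac\alpha N$. If $f\in L^{p,q}(K,\lambda)$, then $I_\alpha f\in L^{r,q}(K,\lambda)$ and $$\|I_\alpha f\|_{K,r,q}\le C\,\|f\|_{K,p,q},\qquad C=\frac{3rN}{\alpha}\,A^{\frac{N-\alpha}{N}}.$$
   Context: A hypergroup $(K,\ast_K)$ is a locally compact Hausdorff space $K$ together with a bilinear, associative, weakly continuous convolution $\ast_K$ on the Banach space of all bounded regular Borel measures on $K$ such that: (1) for all $x,y\in K$, $\delta_x\ast_K\delta_y$ (convolution of point measures) is a probability measure with compact support; (2) the map $(x,y)\mapsto \operatorname{supp}(\delta_x\ast_K\delta_y)$ from $K\times K$ to the space $\mathcal C(K)$ of nonvoid compact subsets of $K$ is continuous, where $\mathcal C(K)$ carries the Michael topology generated by the sets $U_{V,W}=\{L\in\mathcal C(K): L\cap V\ne\varnothing,\ L\subset W\}$ with $V,W$ open in $K$; (3) there is an identity $e\in K$ with $\delta_e\ast_K\delta_x=\delta_x\ast_K\delta_e=\delta_x$ for all $x\in K$; (4) there is a continuous involution $x\mapsto x^{\sim}$ on $K$ such that $(\delta_x\ast_K\delta_y)^{\sim}=\delta_{y^\sim}\ast_K\delta_{x^\sim}$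 (where $\mu^\sim$ is the image of $\mu$ under the involution), and $e\in\operatorname{supp}(\delta_x\ast_K\delta_y)$ if and only if $x=y^\sim$. The hypergroup is commutative if $\delta_x\ast_K\delta_y=\delta_y\ast_K\delta_x$ for all $x,y\in K$. Generalized translation: $T^xf(y)=\int_K f\,d(\delta_x\ast_K\delta_y)$ for $x,y\in K$. Every commutative hypergroup has a Haar measure $\lambda$, i.e. a (nonzero, positive, Radon) measure with $\int_K T^xf(y)\,d\lambda(y)=\int_K f(y)\,d\lambda(y)$ for all $x\in K$ and Borel measurable $f$ (for which the integrals make sense). A quasi-metric on $K$ is a function $\rho:K\times K\to[0,\infty)$ such that $\rho(x,y)=0\Leftrightarrow x=y$; $\rho(x,y)=\rho(y,x)$; and there is a constant $c\ge1$ with $\rho(x,y)\le c(\rho(x,z)+\rho(z,y))$ for all $x,y,z\in K$. The hypothesis on $\lambda(B(e,s))$ includes that these balls are $\lambda$-measurable. Fractional integral (Riesz potential), for $0<\alpha<N$: $I_\alpha f(x)=\int_K \left(T^x g\right)(y)\,f(y^\sim)\,d\lambda(y)$, where $g(y)=\rho(e,y)^{\alpha-N}$ (with the convention $0^{\alpha-N}=+\infty$). For a $\lambda$-measurable function $f$ on $K$: $\lambda_f(s)=\lambda\{x\in K:|f(x)|>s\}$, $s\ge0$; $f^{\ast_K}(t)=\inf\{s>0:\lambda_f(s)\le t\}$, $t\ge 0$; $f^{\ast\ast_K}(t)=\frac1t\int_0^t f^{\ast_K}(u)\,du$, $t>0$. The Lorentz space $L^{p,q}(K,\lambda)$ is the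 set of $\lambda$-measurable $f$ on $K$ with $\|f\|_{K,p,q}<\infty$, where $\|f\|_{K,p,q}=\left(\int_0^\infty\left(t^{1/p}f^{\ast\ast_K}(t)\right)^q\frac{dt}{t}\right)^{1/q}$ for $1\le p<\infty$, $1\le q<\infty$, and $\|f\|_{K,p,\infty}=\sup_{t>0}t^{1/p}f^{\ast\ast_K}(t)$. *)

theory Defs
  imports "HOL-Analysis.Analysis"
begin

section \<open>Bounded regular Borel measures\<close>

text \<open>
  A complex Borel measure on the type \<open>'a\<close> is a countably additive function
  \<open>'a set \<Rightarrow> complex\<close> on the Borel sets. It is set to 0 on the other sets, so that
  equality of measures is equality of functions. Such measures are automatically bounded.
\<close>

definition total_variation :: "('a::topological_space set \<Rightarrow> complex) \<Rightarrow> 'a set \<Rightarrow> ennreal"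
  where "total_variation \<mu> E =
    (SUP P\<in>{P. finite P \<and> disjoint P \<and> P \<subseteq> sets borel \<and> \<Union>P = E}.
       \<Sum>F\<in>P. ennreal (cmod (\<mu> F)))"

definition complex_borel_measure :: "('a::topological_space set \<Rightarrow> complex) \<Rightarrow> bool"
  where "complex_borel_measure \<mu> \<longleftrightarrow>
    (\<forall>E. E \<notin> sets borel \<longrightarrow> \<mu> E = 0) \<and>
    (\<forall>A::nat \<Rightarrow> 'a set. range A \<subseteq> sets borel \<and> disjoint_family A \<longrightarrow>
       (\<lambda>n. \<mu> (A n)) sums \<mu> (\<Union>n. A n))"

definition regular_measures :: "('a::topological_space set \<Rightarrow> complex) set"
  where "regular_measures = {\<mu>. complex_borel_measure \<mu> \<and>
    (\<forall>E\<in>sets borel.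
       total_variation \<mu> E = (INF U\<in>{U. open U \<and> E \<subseteq> U}. total_variation \<mu> U) \<and>
       total_variation \<mu> E = (SUP C\<in>{C. compact C \<and> C \<subseteq> E}. total_variation \<mu> C))}"

definition positive_measures :: "('a::topological_space set \<Rightarrow> complex) set"
  where "positive_measures =
    {\<mu>\<in>regular_measures. \<forall>E. Im (\<mu> E) = 0 \<and> 0 \<le> Re (\<mu> E)}"

text \<open>A positive measure as an object of the library's measure type.\<close>

definition to_measure :: "('a::topological_space set \<Rightarrow> complex) \<Rightarrow> 'a measure"
  where "to_measure \<mu> = measure_of UNIV (sets borel) (\<lambda>E. ennreal (Re (\<mu> E)))"

definition point_measure :: "'a::topological_space \<Rightarrow> 'a set \<Rightarrow> complex"
  where "point_measure x E = (if E \<in> sets borel \<and> x \<in> E then 1 else 0)"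

definition support :: "('a::topological_space set \<Rightarrow> complex) \<Rightarrow> 'a set"
  where "support \<mu> = {x. \<forall>U. open U \<and> x \<in> U \<longrightarrow> total_variation \<mu> U > 0}"

text \<open>
  The weak topology on the positive cone: the coarsest topology for which
  \<open>\<mu> \<mapsto> \<integral> f d\<mu>\<close> is continuous for every bounded continuous \<open>f\<close>.
\<close>

definition weak_topology :: "('a::topological_space set \<Rightarrow> complex) topology"
  where "weak_topology = topology_generated_by
    {{\<mu>\<in>positive_measures. (LINT x|to_measure \<mu>. f x) \<in> U} | (f::'a \<Rightarrow> real) U.
       continuous_on UNIV f \<and> bounded (range f) \<and> open U}"

definition michael_topology :: "'a::topological_space set topology"
  where "michael_topology = topology_generated_by
    {{L. compact L \<and> L \<noteq> {} \<and> L \<inter> V \<noteq> {} \<and> L \<subseteq> W} | V W. open V \<and> open W}"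


section \<open>Hypergroups\<close>

text \<open>
  Weak continuity of the convolution is joint continuity on the positive cone, as in
  Jewett's definition. Joint weak continuity on the whole space of complex measures
  already fails for the convolution of an infinite compact group.
\<close>

locale hypergroup =
  fixes conv :: "('a::t2_space set \<Rightarrow> complex) \<Rightarrow> ('a set \<Rightarrow> complex) \<Rightarrow> ('a set \<Rightarrow> complex)"
    and e :: 'a
    and invol :: "'a \<Rightarrow> 'a"
  assumes locally_compact: "locally_compact_space (euclidean :: 'a topology)"
    and conv_closed: "\<mu> \<in> regular_measures \<Longrightarrow> \<nu> \<in> regular_measures \<Longrightarrow>
      conv \<mu> \<nu> \<in> regular_measures"
    and conv_linear_left:
      "\<mu> \<in> regular_measures \<Longrightarrow> \<mu>' \<in> regular_measures \<Longrightarrow> \<nu> \<in> regular_measures \<Longrightarrow>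
       conv (\<lambda>E. a * \<mu> E + b * \<mu>' E) \<nu> = (\<lambda>E. a * conv \<mu> \<nu> E + b * conv \<mu>' \<nu> E)"
    and conv_linear_right:
      "\<mu> \<in> regular_measures \<Longrightarrow> \<nu> \<in> regular_measures \<Longrightarrow> \<nu>' \<in> regular_measures \<Longrightarrow>
       conv \<mu> (\<lambda>E. a * \<nu> E + b * \<nu>' E) = (\<lambda>E. a * conv \<mu> \<nu> E + b * conv \<mu> \<nu>' E)"
    and conv_assoc:
      "\<mu> \<in> regular_measures \<Longrightarrow> \<nu> \<in> regular_measures \<Longrightarrow> \<kappa> \<in> regular_measures \<Longrightarrow>
       conv (conv \<mu> \<nu>) \<kappa> = conv \<mu> (conv \<nu> \<kappa>)"
    and conv_weakly_continuous:
      "continuous_map (prod_topology weak_topology weak_topology) weak_topology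
         (\<lambda>(\<mu>, \<nu>). conv \<mu> \<nu>)"
    and conv_point_positive:
      "conv (point_measure x) (point_measure y) \<in> positive_measures"
    and conv_point_prob:
      "conv (point_measure x) (point_measure y) UNIV = 1"
    and conv_point_compact:
      "compact (support (conv (point_measure x) (point_measure y)))"
    and support_continuous:
      "continuous_map euclidean michael_topology
         (\<lambda>(x, y). support (conv (point_measure x) (point_measure y)))"
    and identity_left: "conv (point_measure e) (point_measure x) = point_measure x"
    and identity_right: "conv (point_measure x) (point_measure e) = point_measure x"
    and invol_continuous: "continuous_on UNIV invol"
    and invol_invol: "invol (invol x) = x"
    and invol_conv:
      "(\<lambda>E. conv (point_measure x) (point_measure y) (invol -` E)) =
       conv (point_measure (invol y)) (point_measure (invol x))"
    and identity_in_support_iff: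
      "e \<in> support (conv (point_measure x) (point_measure y)) \<longleftrightarrow> x = invol y"

locale commutative_hypergroup = hypergroup +
  assumes conv_point_commute:
    "conv (point_measure x) (point_measure y) = conv (point_measure y) (point_measure x)"

text \<open>
  Generalized translation of functions with values in \<open>[0, \<infinity>]\<close>. The library integral of a
  nonmeasurable function is its lower integral, and it agrees with the integral over the
  completed measure.
\<close>

definition translation ::
  "(('a::topological_space set \<Rightarrow> complex) \<Rightarrow> ('a set \<Rightarrow> complex) \<Rightarrow> ('a set \<Rightarrow> complex)) \<Rightarrow>
   'a \<Rightarrow> ('a \<Rightarrow> ennreal) \<Rightarrow> 'a \<Rightarrow> ennreal"
  where "translation conv x f y =
    (\<integral>\<^sup>+ z. f z \<partial>to_measure (conv (point_measure x) (point_measure y)))"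

definition radon_measure :: "'a::topological_space measure \<Rightarrow> bool"
  where "radon_measure M \<longleftrightarrow> sets M = sets borel \<and>
    (\<forall>C. compact C \<and> C \<in> sets borel \<longrightarrow> emeasure M C < \<infinity>) \<and>
    (\<forall>E\<in>sets borel. emeasure M E = (INF U\<in>{U. open U \<and> E \<subseteq> U}. emeasure M U)) \<and>
    (\<forall>U. open U \<longrightarrow> emeasure M U = (SUP C\<in>{C. compact C \<and> C \<subseteq> U}. emeasure M C))"

text \<open>
  Invariance is required for all Borel functions with values in \<open>[0, \<infinity>]\<close>, whose integrals
  always make sense; it passes to integrable functions by linearity.
\<close>

definition haar_measure ::
  "(('a::topological_space set \<Rightarrow> complex) \<Rightarrow> ('a set \<Rightarrow> complex) \<Rightarrow> ('a set \<Rightarrow> complex)) \<Rightarrow>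
   'a measure \<Rightarrow> bool"
  where "haar_measure conv M \<longleftrightarrow> radon_measure M \<and> emeasure M UNIV \<noteq> 0 \<and>
    (\<forall>x. \<forall>f\<in>borel_measurable borel.
       (\<integral>\<^sup>+ y. translation conv x f y \<partial>M) = (\<integral>\<^sup>+ y. f y \<partial>M))"

definition quasi_metric :: "('a \<Rightarrow> 'a \<Rightarrow> real) \<Rightarrow> bool"
  where "quasi_metric \<rho> \<longleftrightarrow>
    (\<forall>x y. 0 \<le> \<rho> x y) \<and> (\<forall>x y. \<rho> x y = 0 \<longleftrightarrow> x = y) \<and> (\<forall>x y. \<rho> x y = \<rho> y x) \<and>
    (\<exists>c\<ge>1. \<forall>x y z. \<rho> x y \<le> c * (\<rho> x z + \<rho> z y))"


section \<open>Fractional integrals\<close>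

definition riesz_kernel :: "('a \<Rightarrow> 'a \<Rightarrow> real) \<Rightarrow> 'a \<Rightarrow> real \<Rightarrow> real \<Rightarrow> 'a \<Rightarrow> ennreal"
  where "riesz_kernel \<rho> e N \<alpha> y =
    (if \<rho> e y = 0 then \<infinity> else ennreal (\<rho> e y powr (\<alpha> - N)))"

text \<open>
  The complex integral defining the fractional integral at a point. Where the translated
  kernel is infinite, \<open>enn2real\<close> replaces it by 0. This is harmless under absolute
  convergence, expressed by the predicate below: there the kernel can be infinite with
  \<open>f (invol y) \<noteq> 0\<close> only on a null set.
\<close>

definition fractional_integral ::
  "(('a::topological_space set \<Rightarrow> complex) \<Rightarrow> ('a set \<Rightarrow> complex) \<Rightarrow> ('a set \<Rightarrow> complex)) \<Rightarrow>
   'a \<Rightarrow> ('a \<Rightarrow> 'a) \<Rightarrow> 'a measure \<Rightarrow> ('a \<Rightarrow> 'a \<Rightarrow> real) \<Rightarrow> real \<Rightarrow> real \<Rightarrow>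
   ('a \<Rightarrow> complex) \<Rightarrow> 'a \<Rightarrow> complex"
  where "fractional_integral conv e invol M \<rho> N \<alpha> f x =
    (LINT y|completion M.
       enn2real (translation conv x (riesz_kernel \<rho> e N \<alpha>) y) *\<^sub>R f (invol y))"

definition fractional_integral_converges ::
  "(('a::topological_space set \<Rightarrow> complex) \<Rightarrow> ('a set \<Rightarrow> complex) \<Rightarrow> ('a set \<Rightarrow> complex)) \<Rightarrow>
   'a \<Rightarrow> ('a \<Rightarrow> 'a) \<Rightarrow> 'a measure \<Rightarrow> ('a \<Rightarrow> 'a \<Rightarrow> real) \<Rightarrow> real \<Rightarrow> real \<Rightarrow>
   ('a \<Rightarrow> complex) \<Rightarrow> 'a \<Rightarrow> bool"
  where "fractional_integral_converges conv e invol M \<rho> N \<alpha> f x \<longleftrightarrow>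
    translation conv x (riesz_kernel \<rho> e N \<alpha>) \<in> borel_measurable (completion M) \<and>
    (\<lambda>y. f (invol y)) \<in> borel_measurable (completion M) \<and>
    (\<integral>\<^sup>+ y. translation conv x (riesz_kernel \<rho> e N \<alpha>) y * ennreal (cmod (f (invol y)))
       \<partial>completion M) < \<infinity>"


section \<open>Lorentz spaces\<close>

text \<open>
  Measurability with respect to a Borel measure \<open>M\<close> means measurability with respect to its
  completion. For the \<open>\<sigma>\<close>-finite measures considered here this is the same as
  Caratheodory measurability.
\<close>

definition distribution_fun :: "'a measure \<Rightarrow> ('a \<Rightarrow> complex) \<Rightarrow> real \<Rightarrow> ennreal"
  where "distribution_fun M f s = emeasure (completion M) {x\<in>space M. s < cmod (f x)}"

definition rearrangement :: "'a measure \<Rightarrow> ('a \<Rightarrow> complex) \<Rightarrow> real \<Rightarrow> ennreal"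
  where "rearrangement M f t =
    (INF s\<in>{s. 0 < s \<and> distribution_fun M f s \<le> ennreal t}. ennreal s)"

definition maximal_rearrangement :: "'a measure \<Rightarrow> ('a \<Rightarrow> complex) \<Rightarrow> real \<Rightarrow> ennreal"
  where "maximal_rearrangement M f t =
    ennreal (1 / t) * (\<integral>\<^sup>+ u\<in>{0<..<t}. rearrangement M f u \<partial>lborel)"

text \<open>Powers of extended nonnegative reals, for positive exponents.\<close>

definition epowr :: "ennreal \<Rightarrow> real \<Rightarrow> ennreal"
  where "epowr x a = (if x = \<infinity> then \<infinity> else ennreal (enn2real x powr a))"

definition lorentz_norm :: "'a measure \<Rightarrow> real \<Rightarrow> ennreal \<Rightarrow> ('a \<Rightarrow> complex) \<Rightarrow> ennreal"
  where "lorentz_norm M p q f =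
    (if q = \<infinity>
     then (SUP t\<in>{0<..}. ennreal (t powr (1 / p)) * maximal_rearrangement M f t)
     else epowr
       (\<integral>\<^sup>+ t\<in>{0<..}.
          epowr (ennreal (t powr (1 / p)) * maximal_rearrangement M f t) (enn2real q)
            * ennreal (1 / t) \<partial>lborel)
       (1 / enn2real q))"

definition lorentz_space :: "'a measure \<Rightarrow> real \<Rightarrow> ennreal \<Rightarrow> ('a \<Rightarrow> complex) set"
  where "lorentz_space M p q =
    {f\<in>borel_measurable (completion M). lorentz_norm M p q f < \<infinity>}"

end

theory Submission
  imports Defs "HOL-Probability.Giry_Monad"
begin

text \<open>
  Only the function \<open>\<rho> e\<close> matters. Put \<open>a = \<alpha> / N\<close> and \<open>V = A * (\<rho> e) powr N\<close>, so that
  \<open>{V < u}\<close> has measure \<open>u\<close> and the Riesz kernel is \<open>A powr (1 - a) * V powr (a - 1)\<close>, a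
  superposition of the indicators of the sets \<open>{V < u}\<close> with density \<open>(1 - a) * u powr (a - 2)\<close>.
  The translate of such an indicator takes values in \<open>[0, 1]\<close> and has integral \<open>u\<close> in each
  variable. Splitting the superposition at \<open>u = t\<close> and \<open>\<bar>f\<bar>\<close> at the height of its rearrangement
  at \<open>t\<close> bounds the maximal rearrangement of the fractional integral at \<open>t\<close> by a constant times
  the integral over \<open>u > t\<close> of \<open>u powr (a - 1)\<close> times the maximal rearrangement of \<open>f\<close> at \<open>u\<close>,
  and Hardy's inequality finishes the proof.

  The space need not be second countable, so iterated integrals of functions that are Borel on
  the product are exchanged by means of the regularity of the measures. The invariance of the
  Haar measure \<open>\<lambda>\<close> under the involution is needed to compare \<open>f\<close> with \<open>f \<circ> invol\<close>. It follows by
  computing the integral of \<open>(\<delta>\<^sub>v * \<delta>\<^sub>u)(W)\<close> over \<open>u \<in> U\<close> and all \<open>v\<close> in both orders, for a small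
  neighbourhood \<open>W\<close> of \<open>e\<close>: one order gives \<open>\<lambda>(U) \<lambda>(W)\<close>, the other at least \<open>\<lambda>(C) \<lambda>(W)\<close> whenever
  \<open>C\<close> is compact and its image under the involution lies in the open set \<open>U\<close>.
\<close>

section \<open>Iterated integrals with respect to regular measures\<close>

text \<open>The layers are cut by the measure of a sublevel set and not by distance, so that one
  \<open>t\<close> is both the cut of the kernel and the argument of the rearrangement. Since
  \<open>t\<close> times the maximal rearrangement is the K-functional of \<open>L^1\<close> and
  \<open>L^\<infinity>\<close>, any splitting of the potential into an integrable function and a
  constant bounds it; no rearrangement of a convolution is computed, and \<open>p = 1\<close> is no
  special case. The low layers, of mass \<open>(1 - a) * t powr a / a\<close>, are absorbed into the
  tail integral because the integrated rearrangement increases. Together with the high layers they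
  give the factor \<open>(1 - a) / a\<close>, at most \<open>1 / a\<close>, and Hardy's inequality
  gives \<open>r\<close>, so that the constant reached is a third of \<open>C\<close>. The main
  obstacle is measurability. The convolution is weakly continuous, so its values on Borel sets are
  Borel functions on the product space, but need not be product measurable; the balls and
  \<open>f\<close> are measurable for the completion only. Hence the Fubini theorem for regular
  measures, and the passage to Borel versions, which is harmless as null sets stay negligible under
  translation and involution.\<close>

definition compact_inner_regular :: "'a::topological_space measure \<Rightarrow> bool"
  where "compact_inner_regular M \<longleftrightarrow> sets M = sets borel \<and>
    (\<forall>E\<in>sets borel. emeasure M E = (SUP C\<in>{C. compact C \<and> C \<subseteq> E}. emeasure M C))"

lemma compact_inner_regularD:
  assumes "compact_inner_regular M"
  shows "sets M = sets borel" and "space M = UNIV"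
    and "E \<in> sets borel \<Longrightarrow> emeasure M E = (SUP C\<in>{C. compact C \<and> C \<subseteq> E}. emeasure M C)"
  using assms sets_eq_imp_space_eq[of M borel] by (auto simp: compact_inner_regular_def)

lemma compact_inner_regular_less:
  assumes "compact_inner_regular M" "E \<in> sets borel" "a < emeasure M E"
  obtains C where "compact C" "C \<subseteq> E" "a < emeasure M C"
  using assms compact_inner_regularD(3)[OF assms(1,2)] by (auto simp: less_SUP_iff)

lemma compact_borel: "compact C \<Longrightarrow> (C :: 'a::t2_space set) \<in> sets borel"
  by (intro borel_closed compact_imp_closed)

lemma Pair_vimage_borel:
  assumes "E \<in> sets borel"
  shows "Pair x -` E \<in> sets borel" "(\<lambda>x. (x, y)) -` E \<in> sets borel"
proof -
  have "Pair x -` E \<inter> space borel \<in> sets borel"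
    by (rule measurable_sets[OF _ assms]) (auto intro!: borel_measurable_continuous_onI continuous_intros)
  moreover have "(\<lambda>x. (x, y)) -` E \<inter> space borel \<in> sets borel"
    by (rule measurable_sets[OF _ assms]) (auto intro!: borel_measurable_continuous_onI continuous_intros)
  ultimately show "Pair x -` E \<in> sets borel" "(\<lambda>x. (x, y)) -` E \<in> sets borel" by auto
qed

text \<open>A compact part of one section with measure above \<open>a\<close> lies, by the tube
  lemma, in all nearby sections; the measure of the sections of an open set is therefore lower
  semicontinuous.\<close>

lemma open_emeasure_section_greater:
  fixes O' :: "('a::topological_space \<times> 'b::topological_space) set"
  assumes M: "compact_inner_regular M" and O': "open O'"
  shows "open {x. a < emeasure M (Pair x -` O')}"
proof (subst open_subopen, safe)
  fix x assume a: "a < emeasure M (Pair x -` O')"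
  have "Pair x -` O' \<in> sets borel" using O' by (intro Pair_vimage_borel) auto
  from compact_inner_regular_less[OF M this a] obtain C where
    C: "compact C" "C \<subseteq> Pair x -` O'" "a < emeasure M C" by blast
  then have "{x} \<times> C \<subseteq> O'" by auto
  from Elementary_Topology.tube_lemma[OF C(1) O' this] obtain V where V: "x \<in> V" "open V" "V \<times> C \<subseteq> O'" by blast
  show "\<exists>T. open T \<and> x \<in> T \<and> T \<subseteq> {x. a < emeasure M (Pair x -` O')}"
  proof (intro exI[of _ V] conjI V(1,2) subsetI CollectI)
    fix y assume "y \<in> V"
    then have "C \<subseteq> Pair y -` O'" using V(3) by auto
    then have "emeasure M C \<le> emeasure M (Pair y -` O')"
      using O' compact_inner_regularD(1)[OF M] by (intro emeasure_mono) (auto intro: Pair_vimage_borel)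
    with C(3) show "a < emeasure M (Pair y -` O')" by simp
  qed
qed

lemma emeasure_open_section_measurable:
  fixes O' :: "('a::topological_space \<times> 'b::topological_space) set"
  assumes "compact_inner_regular M" and "open O'"
  shows "(\<lambda>x. emeasure M (Pair x -` O')) \<in> borel_measurable borel"
  by (rule borel_measurableI_greater) (auto intro!: borel_open open_emeasure_section_greater assms)

text \<open>The exceptional null set in \<open>rect\<close> may depend on the rectangle, and there
  may be uncountably many rectangles. On a compact set of bad \<open>x\<close> the tube lemma and
  compactness leave finitely many of them, and inner regularity of \<open>M1\<close> passes from
  compact sets of bad \<open>x\<close> to all bad \<open>x\<close>.\<close>

lemma AE_section_eq:
  fixes O' R :: "('a::t2_space \<times> 'b::t2_space) set"
  assumes M1: "compact_inner_regular M1" and M2: "compact_inner_regular M2"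
    and "sigma_finite_measure M2"
    and O': "open O'" and RO: "R \<subseteq> O'" and R: "R \<in> sets (M1 \<Otimes>\<^sub>M M2)"
    and rect: "\<And>V D. open V \<Longrightarrow> compact D \<Longrightarrow> V \<times> D \<subseteq> O' \<Longrightarrow>
      AE x in M1. x \<in> V \<longrightarrow> emeasure M2 D \<le> emeasure M2 (Pair x -` R)"
  shows "AE x in M1. emeasure M2 (Pair x -` R) = emeasure M2 (Pair x -` O')"
proof -
  interpret M2: sigma_finite_measure M2 by fact
  note sets1[measurable_cong] = compact_inner_regularD(1)[OF M1]
  note sets2[measurable_cong] = compact_inner_regularD(1)[OF M2]
  have sp: "space M1 = UNIV" by (rule compact_inner_regularD(2)[OF M1])
  have mR: "(\<lambda>x. emeasure M2 (Pair x -` R)) \<in> borel_measurable M1"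
    by (rule M2.measurable_emeasure_Pair[OF R])
  have mO: "(\<lambda>x. emeasure M2 (Pair x -` O')) \<in> borel_measurable M1"
    using emeasure_open_section_measurable[OF M2 O'] by simp
  have le: "emeasure M2 (Pair x -` R) \<le> emeasure M2 (Pair x -` O')" for x
    using RO O' by (intro emeasure_mono) (auto simp: sets2 intro: Pair_vimage_borel)
  \<comment> \<open>A level \<open>a\<close> strictly between the two measures makes badness of
    \<open>x\<close> visible on one compact set; rational levels suffice.\<close>
  define Z where "Z a = {x. emeasure M2 (Pair x -` R) < a \<and> a < emeasure M2 (Pair x -` O')}" for a
  have Zb: "Z a \<in> sets M1" for a
  proof -
    have "{x\<in>space M1. emeasure M2 (Pair x -` R) < a \<and> a < emeasure M2 (Pair x -` O')} \<in> sets M1"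
      using mR mO by measurable
    then show ?thesis by (simp add: Z_def sp)
  qed
  have C0: "emeasure M1 C = 0" if C: "compact C" "C \<subseteq> Z a" for C a
  proof -
    have Cb: "C \<in> sets M1" using C(1) by (simp add: compact_borel sets1)
    have "\<exists>V. open V \<and> x \<in> V \<and> emeasure M1 (V \<inter> C) = 0" if "x \<in> C" for x
    proof -
      have "a < emeasure M2 (Pair x -` O')" using that C(2) by (auto simp: Z_def)
      moreover have "Pair x -` O' \<in> sets borel" using O' by (intro Pair_vimage_borel) auto
      ultimately obtain D where D: "compact D" "D \<subseteq> Pair x -` O'" "a < emeasure M2 D"
        using compact_inner_regular_less[OF M2] by blast
      then have "{x} \<times> D \<subseteq> O'" by auto
      from Elementary_Topology.tube_lemma[OF D(1) O' this] obtain V where V: "x \<in> V" "open V" "V \<times> D \<subseteq> O'" by blast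
      have VC: "V \<inter> C \<in> sets M1" using V(2) Cb by (auto simp: sets1)
      from rect[OF V(2) D(1) V(3)] have "AE y in M1. y \<notin> V \<inter> C"
      proof eventually_elim
        case (elim y)
        show ?case
        proof
          assume "y \<in> V \<inter> C"
          with elim have "emeasure M2 D \<le> emeasure M2 (Pair y -` R)" by auto
          also have "\<dots> < a" using \<open>y \<in> V \<inter> C\<close> C(2) by (auto simp: Z_def)
          finally show False using D(3) by simp
        qed
      qed
      then have "emeasure M1 (V \<inter> C) = 0"
        using AE_iff_null_sets[OF VC] by (simp only: null_sets_def) simp
      with V show ?thesis by blast
    qed
    then have "\<forall>x\<in>C. \<exists>V. open V \<and> x \<in> V \<and> emeasure M1 (V \<inter> C) = 0" by blast
    from bchoice[OF this] obtain V
      where V: "\<And>x. x \<in> C \<Longrightarrow> open (V x) \<and> x \<in> V x \<and> emeasure M1 (V x \<inter> C) = 0" by blast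
    have "C \<subseteq> (\<Union>x\<in>C. V x)" using V by auto
    with C(1) obtain F where F: "F \<subseteq> C" "finite F" "C \<subseteq> (\<Union>x\<in>F. V x)"
      using compactE_image[of C C V] V by metis
    have "emeasure M1 C \<le> emeasure M1 (\<Union>x\<in>F. V x \<inter> C)"
    proof (rule emeasure_mono)
      show "(\<Union>x\<in>F. V x \<inter> C) \<in> sets M1"
        using F V Cb by (intro sets.finite_UN) (auto simp: sets1)
    qed (use F in auto)
    also have "\<dots> \<le> (\<Sum>x\<in>F. emeasure M1 (V x \<inter> C))"
      using F V Cb by (intro emeasure_subadditive_finite) (auto simp: sets1)
    also have "\<dots> = 0" using F V by (auto intro!: sum.neutral)
    finally show ?thesis by simp
  qed
  have Z0: "emeasure M1 (Z a) = 0" for a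
  proof -
    have "emeasure M1 (Z a) = (SUP C\<in>{C. compact C \<and> C \<subseteq> Z a}. emeasure M1 C)"
      using Zb[of a] by (intro compact_inner_regularD(3)[OF M1]) (simp add: sets1)
    also have "\<dots> = (SUP C\<in>{C. compact C \<and> C \<subseteq> Z a}. 0)"
      by (intro SUP_cong refl) (auto intro: C0)
    also have "\<dots> = 0" by (auto intro!: antisym SUP_least)
    finally show ?thesis .
  qed
  have "AE x in M1. \<forall>q::rat. x \<notin> Z (ennreal (of_rat q))"
    unfolding AE_all_countable using Z0 Zb by (auto simp: AE_iff_null_sets[symmetric] null_sets_def)
  then show ?thesis
  proof eventually_elim
    case (elim x)
    show ?case
    proof (rule ccontr)
      assume "\<not> ?thesis"
      with le[of x] have "emeasure M2 (Pair x -` R) < emeasure M2 (Pair x -` O')" by simp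
      from ennreal_rat_dense[OF this] obtain q where
        "emeasure M2 (Pair x -` R) < ennreal (of_rat q)" "ennreal (of_rat q) < emeasure M2 (Pair x -` O')"
        by blast
      with elim show False by (auto simp: Z_def)
    qed
  qed
qed

text \<open>
  Without second countability, an open set need not belong to the product \<open>\<sigma>\<close>-algebra. But the
  largest product-measurable subset of it, up to null sets, has almost everywhere full sections.
\<close>

lemma nn_integral_open_sections_swap:
  fixes O' :: "('a::t2_space \<times> 'b::t2_space) set"
  assumes M1: "compact_inner_regular M1" and M2: "compact_inner_regular M2"
    and f1: "finite_measure M1" and f2: "finite_measure M2" and O': "open O'"
  shows "(\<integral>\<^sup>+x. emeasure M2 (Pair x -` O') \<partial>M1) = (\<integral>\<^sup>+y. emeasure M1 ((\<lambda>x. (x, y)) -` O') \<partial>M2)"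
proof -
  interpret M1: finite_measure M1 by fact
  interpret M2: finite_measure M2 by fact
  interpret P: pair_sigma_finite M1 M2 ..
  interpret PF: finite_measure "M1 \<Otimes>\<^sub>M M2" by (rule finite_measure_pair_measure) unfold_locales
  note sets1[measurable_cong] = compact_inner_regularD(1)[OF M1]
  note sets2[measurable_cong] = compact_inner_regularD(1)[OF M2]
  let ?P = "M1 \<Otimes>\<^sub>M M2"
  let ?C = "{R\<in>sets ?P. R \<subseteq> O'}"
  have "?C \<noteq> {}" by auto
  \<comment> \<open>The supremum is approached along a sequence, and the union of that sequence
    attains it.\<close>
  from ennreal_SUP_countable_SUP[OF this, of "emeasure ?P"] obtain g :: "nat \<Rightarrow> ennreal" where
    g: "range g \<subseteq> emeasure ?P ` ?C" "Sup (emeasure ?P ` ?C) = Sup (range g)" by blast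
  then have "\<forall>n. \<exists>R\<in>?C. g n = emeasure ?P R" by (auto simp: image_subset_iff) 
  then obtain Rn where Rn: "\<And>n. Rn n \<in> ?C" "\<And>n. g n = emeasure ?P (Rn n)" by metis
  define R where "R = (\<Union>n. Rn n)"
  have R: "R \<in> sets ?P" "R \<subseteq> O'" using Rn by (auto simp: R_def)
  have max: "emeasure ?P Q \<le> emeasure ?P R" if "Q \<in> ?C" for Q
  proof -
    have "emeasure ?P Q \<le> Sup (range g)" unfolding g(2)[symmetric] using that by (rule SUP_upper)
    also have "\<dots> \<le> emeasure ?P R"
      using Rn(1) by (auto simp: Rn(2) intro!: SUP_least emeasure_mono simp: R_def)
    finally show ?thesis .
  qed
  \<comment> \<open>Adjoining \<open>Q - R\<close> to \<open>R\<close> cannot raise the maximal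
    measure, and finiteness allows cancellation.\<close>
  have null: "Q - R \<in> null_sets ?P" if Q: "Q \<in> ?C" for Q
  proof -
    have "emeasure ?P R + emeasure ?P (Q - R) = emeasure ?P (R \<union> (Q - R))"
      using Q R by (intro plus_emeasure) auto
    also have "\<dots> \<le> emeasure ?P R" using Q R by (intro max) auto
    finally have "emeasure ?P (Q - R) = 0"
      using PF.emeasure_finite[of R] by (metis add.right_neutral ennreal_add_left_cancel_le le_zero_eq infinity_ennreal_def)
    then show ?thesis using Q R by auto
  qed
  have AE1: "AE x in M1. emeasure M2 (Pair x -` R) = emeasure M2 (Pair x -` O')"
  proof (rule AE_section_eq[OF M1 M2 _ O' R(2,1)])
    show "sigma_finite_measure M2" ..
    fix V D assume V: "open (V :: 'a set)" and D: "compact (D :: 'b set)" and VD: "V \<times> D \<subseteq> O'"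
    have DM: "D \<in> sets M2" using D by (simp add: sets2 compact_borel)
    \<comment> \<open>Rectangles are product measurable, so \<open>R\<close> contains this one up to
      a null set, almost all of whose sections are null.\<close>
    have "V \<times> D \<in> ?C" using V DM VD by (auto simp: sets1)
    from P.AE_pair[OF AE_not_in[OF null[OF this]]]
    have "AE x in M1. AE y in M2. (x, y) \<notin> V \<times> D - R" .
    then show "AE x in M1. x \<in> V \<longrightarrow> emeasure M2 D \<le> emeasure M2 (Pair x -` R)"
    proof eventually_elim
      case (elim x)
      show ?case
      proof
        assume "x \<in> V"
        with elim have "AE y in M2. y \<in> D \<longrightarrow> y \<in> Pair x -` R" by auto
        then show "emeasure M2 D \<le> emeasure M2 (Pair x -` R)"
          using sets_Pair1[OF R(1)] by (intro emeasure_mono_AE) auto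
      qed
    qed
  qed
  have AE2: "AE y in M2. emeasure M1 (Pair y -` prod.swap -` R) = emeasure M1 (Pair y -` prod.swap -` O')"
  proof (rule AE_section_eq[OF M2 M1])
    show "sigma_finite_measure M1" ..
    show "open (prod.swap -` O' :: ('b \<times> 'a) set)"
      using O' by (intro open_vimage continuous_on_swap)
    show "prod.swap -` R \<subseteq> (prod.swap -` O' :: ('b \<times> 'a) set)" using R by auto
    have "prod.swap -` R \<inter> space (M2 \<Otimes>\<^sub>M M1) \<in> sets (M2 \<Otimes>\<^sub>M M1)"
      using measurable_sets[OF measurable_pair_swap' R(1)]
      by (simp add: case_prod_beta' prod.swap_def[abs_def])
    then show "prod.swap -` R \<in> sets (M2 \<Otimes>\<^sub>M M1)"
      by (simp add: space_pair_measure compact_inner_regularD(2)[OF M1] compact_inner_regularD(2)[OF M2])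
    fix V D assume V: "open (V :: 'b set)" and D: "compact (D :: 'a set)"
      and VD: "V \<times> D \<subseteq> prod.swap -` O'"
    have DM: "D \<in> sets M1" using D by (simp add: sets1 compact_borel)
    have DV: "D \<times> V \<in> ?C" using V DM VD by (auto simp: sets2)
    from P.AE_pair[OF AE_not_in[OF null[OF DV]]]
    have "AE x in M1. AE y in M2. (x, y) \<notin> D \<times> V - R" .
    moreover have "{z\<in>space ?P. (fst z, snd z) \<notin> D \<times> V - R} \<in> sets ?P"
    proof -
      have "{z\<in>space ?P. (fst z, snd z) \<notin> D \<times> V - R} = space ?P - (D \<times> V - R)" by auto
      then show ?thesis using DV R by auto
    qed
    ultimately have "AE y in M2. AE x in M1. (x, y) \<notin> D \<times> V - R"
      using P.AE_commute[of "\<lambda>x y. (x, y) \<notin> D \<times> V - R"] by blast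
    then show "AE y in M2. y \<in> V \<longrightarrow> emeasure M1 D \<le> emeasure M1 (Pair y -` prod.swap -` R)"
    proof eventually_elim
      case (elim y)
      show ?case
      proof
        assume "y \<in> V"
        with elim have "AE x in M1. x \<in> D \<longrightarrow> x \<in> Pair y -` prod.swap -` R" by auto
        then show "emeasure M1 D \<le> emeasure M1 (Pair y -` prod.swap -` R)"
          using sets_Pair2[OF R(1), of y] by (intro emeasure_mono_AE) (auto simp: vimage_def)
      qed
    qed
  qed
  have "(\<integral>\<^sup>+x. emeasure M2 (Pair x -` O') \<partial>M1) = (\<integral>\<^sup>+x. emeasure M2 (Pair x -` R) \<partial>M1)"
    using AE1 by (intro nn_integral_cong_AE) auto
  also have "\<dots> = emeasure ?P R" by (rule M2.emeasure_pair_measure_alt[OF R(1), symmetric])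
  also have "\<dots> = (\<integral>\<^sup>+y. emeasure M1 ((\<lambda>x. (x, y)) -` R) \<partial>M2)"
    by (rule P.emeasure_pair_measure_alt2[OF R(1)])
  also have "\<dots> = (\<integral>\<^sup>+y. emeasure M1 ((\<lambda>x. (x, y)) -` O') \<partial>M2)"
    using AE2 by (intro nn_integral_cong_AE) (auto simp: vimage_def)
  finally show ?thesis .
qed

text \<open>Measurability of the inner integrals is bundled with the exchange: for functions that
  are Borel on the product space it does not come from the product \<sigma>-algebra, and the
  induction over functions needs both together.\<close>

definition sections_swap :: "'a measure \<Rightarrow> 'b measure \<Rightarrow> ('a::topological_space \<times> 'b::topological_space \<Rightarrow> ennreal) \<Rightarrow> bool"
  where "sections_swap M1 M2 F \<longleftrightarrow>
    (\<lambda>x. \<integral>\<^sup>+y. F (x, y) \<partial>M2) \<in> borel_measurable borel \<and>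
    (\<lambda>y. \<integral>\<^sup>+x. F (x, y) \<partial>M1) \<in> borel_measurable borel \<and>
    (\<integral>\<^sup>+x. \<integral>\<^sup>+y. F (x, y) \<partial>M2 \<partial>M1) = (\<integral>\<^sup>+y. \<integral>\<^sup>+x. F (x, y) \<partial>M1 \<partial>M2)"

lemma borel_measurable_section:
  assumes "F \<in> borel_measurable (borel :: ('a::topological_space \<times> 'b::topological_space) measure)"
  shows "(\<lambda>x. F (x, y)) \<in> borel_measurable borel" "(\<lambda>y. F (x, y)) \<in> borel_measurable borel"
proof -
  have "(\<lambda>x. (x, y)) \<in> (borel :: 'a measure) \<rightarrow>\<^sub>M borel" "Pair x \<in> (borel :: 'b measure) \<rightarrow>\<^sub>M borel"
    by (auto intro!: borel_measurable_continuous_onI continuous_intros)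
  then show "(\<lambda>x. F (x, y)) \<in> borel_measurable borel" "(\<lambda>y. F (x, y)) \<in> borel_measurable borel"
    using measurable_compose[OF _ assms, of "\<lambda>x. (x, y)"] measurable_compose[OF _ assms, of "Pair x"] by auto
qed

text \<open>Open sets are stable under intersection and generate the Borel sets of the product
  space, so Dynkin's theorem applies. Finiteness is used for complements, where measures are
  subtracted.\<close>

lemma sections_swap_indicator:
  fixes E :: "('a::t2_space \<times> 'b::t2_space) set"
  assumes M1: "compact_inner_regular M1" and M2: "compact_inner_regular M2"
    and f1: "finite_measure M1" and f2: "finite_measure M2" and E: "E \<in> sets borel"
  shows "sections_swap M1 M2 (indicator E)"
proof -
  interpret M1: finite_measure M1 by fact
  interpret M2: finite_measure M2 by fact
  note sets1[measurable_cong] = compact_inner_regularD(1)[OF M1]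
  note sets2[measurable_cong] = compact_inner_regularD(1)[OF M2]
  note sp = compact_inner_regularD(2)[OF M1] compact_inner_regularD(2)[OF M2]
  note vim = Pair_vimage_borel
  let ?e2 = "\<lambda>E x. emeasure M2 (Pair x -` E)"
  let ?e1 = "\<lambda>E y. emeasure M1 ((\<lambda>x. (x, y)) -` E)"
  have "Int_stable {S :: ('a \<times> 'b) set. open S}" "{S :: ('a \<times> 'b) set. open S} \<subseteq> Pow UNIV"
    "E \<in> sigma_sets UNIV {S. open S}" using E by (auto simp: borel_def Int_stable_def)
  then have "?e2 E \<in> borel_measurable borel \<and> ?e1 E \<in> borel_measurable borel \<and>
    (\<integral>\<^sup>+x. ?e2 E x \<partial>M1) = (\<integral>\<^sup>+y. ?e1 E y \<partial>M2)"
  proof (induction rule: sigma_sets_induct_disjoint)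
    case (basic S)
    then have S: "open S" by simp
    have "?e1 S = (\<lambda>y. emeasure M1 (Pair y -` prod.swap -` S))"
      by (auto simp: vimage_def)
    moreover have "open (prod.swap -` S :: ('b \<times> 'a) set)"
      using S by (intro open_vimage continuous_on_swap)
    ultimately show ?case
      using emeasure_open_section_measurable[OF M2 S]
        emeasure_open_section_measurable[OF M1, of "prod.swap -` S"]
        nn_integral_open_sections_swap[OF M1 M2 f1 f2 S] by simp
  next
    case (compl B)
    then have B: "B \<in> sets borel" by (simp add: borel_def)
    have [measurable]: "?e2 B \<in> borel_measurable borel" "?e1 B \<in> borel_measurable borel"
      using compl by auto
    have "?e2 (UNIV - B) = (\<lambda>x. emeasure M2 UNIV - ?e2 B x)"
      using emeasure_compl[of _ M2] vim(1)[OF B] 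
      by (auto simp: vimage_Diff sp sets2 M2.emeasure_finite intro!: ext)
    moreover have "?e1 (UNIV - B) = (\<lambda>x. emeasure M1 UNIV - ?e1 B x)"
      using emeasure_compl[of _ M1] vim(2)[OF B]
      by (auto simp: vimage_Diff sp sets1 M1.emeasure_finite intro!: ext)
    moreover have "(\<integral>\<^sup>+x. emeasure M2 UNIV - ?e2 B x \<partial>M1) = (\<integral>\<^sup>+x. emeasure M2 UNIV \<partial>M1) - (\<integral>\<^sup>+x. ?e2 B x \<partial>M1)"
    proof (rule nn_integral_diff)
      have "(\<integral>\<^sup>+x. ?e2 B x \<partial>M1) \<le> (\<integral>\<^sup>+x. emeasure M2 UNIV \<partial>M1)"
        using vim(1)[OF B] by (intro nn_integral_mono emeasure_mono) (auto simp: sets2)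
      also have "\<dots> < \<infinity>" using M1.emeasure_finite M2.emeasure_finite
        by (simp add: ennreal_mult_eq_top_iff top.not_eq_extremum[symmetric])
      finally show "(\<integral>\<^sup>+x. ?e2 B x \<partial>M1) \<noteq> \<infinity>" by simp
    qed (use vim(1)[OF B] in \<open>auto simp: sets2 intro!: emeasure_mono\<close>)
    moreover have "(\<integral>\<^sup>+x. emeasure M1 UNIV - ?e1 B x \<partial>M2) = (\<integral>\<^sup>+x. emeasure M1 UNIV \<partial>M2) - (\<integral>\<^sup>+x. ?e1 B x \<partial>M2)"
    proof (rule nn_integral_diff)
      have "(\<integral>\<^sup>+x. ?e1 B x \<partial>M2) \<le> (\<integral>\<^sup>+x. emeasure M1 UNIV \<partial>M2)"
        using vim(2)[OF B] by (intro nn_integral_mono emeasure_mono) (auto simp: sets1)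
      also have "\<dots> < \<infinity>" using M1.emeasure_finite M2.emeasure_finite
        by (simp add: ennreal_mult_eq_top_iff top.not_eq_extremum[symmetric])
      finally show "(\<integral>\<^sup>+x. ?e1 B x \<partial>M2) \<noteq> \<infinity>" by simp
    qed (use vim(2)[OF B] in \<open>auto simp: sets1 intro!: emeasure_mono\<close>)
    ultimately show ?case using compl by (simp add: sp mult.commute)
  next
    case (union B)
    then have B: "\<And>i. B i \<in> sets borel" by (auto simp: borel_def)
    have [measurable]: "\<And>i. ?e2 (B i) \<in> borel_measurable borel" "\<And>i. ?e1 (B i) \<in> borel_measurable borel"
      using union by auto
    have disj: "disjoint_family (\<lambda>i. Pair x -` B i)" "disjoint_family (\<lambda>i. (\<lambda>x. (x, y)) -` B i)" for x y
      using union(1) unfolding disjoint_family_on_def by blast+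
    have "?e2 (\<Union>i. B i) = (\<lambda>x. \<Sum>i. ?e2 (B i) x)"
      using disj vim(1)[OF B] by (auto simp: vimage_UN sets2 intro!: ext suminf_emeasure[symmetric])
    moreover have "?e1 (\<Union>i. B i) = (\<lambda>x. \<Sum>i. ?e1 (B i) x)"
      using disj vim(2)[OF B] by (auto simp: vimage_UN sets1 intro!: ext suminf_emeasure[symmetric])
    ultimately show ?case using union by (simp add: nn_integral_suminf)
  qed auto
  moreover have "(\<integral>\<^sup>+y. indicator E (x, y) \<partial>M2) = ?e2 E x" for x
    using vim(1)[OF E, of x] nn_integral_indicator[of "Pair x -` E" M2]
    by (simp add: sets2 indicator_vimage)
  moreover have "(\<integral>\<^sup>+x. indicator E (x, y) \<partial>M1) = ?e1 E y" for y
    using vim(2)[OF E, of y] nn_integral_indicator[of "(\<lambda>x. (x, y)) -` E" M1]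
    by (simp add: sets1 indicator_vimage)
  ultimately show ?thesis by (simp add: sections_swap_def)
qed

lemma sections_swap_finite:
  fixes F :: "'a::t2_space \<times> 'b::t2_space \<Rightarrow> ennreal"
  assumes M1: "compact_inner_regular M1" and M2: "compact_inner_regular M2"
    and f1: "finite_measure M1" and f2: "finite_measure M2" and F: "F \<in> borel_measurable borel"
  shows "sections_swap M1 M2 F"
proof -
  note sets1[measurable_cong] = compact_inner_regularD(1)[OF M1]
  note sets2[measurable_cong] = compact_inner_regularD(1)[OF M2]
  note sec[measurable] = borel_measurable_section
  show ?thesis
    using F
  proof (induction rule: borel_measurable_induct)
    case (cong f g)
    then have "f = g" by auto
    with cong show ?case by simp
  next
    case (set A)
    then show ?case by (rule sections_swap_indicator[OF M1 M2 f1 f2])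
  next
    case (mult u c)
    note [measurable] = mult(2)
    have "(\<lambda>x. \<integral>\<^sup>+y. u (x, y) \<partial>M2) \<in> borel_measurable borel" "(\<lambda>y. \<integral>\<^sup>+x. u (x, y) \<partial>M1) \<in> borel_measurable borel"
      using mult.IH by (auto simp: sections_swap_def)
    with mult.IH sec[OF mult(2)] show ?case
      by (simp add: sections_swap_def nn_integral_cmult)
  next
    case (add u v)
    have *: "(\<lambda>x. \<integral>\<^sup>+y. u (x, y) \<partial>M2) \<in> borel_measurable borel" "(\<lambda>y. \<integral>\<^sup>+x. u (x, y) \<partial>M1) \<in> borel_measurable borel"
      "(\<lambda>x. \<integral>\<^sup>+y. v (x, y) \<partial>M2) \<in> borel_measurable borel" "(\<lambda>y. \<integral>\<^sup>+x. v (x, y) \<partial>M1) \<in> borel_measurable borel"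
      using add.IH by (auto simp: sections_swap_def)
    with add.IH sec[OF add(1)] sec[OF add(3)] show ?case
      by (simp add: sections_swap_def nn_integral_add)
  next
    case (seq U)
    have *: "(\<lambda>x. \<integral>\<^sup>+y. U i (x, y) \<partial>M2) \<in> borel_measurable borel" "(\<lambda>y. \<integral>\<^sup>+x. U i (x, y) \<partial>M1) \<in> borel_measurable borel" for i
      using seq.IH by (auto simp: sections_swap_def)
    have i: "incseq (\<lambda>i y. U i (x, y))" "incseq (\<lambda>i x. U i (x, y))" for x y
      using seq(3) by (auto simp: incseq_def le_fun_def)
    have "(\<integral>\<^sup>+y. (SUP i. U i) (x, y) \<partial>M2) = (SUP i. \<integral>\<^sup>+y. U i (x, y) \<partial>M2)" for x
      using sec[OF seq(1)] i by (subst nn_integral_monotone_convergence_SUP[symmetric]) (auto simp: image_comp)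
    moreover have "(\<integral>\<^sup>+x. (SUP i. U i) (x, y) \<partial>M1) = (SUP i. \<integral>\<^sup>+x. U i (x, y) \<partial>M1)" for y
      using sec[OF seq(1)] i by (subst nn_integral_monotone_convergence_SUP[symmetric]) (auto simp: image_comp)
    moreover have "(\<integral>\<^sup>+x. (SUP i. \<integral>\<^sup>+y. U i (x, y) \<partial>M2) \<partial>M1) = (SUP i. \<integral>\<^sup>+x. \<integral>\<^sup>+y. U i (x, y) \<partial>M2 \<partial>M1)"
      using * i by (intro nn_integral_monotone_convergence_SUP) (auto simp: incseq_def le_fun_def intro!: nn_integral_mono)
    moreover have "(\<integral>\<^sup>+y. (SUP i. \<integral>\<^sup>+x. U i (x, y) \<partial>M1) \<partial>M2) = (SUP i. \<integral>\<^sup>+y. \<integral>\<^sup>+x. U i (x, y) \<partial>M1 \<partial>M2)"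
      using * i by (intro nn_integral_monotone_convergence_SUP) (auto simp: incseq_def le_fun_def intro!: nn_integral_mono)
    ultimately show ?case
      using seq.IH * by (auto simp: sections_swap_def intro!: borel_measurable_SUP)
  qed
qed

lemma compact_inner_regular_restrict:
  fixes M :: "'a::t2_space measure"
  assumes M: "compact_inner_regular M" and B: "B \<in> sets borel"
  shows "compact_inner_regular (density M (indicator B))"
  unfolding compact_inner_regular_def
proof (intro conjI ballI)
  note sets[measurable_cong] = compact_inner_regularD(1)[OF M]
  show "sets (density M (indicator B)) = sets borel" using sets by simp
  have e: "emeasure (density M (indicator B)) E = emeasure M (B \<inter> E)" if "E \<in> sets borel" for E
    using B that by (subst emeasure_density) (auto simp: sets indicator_inter_arith[symmetric] intro!: borel_measurable_indicator)
  fix E :: "'a set" assume E: "E \<in> sets borel"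
  show "emeasure (density M (indicator B)) E =
    (SUP C\<in>{C. compact C \<and> C \<subseteq> E}. emeasure (density M (indicator B)) C)"
  proof (rule antisym)
    have "emeasure (density M (indicator B)) E = (SUP C\<in>{C. compact C \<and> C \<subseteq> B \<inter> E}. emeasure M C)"
      using compact_inner_regularD(3)[OF M, of "B \<inter> E"] E B by (simp add: e)
    also have "\<dots> \<le> (SUP C\<in>{C. compact C \<and> C \<subseteq> E}. emeasure (density M (indicator B)) C)"
      by (intro SUP_mono) (auto simp: e compact_borel Int_absorb1 intro!: exI[where P="\<lambda>C. compact C \<and> _ C"])
    finally show "emeasure (density M (indicator B)) E \<le> (SUP C\<in>{C. compact C \<and> C \<subseteq> E}. emeasure (density M (indicator B)) C)" .
  qed (use E sets in \<open>auto intro!: SUP_least emeasure_mono\<close>)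
qed

text \<open>Once \<open>x\<close> lies in some \<open>A k\<close>, passing to \<open>max i k\<close>
  removes the indicator. A single index can thus drive both the approximation and the
  exhaustion.\<close>

lemma SUP_mult_indicator:
  fixes G :: "nat \<Rightarrow> ennreal"
  assumes "incseq G" "incseq A" "x \<in> (\<Union>i. A i)"
  shows "(SUP i. G i * indicator (A i) x) = (SUP i. G i)"
proof (rule antisym)
  from assms(3) obtain k where k: "x \<in> A k" by blast
  show "(SUP i. G i) \<le> (SUP i. G i * indicator (A i) x)"
  proof (rule SUP_least)
    fix i
    have "x \<in> A (max i k)" using subsetD[OF incseqD[OF assms(2)] k] by simp
    then have "G i \<le> G (max i k) * indicator (A (max i k)) x"
      using assms(1) by (auto simp: incseq_def)
    then show "G i \<le> (SUP i. G i * indicator (A i) x)" by (rule SUP_upper2[OF UNIV_I])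
  qed
qed (auto intro!: SUP_mono simp: indicator_def)

text \<open>Both measures are cut to finite pieces with the same index \<open>i\<close>. The inner
  integrals then increase with \<open>i\<close>, and the two nested limits collapse into one
  diagonal supremum.\<close>

theorem sections_swap:
  fixes F :: "'a::t2_space \<times> 'b::t2_space \<Rightarrow> ennreal"
  assumes M1: "compact_inner_regular M1" and M2: "compact_inner_regular M2"
    and f1: "sigma_finite_measure M1" and f2: "sigma_finite_measure M2"
    and F: "F \<in> borel_measurable borel"
  shows "sections_swap M1 M2 F"
proof -
  interpret M1: sigma_finite_measure M1 by fact
  interpret M2: sigma_finite_measure M2 by fact
  note sets1[measurable_cong] = compact_inner_regularD(1)[OF M1]
  note sets2[measurable_cong] = compact_inner_regularD(1)[OF M2]
  note [measurable] = borel_measurable_section[OF F]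
  obtain A1 where A1: "range A1 \<subseteq> sets M1" "(\<Union>i. A1 i) = space M1" "\<And>i. emeasure M1 (A1 i) \<noteq> \<infinity>" "incseq A1"
    by (rule M1.sigma_finite_incseq) blast
  obtain A2 where A2: "range A2 \<subseteq> sets M2" "(\<Union>i. A2 i) = space M2" "\<And>i. emeasure M2 (A2 i) \<noteq> \<infinity>" "incseq A2"
    by (rule M2.sigma_finite_incseq) blast
  have A[measurable]: "A1 i \<in> sets borel" "A2 i \<in> sets borel" for i
    using A1(1) A2(1) by (auto simp: sets1 sets2)
  have cov: "x \<in> (\<Union>i. A1 i)" "y \<in> (\<Union>i. A2 i)" for x y
    using A1(2) A2(2) by (simp_all add: compact_inner_regularD(2)[OF M1] compact_inner_regularD(2)[OF M2])
  let ?N1 = "\<lambda>i. density M1 (indicator (A1 i))" and ?N2 = "\<lambda>i. density M2 (indicator (A2 i))"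
  have d1: "(\<integral>\<^sup>+x. G x \<partial>?N1 i) = (\<integral>\<^sup>+x. G x * indicator (A1 i) x \<partial>M1)" if [measurable]: "G \<in> borel_measurable borel" for G i
    by (subst nn_integral_density) (auto simp: mult.commute intro!: nn_integral_cong)
  have d2: "(\<integral>\<^sup>+y. G y \<partial>?N2 i) = (\<integral>\<^sup>+y. G y * indicator (A2 i) y \<partial>M2)" if [measurable]: "G \<in> borel_measurable borel" for G i
    by (subst nn_integral_density) (auto simp: mult.commute intro!: nn_integral_cong)
  have mono1: "(\<integral>\<^sup>+x. G x \<partial>?N1 i) \<le> (\<integral>\<^sup>+x. G x \<partial>?N1 j)" if "i \<le> j" "G \<in> borel_measurable borel" for G i j
    using incseqD[OF A1(4) that(1)] that by (auto simp: d1 indicator_def intro!: nn_integral_mono)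
  have mono2: "(\<integral>\<^sup>+y. G y \<partial>?N2 i) \<le> (\<integral>\<^sup>+y. G y \<partial>?N2 j)" if "i \<le> j" "G \<in> borel_measurable borel" for G i j
    using incseqD[OF A2(4) that(1)] that by (auto simp: d2 indicator_def intro!: nn_integral_mono)
  have lim1: "(\<integral>\<^sup>+x. (SUP i. G i x) \<partial>M1) = (SUP i. \<integral>\<^sup>+x. G i x \<partial>?N1 i)"
    if "incseq G" and [measurable]: "\<And>i. G i \<in> borel_measurable borel" for G
  proof -
    have "(\<integral>\<^sup>+x. (SUP i. G i x) \<partial>M1) = (\<integral>\<^sup>+x. (SUP i. G i x * indicator (A1 i) x) \<partial>M1)"
      using that(1) A1(4) cov by (subst SUP_mult_indicator) (auto simp: incseq_def le_fun_def)
    also have "\<dots> = (SUP i. \<integral>\<^sup>+x. G i x * indicator (A1 i) x \<partial>M1)"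
      using incseqD[OF that(1)] incseqD[OF A1(4), THEN subsetD]
      by (intro nn_integral_monotone_convergence_SUP)
        (auto simp: incseq_def le_fun_def intro!: mult_mono split: split_indicator)
    finally show ?thesis by (simp add: d1)
  qed
  have lim2: "(\<integral>\<^sup>+y. (SUP i. G i y) \<partial>M2) = (SUP i. \<integral>\<^sup>+y. G i y \<partial>?N2 i)"
    if "incseq G" and [measurable]: "\<And>i. G i \<in> borel_measurable borel" for G
  proof -
    have "(\<integral>\<^sup>+y. (SUP i. G i y) \<partial>M2) = (\<integral>\<^sup>+y. (SUP i. G i y * indicator (A2 i) y) \<partial>M2)"
      using that(1) A2(4) cov by (subst SUP_mult_indicator) (auto simp: incseq_def le_fun_def)
    also have "\<dots> = (SUP i. \<integral>\<^sup>+y. G i y * indicator (A2 i) y \<partial>M2)"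
      using incseqD[OF that(1)] incseqD[OF A2(4), THEN subsetD]
      by (intro nn_integral_monotone_convergence_SUP)
        (auto simp: incseq_def le_fun_def intro!: mult_mono split: split_indicator)
    finally show ?thesis by (simp add: d2)
  qed
  have fin: "finite_measure (?N1 i)" "finite_measure (?N2 i)" for i
    using A1(3) A2(3) by (auto intro!: finite_measureI simp: emeasure_density
        compact_inner_regularD(2)[OF M1] compact_inner_regularD(2)[OF M2])
  have S: "sections_swap (?N1 i) (?N2 i) F" for i
    by (intro sections_swap_finite compact_inner_regular_restrict M1 M2 fin F A)
  let ?J2 = "\<lambda>i x. \<integral>\<^sup>+y. F (x, y) \<partial>?N2 i" and ?J1 = "\<lambda>i y. \<integral>\<^sup>+x. F (x, y) \<partial>?N1 i"
  have J: "?J2 i \<in> borel_measurable borel" "?J1 i \<in> borel_measurable borel" for i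
    using S[of i] by (auto simp: sections_swap_def)
  have inc: "incseq ?J1" "incseq ?J2"
    by (auto simp: incseq_def le_fun_def intro!: mono1 mono2)
  have L: "(\<integral>\<^sup>+y. F (x, y) \<partial>M2) = (SUP i. ?J2 i x)" "(\<integral>\<^sup>+x. F (x, y) \<partial>M1) = (SUP i. ?J1 i y)" for x y
    using lim1[of "\<lambda>i x. F (x, y)"] lim2[of "\<lambda>i y. F (x, y)"] by (auto simp: incseq_def)
  have "(\<integral>\<^sup>+x. \<integral>\<^sup>+y. F (x, y) \<partial>M2 \<partial>M1) = (SUP i. \<integral>\<^sup>+x. ?J2 i x \<partial>?N1 i)"
    unfolding L by (rule lim1[OF inc(2) J(1)])
  also have "\<dots> = (SUP i. \<integral>\<^sup>+y. ?J1 i y \<partial>?N2 i)"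
    using S by (simp add: sections_swap_def)
  also have "\<dots> = (\<integral>\<^sup>+y. \<integral>\<^sup>+x. F (x, y) \<partial>M1 \<partial>M2)"
    unfolding L by (rule lim2[OF inc(1) J(2), symmetric])
  finally show ?thesis
    using J unfolding sections_swap_def by (auto simp: L intro!: borel_measurable_SUP)
qed

text \<open>The definition of a Radon measure gives inner approximation for open sets only. For
  \<open>E\<close> of finite measure take an open \<open>U\<close> around \<open>E\<close>, a
  compact \<open>C\<close> nearly filling \<open>U\<close>, and a small open \<open>V\<close> around
  \<open>U - E\<close>: then \<open>C - V\<close> is compact, lies in \<open>E\<close> and misses
  little. An exhaustion by sets of finite measure does the rest.\<close>

lemma radon_measure_compact_inner_regular:
  fixes M :: "'a::t2_space measure"
  assumes R: "radon_measure M" and "sigma_finite_measure M"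
  shows "compact_inner_regular M"
proof -
  interpret sigma_finite_measure M by fact
  note R' = R[unfolded radon_measure_def]
  note sets = R'[THEN conjunct1]
    and outer = R'[THEN conjunct2, THEN conjunct2, THEN conjunct1, THEN bspec]
    and inner = R'[THEN conjunct2, THEN conjunct2, THEN conjunct2, THEN spec, THEN mp]
  have open_super: "\<exists>U. open U \<and> E \<subseteq> U \<and> emeasure M U < emeasure M E + ennreal \<epsilon>"
    if "E \<in> sets borel" "emeasure M E < \<infinity>" "\<epsilon> > 0" for E \<epsilon>
  proof -
    have "emeasure M E < emeasure M E + ennreal \<epsilon>"
      using that by (cases "emeasure M E") (auto simp flip: ennreal_plus simp: ennreal_less_iff)
    then show ?thesis using outer[OF that(1)] by (auto simp: INF_less_iff)
  qed
  have fin: "\<exists>C. compact C \<and> C \<subseteq> E \<and> emeasure M E \<le> emeasure M C + ennreal (2 * \<epsilon>)"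
    if E: "E \<in> sets borel" "emeasure M E < \<infinity>" and \<epsilon>: "\<epsilon> > 0" for E \<epsilon>
  proof -
    obtain U where U: "open U" "E \<subseteq> U" "emeasure M U < emeasure M E + ennreal \<epsilon>"
      using open_super[OF E \<epsilon>] by blast
    have Uf: "emeasure M U < \<infinity>" using E(2) by (intro order.strict_trans[OF U(3)]) (auto simp: less_top)
    have "emeasure M (U - E) = emeasure M U - emeasure M E"
      using U E by (intro emeasure_Diff) (auto simp: sets)
    also have "\<dots> < ennreal \<epsilon>"
      using U E Uf emeasure_mono[OF U(2), of M]
      by (subst minus_less_iff_ennreal) (auto simp: sets add.commute)
    finally have UE: "emeasure M (U - E) < ennreal \<epsilon>" .
    have UEb: "U - E \<in> sets borel" using U E by auto
    have "(INF V\<in>{V. open V \<and> U - E \<subseteq> V}. emeasure M V) < ennreal \<epsilon>"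
      using outer[OF UEb] UE by simp
    then obtain V where V: "open V" "U - E \<subseteq> V" "emeasure M V < ennreal \<epsilon>"
      by (auto simp: INF_less_iff)
    have "\<exists>C. compact C \<and> C \<subseteq> U \<and> emeasure M U \<le> emeasure M C + ennreal \<epsilon>"
    \<comment> \<open>For a null \<open>U\<close>, subtracting \<epsilon> gives no strictly smaller
      value; there the empty set serves as \<open>C\<close>.\<close>
    proof (cases "emeasure M U = 0")
      case False
      then have "emeasure M U - ennreal \<epsilon> < emeasure M U"
        using Uf \<epsilon> by (intro ennreal_between[OF]) (auto simp: less_top zero_less_iff_neq_zero)
      then obtain C where "compact C" "C \<subseteq> U" "emeasure M U - ennreal \<epsilon> < emeasure M C"
        using inner[OF U(1)] by (auto simp: less_SUP_iff)
      then show ?thesis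
        by (intro exI[of _ C]) (auto simp: ennreal_minus_le_iff dest: less_imp_le simp: add.commute)
    qed (auto intro!: exI[of _ "{}"])
    then obtain C where C: "compact C" "C \<subseteq> U" "emeasure M U \<le> emeasure M C + ennreal \<epsilon>" by blast
    have Cb: "C \<in> sets borel" using C by (simp add: compact_borel)
    show ?thesis
    proof (intro exI[of _ "C - V"] conjI)
      show "compact (C - V)" using C V by (simp add: compact_diff)
      show "C - V \<subseteq> E" using C V by auto
      have "emeasure M E \<le> emeasure M U" using U E by (intro emeasure_mono) (auto simp: sets)
      also note C(3)
      also have "emeasure M C \<le> emeasure M ((C - V) \<union> V)"
        using V Cb by (intro emeasure_mono) (auto simp: sets)
      also have "\<dots> \<le> emeasure M (C - V) + emeasure M V"
        using V Cb by (intro emeasure_subadditive) (auto simp: sets)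
      also have "emeasure M V \<le> ennreal \<epsilon>" using V by simp
      finally have "emeasure M E \<le> emeasure M (C - V) + ennreal \<epsilon> + ennreal \<epsilon>"
        by (auto simp: add_mono)
      then show "emeasure M E \<le> emeasure M (C - V) + ennreal (2 * \<epsilon>)"
        using \<epsilon> by (simp add: add.assoc flip: ennreal_plus)
    qed
  qed
  obtain A where A: "range A \<subseteq> sets M" "(\<Union>i. A i) = space M" "\<And>i. emeasure M (A i) \<noteq> \<infinity>" "incseq A"
    by (rule sigma_finite_incseq) blast
  have A': "(\<Union>i. A i) = UNIV" using A(2) sets_eq_imp_space_eq[OF sets] by simp
  have Ab: "A i \<in> sets borel" for i using A(1) sets by auto
  show ?thesis
    unfolding compact_inner_regular_def
  proof (intro conjI sets ballI antisym)
    fix E :: "'a set" assume E: "E \<in> sets borel"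
    show "emeasure M E \<le> (SUP C\<in>{C. compact C \<and> C \<subseteq> E}. emeasure M C)" (is "_ \<le> ?S")
    proof -
      have "emeasure M (A i \<inter> E) \<le> ?S" for i
      proof (rule ennreal_le_epsilon)
        fix \<epsilon> :: real assume \<epsilon>: "0 < \<epsilon>"
        have "emeasure M (A i \<inter> E) \<le> emeasure M (A i)" using Ab by (intro emeasure_mono) (auto simp: sets)
        then have "emeasure M (A i \<inter> E) < \<infinity>" using A(3)[of i] by (simp add: less_top order.strict_trans1)
        from fin[OF _ this, of "\<epsilon> / 2"] obtain C where
          "compact C" "C \<subseteq> A i \<inter> E" "emeasure M (A i \<inter> E) \<le> emeasure M C + ennreal \<epsilon>"
          using \<epsilon> Ab E by auto
        moreover from this have "emeasure M C \<le> ?S" by (intro SUP_upper) auto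
        ultimately show "emeasure M (A i \<inter> E) \<le> ?S + ennreal \<epsilon>"
          by (meson add_right_mono order_trans)
      qed
      moreover have "emeasure M E = (SUP i. emeasure M (A i \<inter> E))"
        using A(4) A' E Ab by (subst SUP_emeasure_incseq) (auto simp: sets incseq_def simp flip: UN_extend_simps)
      ultimately show ?thesis by (auto intro!: SUP_least)
    qed
  qed (use sets in \<open>auto intro!: SUP_least emeasure_mono\<close>)
qed

text \<open>Inner regularity stands in for a countable subcover: only compact subsets of
  \<open>U\<close> have to be null, and finitely many null open sets cover each of them.\<close>

lemma locally_null_imp_null:
  fixes M :: "'a::t2_space measure"
  assumes M: "compact_inner_regular M" and U: "open U"
    and loc: "\<And>z. z \<in> U \<Longrightarrow> \<exists>V. open V \<and> z \<in> V \<and> emeasure M V = 0"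
  shows "emeasure M U = 0"
proof (rule ccontr)
  note sets = compact_inner_regularD(1)[OF M]
  assume "emeasure M U \<noteq> 0"
  then have "0 < emeasure M U" by (simp add: zero_less_iff_neq_zero)
  then obtain C where C: "compact C" "C \<subseteq> U" "0 < emeasure M C"
    using compact_inner_regular_less[OF M, of U 0] U by auto
  from C(2) loc have "\<forall>z\<in>C. \<exists>V. open V \<and> z \<in> V \<and> emeasure M V = 0" by blast
  from bchoice[OF this] obtain V where V: "\<And>z. z \<in> C \<Longrightarrow> open (V z) \<and> z \<in> V z \<and> emeasure M (V z) = 0"
    by blast
  have "C \<subseteq> (\<Union>z\<in>C. V z)" using V by auto
  then obtain F where F: "F \<subseteq> C" "finite F" "C \<subseteq> (\<Union>z\<in>F. V z)"
    using compactE_image[OF C(1), of C V] V by metis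
  have "emeasure M C \<le> emeasure M (\<Union>z\<in>F. V z)"
    using F V by (intro emeasure_mono) (auto simp: sets intro!: borel_open)
  also have "\<dots> \<le> (\<Sum>z\<in>F. emeasure M (V z))"
    using F V by (intro emeasure_subadditive_finite) (auto simp: sets)
  also have "\<dots> = 0" using F V by (auto intro!: sum.neutral)
  finally show False using C(3) by simp
qed

section \<open>Rearrangements\<close>

lemma borel_measurable_antimono_ennreal:
  fixes D :: "real \<Rightarrow> ennreal"
  assumes "antimono D"
  shows "D \<in> borel_measurable borel"
proof (rule borel_measurableI_greater)
  fix y
  have "is_interval {x. y < D x}"
    using assms by (auto simp: is_interval_1 antimono_def intro: less_le_trans)
  then show "{x \<in> space borel. y < D x} \<in> sets borel"
    by (simp add: real_interval_borel_measurable)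
qed

lemma borel_measurable_mono_ennreal:
  fixes D :: "real \<Rightarrow> ennreal"
  assumes "mono D"
  shows "D \<in> borel_measurable borel"
proof (rule borel_measurableI_greater)
  fix y
  have "is_interval {x. y < D x}"
    using assms by (auto simp: is_interval_1 mono_def intro: less_le_trans)
  then show "{x \<in> space borel. y < D x} \<in> sets borel"
    by (simp add: real_interval_borel_measurable)
qed

lemma nn_integral_less_ennreal:
  assumes "0 \<le> b"
  shows "(\<integral>\<^sup>+s. indicator {b<..} s * indicator {s. ennreal s < y} s \<partial>lborel) = y - ennreal b"
proof (cases y)
  case (real d)
  have "(\<integral>\<^sup>+s. indicator {b<..} s * indicator {s. ennreal s < y} s \<partial>lborel) = (\<integral>\<^sup>+s. indicator {b<..<d} s \<partial>lborel)"
    using assms real by (intro nn_integral_cong) (auto simp: indicator_def ennreal_less_iff)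
  also have "\<dots> = emeasure lborel {b<..<d}" by simp
  also have "\<dots> = y - ennreal b"
    using assms real by (cases "b \<le> d") (auto simp: ennreal_minus ennreal_neg diff_le_0_iff_le[THEN iffD2])
  finally show ?thesis .
next
  case top
  have "(\<integral>\<^sup>+s. indicator {b<..} s * indicator {s. ennreal s < y} s \<partial>lborel) = (\<integral>\<^sup>+s. indicator {b<..} s \<partial>lborel)"
    using top by (intro nn_integral_cong) (auto simp: indicator_def)
  also have "\<dots> = emeasure lborel {b<..}" by simp
  also have "\<dots> = \<infinity>"
  proof -
    have "of_nat n \<le> emeasure lborel {b<..}" for n
    proof -
      have "of_nat n = emeasure lborel {b<..<b + real n}" by (simp add: ennreal_of_nat_eq_real_of_nat)
      also have "\<dots> \<le> emeasure lborel {b<..}" by (intro emeasure_mono) auto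
      finally show ?thesis .
    qed
    then have "(SUP n. of_nat n) \<le> emeasure lborel {b<..}" by (intro SUP_least)
    then show ?thesis by (simp add: ennreal_SUP_of_nat_eq_top top.extremum_unique)
  qed
  finally show ?thesis using top by simp
qed

text \<open>The layer-cake formula for the part of \<Phi> above height \<open>b\<close>; subtraction
  in \<open>[0, \<infinity>]\<close> stops at 0, so the right side integrates a positive
  part.\<close>

lemma nn_integral_emeasure_greater:
  fixes \<Phi> :: "'a \<Rightarrow> ennreal"
  assumes "sigma_finite_measure M" and [measurable]: "\<Phi> \<in> borel_measurable M" and b: "0 \<le> b"
  shows "(\<integral>\<^sup>+s\<in>{b<..}. emeasure M {x\<in>space M. ennreal s < \<Phi> x} \<partial>lborel) = (\<integral>\<^sup>+x. (\<Phi> x - ennreal b) \<partial>M)"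
proof -
  interpret sigma_finite_measure M by fact
  interpret P: pair_sigma_finite M lborel ..
  have "(\<integral>\<^sup>+s\<in>{b<..}. emeasure M {x\<in>space M. ennreal s < \<Phi> x} \<partial>lborel) =
    (\<integral>\<^sup>+s. \<integral>\<^sup>+x. indicator {b<..} s * indicator {x\<in>space M. ennreal s < \<Phi> x} x \<partial>M \<partial>lborel)"
    by (simp add: nn_integral_cmult mult.commute)
  also have "\<dots> = (\<integral>\<^sup>+s. \<integral>\<^sup>+x. indicator {b<..} s * indicator {s. ennreal s < \<Phi> x} s \<partial>M \<partial>lborel)"
    by (intro nn_integral_cong) (auto simp: indicator_def)
  also have "\<dots> = (\<integral>\<^sup>+x. \<integral>\<^sup>+s. indicator {b<..} s * indicator {s. ennreal s < \<Phi> x} s \<partial>lborel \<partial>M)"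
    by (rule P.Fubini') measurable
  also have "\<dots> = (\<integral>\<^sup>+x. (\<Phi> x - ennreal b) \<partial>M)"
    by (simp add: nn_integral_less_ennreal[OF b])
  finally show ?thesis .
qed

lemma distribution_fun_antimono:
  assumes "F \<in> borel_measurable (completion M)"
  shows "antimono (distribution_fun M F)"
proof (rule antimonoI)
  fix s s' :: real assume "s \<le> s'"
  have "{x \<in> space (completion M). s < cmod (F x)} \<in> sets (completion M)"
    using assms by measurable
  then show "distribution_fun M F s' \<le> distribution_fun M F s"
    unfolding distribution_fun_def using \<open>s \<le> s'\<close> by (intro emeasure_mono) auto
qed

lemma rearrangement_antimono: "antimono (rearrangement M F)"
  unfolding rearrangement_def
  by (intro antimonoI INF_superset_mono) (auto intro: order_trans ennreal_leI)

text \<open>As the distribution function decreases, the levels \<open>s\<close> where it exceeds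
  \<open>u\<close> form an interval starting at 0, and the infimum in the definition is its length.
  In this form \<open>u\<close> and \<open>s\<close> can be exchanged by Fubini.\<close>

lemma rearrangement_eq_nn_integral:
  assumes D: "antimono (distribution_fun M F)"
  shows "rearrangement M F u =
    (\<integral>\<^sup>+s\<in>{0<..}. indicator {s. ennreal u < distribution_fun M F s} s \<partial>lborel)"
proof -
  define R where "R = rearrangement M F u"
  let ?D = "distribution_fun M F"
  note [measurable] = borel_measurable_antimono_ennreal[OF D]
  have 1: "ennreal u < ?D s" if "0 < s" "ennreal s < R" for s
  proof (rule ccontr)
    assume "\<not> ennreal u < ?D s"
    then have "R \<le> ennreal s" using that(1)
      unfolding R_def rearrangement_def by (intro INF_lower) auto
    then show False using that(2) by simp
  qed
  have 2: "ennreal s \<le> R" if "0 < s" "ennreal u < ?D s" for s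
    unfolding R_def rearrangement_def
  proof (rule INF_greatest, safe)
    fix s' :: real assume "0 < s'" "?D s' \<le> ennreal u"
    then have "s < s'" using that(2) D[THEN antimonoD, of s' s] by (meson leD le_less_trans not_le_imp_less)
    then show "ennreal s \<le> ennreal s'" by (intro ennreal_leI) simp
  qed
  have "(\<integral>\<^sup>+s\<in>{0<..}. indicator {s. ennreal u < ?D s} s \<partial>lborel) =
    (\<integral>\<^sup>+s. indicator {0<..} s * indicator {s. ennreal s < R} s \<partial>lborel)"
  proof (rule nn_integral_cong_AE)
    \<comment> \<open>The right endpoint of the interval may or may not belong to it.\<close>
    have "AE s in lborel. s \<noteq> enn2real R" by (rule AE_lborel_singleton)
    then show "AE s in lborel. indicator {s. ennreal u < ?D s} s * indicator {0<..} s =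
      (indicator {0<..} s * indicator {s. ennreal s < R} s :: ennreal)"
    proof eventually_elim
      case (elim s)
      have "ennreal u < ?D s \<longleftrightarrow> ennreal s < R" if "0 < s"
      proof
        assume "ennreal u < ?D s"
        from 2[OF that this] show "ennreal s < R" using elim that by (cases R) (auto simp: less_le)
      qed (use 1 that in auto)
      then show ?case by (auto simp: indicator_def)
    qed
  qed
  then show ?thesis by (simp add: nn_integral_less_ennreal R_def)
qed

text \<open>This is \<open>t\<close> times the maximal rearrangement, the K-functional of
  \<open>L^1\<close> and \<open>L^\<infinity>\<close> at \<open>t\<close>:
  \<open>rearrangement_integral_le\<close> bounds it by any decomposition, and
  \<open>rearrangement_integral_split\<close> exhibits an optimal one.\<close>

definition rearrangement_integral :: "'a measure \<Rightarrow> ('a \<Rightarrow> complex) \<Rightarrow> real \<Rightarrow> ennreal"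
  where "rearrangement_integral M F t = (\<integral>\<^sup>+u\<in>{0<..<t}. rearrangement M F u \<partial>lborel)"

text \<open>The area below the rearrangement over \<open>{0<..<t}\<close>, computed by horizontal
  instead of vertical slices.\<close>

lemma rearrangement_integral_eq:
  assumes D: "antimono (distribution_fun M F)" and "0 \<le> t"
  shows "rearrangement_integral M F t =
    (\<integral>\<^sup>+s\<in>{0<..}. min (ennreal t) (distribution_fun M F s) \<partial>lborel)"
proof -
  let ?D = "distribution_fun M F"
  note [measurable] = borel_measurable_antimono_ennreal[OF D]
  have "rearrangement_integral M F t = (\<integral>\<^sup>+u. \<integral>\<^sup>+s. indicator {0<..<t} u * (indicator {0<..} s * indicator {s. ennreal u < ?D s} s) \<partial>lborel \<partial>lborel)"
    unfolding rearrangement_integral_def rearrangement_eq_nn_integral[OF D]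
    by (simp add: nn_integral_cmult mult.commute)
  also have "\<dots> = (\<integral>\<^sup>+s. \<integral>\<^sup>+u. indicator {0<..<t} u * (indicator {0<..} s * indicator {s. ennreal u < ?D s} s) \<partial>lborel \<partial>lborel)"
    by (rule lborel_pair.Fubini') measurable
  also have "\<dots> = (\<integral>\<^sup>+s\<in>{0<..}. min (ennreal t) (?D s) \<partial>lborel)"
  proof (rule nn_integral_cong)
    fix s :: real
    have "(\<integral>\<^sup>+u. indicator {0<..<t} u * (indicator {0<..} s * indicator {s. ennreal u < ?D s} s) \<partial>lborel)
      = (\<integral>\<^sup>+u. indicator {0<..} s * (indicator {0<..} u * indicator {u. ennreal u < min (ennreal t) (?D s)} u) \<partial>lborel)"
      using \<open>0 \<le> t\<close> by (intro nn_integral_cong) (auto simp: indicator_def ennreal_less_iff)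
    also have "\<dots> = indicator {0<..} s * min (ennreal t) (?D s)"
      by (subst nn_integral_cmult, measurable, subst nn_integral_less_ennreal) simp_all
    finally show "(\<integral>\<^sup>+u. indicator {0<..<t} u * (indicator {0<..} s * indicator {s. ennreal u < ?D s} s) \<partial>lborel)
      = min (ennreal t) (?D s) * indicator {0<..} s" by (simp add: mult.commute)
  qed
  finally show ?thesis .
qed

lemma distribution_fun_eq:
  assumes F: "F \<in> borel_measurable (completion M)" and [measurable]: "\<phi> \<in> borel_measurable M"
    and AE: "AE x in M. ennreal (cmod (F x)) = \<phi> x" and "0 \<le> s"
  shows "distribution_fun M F s = emeasure M {x\<in>space M. ennreal s < \<phi> x}"
proof -
  have [measurable]: "F \<in> borel_measurable (completion M)" by fact
  have "{x \<in> space (completion M). s < cmod (F x)} \<in> sets (completion M)" by measurable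
  then have "distribution_fun M F s = emeasure (completion M) {x\<in>space M. ennreal s < \<phi> x}"
    unfolding distribution_fun_def
    using AE_completion[OF AE] \<open>0 \<le> s\<close>
    by (intro emeasure_eq_AE) (auto elim!: eventually_mono simp: ennreal_less_iff[symmetric] simp del: ennreal_less_iff)
  then show ?thesis by simp
qed

text \<open>Horizontal slices below height \<open>b\<close> have length at most \<open>t\<close> and
  contribute at most \<open>t * b\<close>; those above are bounded by the distribution of
  \<open>H + b\<close> and contribute at most the integral of \<open>H\<close>.\<close>

lemma rearrangement_integral_le:
  assumes "sigma_finite_measure M" and F: "F \<in> borel_measurable (completion M)"
    and H[measurable]: "H \<in> borel_measurable M" and "0 \<le> b" "0 \<le> t"
    and AE: "AE x in M. ennreal (cmod (F x)) \<le> H x + ennreal b"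
  shows "rearrangement_integral M F t \<le> (\<integral>\<^sup>+x. H x \<partial>M) + ennreal (t * b)"
proof -
  let ?D = "distribution_fun M F" and ?E = "\<lambda>s. emeasure M {x\<in>space M. ennreal s < H x + ennreal b}"
  note D = distribution_fun_antimono[OF F]
  note [measurable] = borel_measurable_antimono_ennreal[OF D]
  have DE: "?D s \<le> ?E s" if "0 \<le> s" for s
  proof -
    have "?D s \<le> emeasure (completion M) {x\<in>space M. ennreal s < H x + ennreal b}"
      unfolding distribution_fun_def
    proof (rule emeasure_mono_AE)
      show "AE x in completion M. x \<in> {x \<in> space M. s < cmod (F x)} \<longrightarrow> x \<in> {x \<in> space M. ennreal s < H x + ennreal b}"
        using AE_completion[OF AE]
      proof eventually_elim
        case (elim x)
        have "ennreal s < ennreal (cmod (F x))" if "s < cmod (F x)"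
          using that \<open>0 \<le> s\<close> by (auto simp: ennreal_less_iff)
        with elim show ?case by auto
      qed
    qed auto
    then show ?thesis by simp
  qed
  have "antimono ?E" by (intro antimonoI emeasure_mono) (auto intro: le_less_trans ennreal_leI)
  note [measurable] = borel_measurable_antimono_ennreal[OF this]
  have "rearrangement_integral M F t = (\<integral>\<^sup>+s\<in>{0<..}. min (ennreal t) (?D s) \<partial>lborel)"
    by (rule rearrangement_integral_eq[OF D \<open>0 \<le> t\<close>])
  also have "\<dots> \<le> (\<integral>\<^sup>+s. ennreal t * indicator {0..b} s + ?E s * indicator {b<..} s \<partial>lborel)"
    using DE by (intro nn_integral_mono) (auto simp: indicator_def min.coboundedI2)
  also have "\<dots> = ennreal t * ennreal b + (\<integral>\<^sup>+x. (H x + ennreal b - ennreal b) \<partial>M)"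
    using \<open>0 \<le> b\<close> nn_integral_emeasure_greater[OF assms(1), of "\<lambda>x. H x + ennreal b" b]
    by (simp add: nn_integral_add nn_integral_cmult)
  finally show ?thesis using \<open>0 \<le> b\<close> \<open>0 \<le> t\<close> by (simp add: add.commute ennreal_mult)
qed

text \<open>The level at which the function is cut is the value of its rearrangement at \<open>t\<close>.\<close>

lemma rearrangement_integral_split:
  assumes "sigma_finite_measure M" and F: "F \<in> borel_measurable (completion M)"
    and \<phi>[measurable]: "\<phi> \<in> borel_measurable M" and AE: "AE x in M. ennreal (cmod (F x)) = \<phi> x"
    and "0 < t" and fin: "rearrangement_integral M F t \<noteq> \<infinity>"
  obtains c where "0 \<le> c" "rearrangement_integral M F t = (\<integral>\<^sup>+x. (\<phi> x - ennreal c) \<partial>M) + ennreal (t * c)"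
proof -
  let ?D = "distribution_fun M F" 
  note D = distribution_fun_antimono[OF F]
  note [measurable] = borel_measurable_antimono_ennreal[OF D]
  \<comment> \<open>An infinite value at \<open>t\<close> would persist on all of
    \<open>{0<..<t}\<close> by monotonicity and make the integral infinite.\<close>
  have "rearrangement M F t \<noteq> \<infinity>"
  proof
    assume inf: "rearrangement M F t = \<infinity>"
    have "rearrangement M F u = \<infinity>" if "u < t" for u
      using antimonoD[OF rearrangement_antimono[of M F], of u t] inf that by (simp add: top.extremum_unique)
    then have "rearrangement_integral M F t = (\<integral>\<^sup>+u. \<infinity> * indicator {0<..<t} u \<partial>lborel)"
      unfolding rearrangement_integral_def by (intro nn_integral_cong) (auto simp: indicator_def)
    also have "\<dots> = \<infinity>" using \<open>0 < t\<close> by (subst nn_integral_cmult_indicator) (auto simp: ennreal_top_mult)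
    finally show False using fin by simp
  qed
  then obtain c where c: "0 \<le> c" "rearrangement M F t = ennreal c" by (cases "rearrangement M F t") auto
  have lt: "ennreal t < ?D s" if "0 < s" "s < c" for s
  proof (rule ccontr)
    assume "\<not> ennreal t < ?D s"
    then have "rearrangement M F t \<le> ennreal s" using that(1)
      unfolding rearrangement_def by (intro INF_lower) auto
    then show False using that c by simp
  qed
  have gt: "?D s \<le> ennreal t" if "c < s" for s
  proof -
    have "rearrangement M F t < ennreal s" using that c by (simp add: ennreal_less_iff)
    then obtain s' where s': "0 < s'" "?D s' \<le> ennreal t" "ennreal s' < ennreal s"
      unfolding rearrangement_def by (auto simp: INF_less_iff)
    then have "?D s \<le> ?D s'" using that by (intro antimonoD[OF D]) (auto simp: ennreal_less_iff)
    with s' show ?thesis by simp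
  qed
  have "rearrangement_integral M F t = (\<integral>\<^sup>+s\<in>{0<..}. min (ennreal t) (?D s) \<partial>lborel)"
    using \<open>0 < t\<close> by (intro rearrangement_integral_eq[OF D]) simp
  \<comment> \<open>The cut \<open>c\<close> is the height at which the distribution function
    crosses \<open>t\<close>: below it the minimum is \<open>t\<close>, above it the distribution
    function. The value at \<open>c\<close> itself is immaterial.\<close>
  also have "\<dots> = (\<integral>\<^sup>+s. ennreal t * indicator {0<..<c} s + ?D s * indicator {c<..} s \<partial>lborel)"
  proof (rule nn_integral_cong_AE)
    have "AE s in lborel. s \<noteq> c" by (rule AE_lborel_singleton)
    then show "AE s in lborel. min (ennreal t) (?D s) * indicator {0<..} s =
      ennreal t * indicator {0<..<c} s + ?D s * indicator {c<..} s"
    proof eventually_elim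
      case (elim s)
      consider "s \<le> 0" | "0 < s" "s < c" | "c < s" using elim by linarith
      then show ?case
      proof cases
        case 2
        with less_imp_le[OF lt[OF 2]] show ?thesis by (simp add: min_absorb1)
      next
        case 3
        with gt[OF 3] c(1) show ?thesis by (simp add: min_def)
      qed (use c in auto)
    qed
  qed
  also have "\<dots> = ennreal t * ennreal c + (\<integral>\<^sup>+s\<in>{c<..}. ?D s \<partial>lborel)"
    using c by (simp add: nn_integral_add nn_integral_cmult)
  also have "(\<integral>\<^sup>+s\<in>{c<..}. ?D s \<partial>lborel) = (\<integral>\<^sup>+s\<in>{c<..}. emeasure M {x\<in>space M. ennreal s < \<phi> x} \<partial>lborel)"
    using c by (intro nn_integral_cong) (auto simp: indicator_def distribution_fun_eq[OF F \<phi> AE])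
  also have "\<dots> = (\<integral>\<^sup>+x. (\<phi> x - ennreal c) \<partial>M)"
    by (rule nn_integral_emeasure_greater[OF assms(1) \<phi> c(1)])
  finally show thesis
    using c(1) \<open>0 < t\<close> by (intro that[of c]) (auto simp: add.commute ennreal_mult)
qed

section \<open>Hardy's inequality for Lorentz functionals\<close>

lemma nn_integral_powr_tail:
  assumes "0 < s" "0 < t"
  shows "(\<integral>\<^sup>+u\<in>{t<..}. ennreal (u powr (- s - 1)) \<partial>lborel) = ennreal (t powr (- s) / s)"
proof -
  have "((\<lambda>u. u powr (- s - 1)) has_integral (t powr (- s) / s)) {t..}"
    using has_integral_powr_to_inf[of "- s - 1" t] assms by simp
  from nn_integral_has_integral_lebesgue'[OF _ this]
  have "(\<integral>\<^sup>+u\<in>{t..}. ennreal (u powr (- s - 1)) \<partial>lborel) = ennreal (t powr (- s) / s)"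
    by simp
  moreover have "(\<integral>\<^sup>+u\<in>{t<..}. ennreal (u powr (- s - 1)) \<partial>lborel) = (\<integral>\<^sup>+u\<in>{t..}. ennreal (u powr (- s - 1)) \<partial>lborel)"
    using AE_lborel_singleton[of t]
    by (intro nn_integral_cong_AE) (auto elim!: eventually_mono simp: indicator_def)
  ultimately show ?thesis by simp
qed

lemma nn_integral_powr_head:
  assumes "0 < s" "0 < t"
  shows "(\<integral>\<^sup>+u\<in>{0<..<t}. ennreal (u powr (s - 1)) \<partial>lborel) = ennreal (t powr s / s)"
proof -
  have "((\<lambda>u. u powr (s - 1)) has_integral (t powr s / s)) {0..t}"
    using has_integral_powr_from_0[of "s - 1" t] assms by simp
  from nn_integral_has_integral_lebesgue'[OF _ this]
  have "(\<integral>\<^sup>+u\<in>{0..t}. ennreal (u powr (s - 1)) \<partial>lborel) = ennreal (t powr s / s)"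
    by simp
  moreover have "(\<integral>\<^sup>+u\<in>{0<..<t}. ennreal (u powr (s - 1)) \<partial>lborel) = (\<integral>\<^sup>+u\<in>{0..t}. ennreal (u powr (s - 1)) \<partial>lborel)"
    using AE_lborel_singleton[of t] AE_lborel_singleton[of 0]
    by (intro nn_integral_cong_AE, eventually_elim) (auto simp: indicator_def)
  ultimately show ?thesis by simp
qed

section \<open>Powers and Jensen's inequality in [0, \<infinity>]\<close>

lemma borel_measurable_epowr[measurable (raw)]:
  assumes [measurable]: "f \<in> borel_measurable M"
  shows "(\<lambda>x. epowr (f x) a) \<in> borel_measurable M"
proof -
  have "(\<lambda>x. epowr (f x) a) = (\<lambda>x. if \<infinity> \<le> f x then \<infinity> else ennreal (enn2real (f x) powr a))"
    by (auto simp: epowr_def top.extremum_unique)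
  also have "\<dots> \<in> borel_measurable M" by measurable
  finally show ?thesis .
qed

lemma ennreal_mult_add:
  "0 \<le> x \<Longrightarrow> 0 \<le> y \<Longrightarrow> 0 \<le> z \<Longrightarrow> ennreal (x * y + z) = ennreal x * ennreal y + ennreal z"
  by (simp add: ennreal_mult ennreal_plus)

lemma epowr_mono: "x \<le> y \<Longrightarrow> 0 \<le> a \<Longrightarrow> epowr x a \<le> epowr y a"
  unfolding epowr_def
  by (auto simp: top.extremum_unique less_top intro!: ennreal_leI powr_mono2 enn2real_mono)

lemma epowr_cmult:
  assumes "0 \<le> c"
  shows "epowr (ennreal c * x) a = ennreal (c powr a) * epowr x a"
proof (cases "x = \<infinity>")
  case True
  then show ?thesis using assms by (cases "c = 0") (auto simp: epowr_def ennreal_mult_top)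
next
  case False
  then show ?thesis using assms
    by (simp add: epowr_def ennreal_mult_eq_top_iff enn2real_mult powr_mult flip: ennreal_mult)
qed

text \<open>The tangent inequality at \<open>c\<close>, with equality for \<open>x = c\<close>.
  Being affine in \<open>epowr x q\<close>, it can be integrated against a kernel, which yields
  Jensen's inequality even for functions with infinite values.\<close>

lemma epowr_Youngs_inequality:
  assumes "1 \<le> q" "0 < c"
  shows "x \<le> ennreal (c powr (1 - q) / q) * epowr x q + ennreal ((1 - 1 / q) * c)"
proof (cases x)
  case top
  then show ?thesis using assms by (simp add: epowr_def ennreal_mult_top)
next
  case (real y)
  show ?thesis
  proof (cases "y = 0")
    case True
    then show ?thesis using real by simp
  next
    case False
    with real have y: "0 < y" by simp
    have "(y powr q * c powr (1 - q)) powr (1 / q) * c powr (1 - 1 / q)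
        \<le> 1 / q * (y powr q * c powr (1 - q)) + (1 - 1 / q) * c"
      using assms y by (intro Youngs_inequality_0) auto
    also have "(y powr q * c powr (1 - q)) powr (1 / q) * c powr (1 - 1 / q) = y"
    proof -
      have "(1 - q) * (1 / q) + (1 - 1 / q) = 0" using assms by (simp add: field_simps)
      then show ?thesis using assms y
        by (simp add: powr_mult powr_powr mult.assoc flip: powr_add)
    qed
    finally have "y \<le> c powr (1 - q) / q * y powr q + (1 - 1 / q) * c"
      by (simp add: mult_ac)
    then have "ennreal y \<le> ennreal (c powr (1 - q) / q * y powr q + (1 - 1 / q) * c)"
      by (rule ennreal_leI)
    also have "\<dots> = ennreal (c powr (1 - q) / q) * epowr x q + ennreal ((1 - 1 / q) * c)"
      using assms y real by (subst ennreal_mult_add) (auto simp: epowr_def)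
    finally show ?thesis using real by simp
  qed
qed

text \<open>Jensen's inequality for the measure with density \<open>k\<close>, whose mass is
  \<open>R\<close>: Young's inequality is integrated with a free \<open>c\<close>, and then
  \<open>c\<close> is optimised.\<close>

lemma epowr_nn_integral_le:
  assumes [measurable]: "k \<in> borel_measurable M" "\<phi> \<in> borel_measurable M"
    and k: "(\<integral>\<^sup>+x. k x \<partial>M) = ennreal R" and R: "0 < R" and q: "1 \<le> q"
  shows "epowr (\<integral>\<^sup>+x. k x * \<phi> x \<partial>M) q \<le> ennreal (R powr (q - 1)) * (\<integral>\<^sup>+x. k x * epowr (\<phi> x) q \<partial>M)"
proof -
  define I where "I = (\<integral>\<^sup>+x. k x * epowr (\<phi> x) q \<partial>M)"
  have le: "(\<integral>\<^sup>+x. k x * \<phi> x \<partial>M) \<le> ennreal (c powr (1 - q) / q) * I + ennreal ((1 - 1 / q) * c * R)"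
    if "0 < c" for c
  proof -
    have "(\<integral>\<^sup>+x. k x * \<phi> x \<partial>M) \<le>
      (\<integral>\<^sup>+x. ennreal (c powr (1 - q) / q) * (k x * epowr (\<phi> x) q) + ennreal ((1 - 1 / q) * c) * k x \<partial>M)"
    proof (rule nn_integral_mono)
      fix x
      have "k x * \<phi> x \<le> k x * (ennreal (c powr (1 - q) / q) * epowr (\<phi> x) q + ennreal ((1 - 1 / q) * c))"
        using epowr_Youngs_inequality[OF q that] by (rule mult_left_mono) simp
      then show "k x * \<phi> x \<le> ennreal (c powr (1 - q) / q) * (k x * epowr (\<phi> x) q) + ennreal ((1 - 1 / q) * c) * k x"
        by (simp add: distrib_left mult_ac)
    qed
    also have "\<dots> = ennreal (c powr (1 - q) / q) * I + ennreal ((1 - 1 / q) * c) * ennreal R"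
      by (simp add: nn_integral_add nn_integral_cmult I_def k)
    finally show ?thesis using q that R by (simp add: ennreal_mult)
  qed
  show ?thesis
    unfolding I_def[symmetric]
  proof (cases I)
    case top
    then show "epowr (\<integral>\<^sup>+x. k x * \<phi> x \<partial>M) q \<le> ennreal (R powr (q - 1)) * I"
      using R by (simp add: ennreal_mult_top)
  next
    case (real J)
    show "epowr (\<integral>\<^sup>+x. k x * \<phi> x \<partial>M) q \<le> ennreal (R powr (q - 1)) * I"
    proof (cases "J = 0")
      \<comment> \<open>No positive \<open>c\<close> is optimal when the right side vanishes;
        \<open>c = \<epsilon> / R\<close> with arbitrary \<epsilon> shows that the left side
        vanishes too.\<close>
      case True
      have "(\<integral>\<^sup>+x. k x * \<phi> x \<partial>M) \<le> 0"
      proof (rule ennreal_le_epsilon)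
        fix \<epsilon> :: real assume \<epsilon>: "0 < \<epsilon>"
        have "(\<integral>\<^sup>+x. k x * \<phi> x \<partial>M) \<le> ennreal ((1 - 1 / q) * (\<epsilon> / R) * R)"
          using le[of "\<epsilon> / R"] R \<epsilon> real True by simp
        also have "\<dots> \<le> ennreal \<epsilon>" using R \<epsilon> q by (intro ennreal_leI) (simp add: field_simps)
        finally show "(\<integral>\<^sup>+x. k x * \<phi> x \<partial>M) \<le> 0 + ennreal \<epsilon>" by simp
      qed
      then show ?thesis by (simp add: epowr_def)
    next
      case False
      with real have J: "0 < J" by simp
      \<comment> \<open>The optimal \<open>c\<close> is the power mean of \<phi> of order
        \<open>q\<close> for the normalised density \<open>k / R\<close>.\<close>
      define c where "c = (J / R) powr (1 / q)"
      have c: "0 < c" using J R by (simp add: c_def)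
      have cq: "c powr q = J / R" using J R q by (simp add: c_def powr_powr)
      have "c powr (1 - q) / q * J + (1 - 1 / q) * c * R = R * c"
      proof -
        have "c powr (1 - q) * J = c * R" using cq c R J by (simp add: powr_diff field_simps)
        then have "c powr (1 - q) / q * J = c * R / q" by (simp add: field_simps)
        then show ?thesis using q by (simp add: field_simps)
      qed
      moreover have "ennreal (c powr (1 - q) / q) * I + ennreal ((1 - 1 / q) * c * R)
          = ennreal (c powr (1 - q) / q * J + (1 - 1 / q) * c * R)"
        using c q R J real by (subst ennreal_mult_add) auto
      ultimately have "(\<integral>\<^sup>+x. k x * \<phi> x \<partial>M) \<le> ennreal (R * c)"
        using le[OF c] by simp
      then have "epowr (\<integral>\<^sup>+x. k x * \<phi> x \<partial>M) q \<le> epowr (ennreal (R * c)) q"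
        using q by (intro epowr_mono) auto
      also have "\<dots> = ennreal ((R * c) powr q)" using R c by (simp add: epowr_def)
      also have "(R * c) powr q = R powr (q - 1) * J"
        using R c J cq by (simp add: powr_mult powr_diff)
      finally show ?thesis using real by (simp add: ennreal_mult)
    qed
  qed
qed

text \<open>Separates the outer functional from rearrangements, because Hardy's inequality is
  applied to a tail integral that is not given as a maximal rearrangement.\<close>

definition lorentz_functional :: "real \<Rightarrow> ennreal \<Rightarrow> (real \<Rightarrow> ennreal) \<Rightarrow> ennreal"
  where "lorentz_functional p q \<psi> =
    (if q = \<infinity> then (SUP t\<in>{0<..}. ennreal (t powr (1 / p)) * \<psi> t)
     else epowr (\<integral>\<^sup>+ t\<in>{0<..}. epowr (ennreal (t powr (1 / p)) * \<psi> t) (enn2real q)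
            * ennreal (1 / t) \<partial>lborel) (1 / enn2real q))"

lemma lorentz_norm_eq: "lorentz_norm M p q F = lorentz_functional p q (maximal_rearrangement M F)"
  by (simp add: lorentz_norm_def lorentz_functional_def)

lemma lorentz_functional_mono:
  assumes "\<And>t. 0 < t \<Longrightarrow> \<psi> t \<le> \<psi>' t"
  shows "lorentz_functional p q \<psi> \<le> lorentz_functional p q \<psi>'"
proof -
  have *: "ennreal (t powr (1 / p)) * \<psi> t \<le> ennreal (t powr (1 / p)) * \<psi>' t" if "0 < t" for t
    using assms[OF that] by (rule mult_left_mono) simp
  have "epowr (ennreal (t powr (1 / p)) * \<psi> t) (enn2real q) * ennreal (1 / t) * indicator {0<..} t
    \<le> epowr (ennreal (t powr (1 / p)) * \<psi>' t) (enn2real q) * ennreal (1 / t) * indicator {0<..} t" for t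
    by (cases "0 < t") (auto intro!: mult_right_mono epowr_mono *)
  then show ?thesis
    unfolding lorentz_functional_def by (auto intro!: SUP_subset_mono * epowr_mono nn_integral_mono)
qed

lemma lorentz_functional_cmult:
  assumes "1 \<le> q" "0 \<le> c" and [measurable]: "\<psi> \<in> borel_measurable borel"
  shows "lorentz_functional p q (\<lambda>t. ennreal c * \<psi> t) = ennreal c * lorentz_functional p q \<psi>"
proof (cases "q = \<infinity>")
  case True
  then show ?thesis
    by (simp add: lorentz_functional_def SUP_mult_left_ennreal mult.left_commute)
next
  case False
  define Q where "Q = enn2real q"
  have Q: "1 \<le> Q" using assms(1) False enn2real_mono[of 1 q] by (simp add: Q_def less_top)
  have "(\<integral>\<^sup>+ t\<in>{0<..}. epowr (ennreal (t powr (1 / p)) * (ennreal c * \<psi> t)) Q * ennreal (1 / t) \<partial>lborel)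
    = (\<integral>\<^sup>+ t. ennreal (c powr Q) * (epowr (ennreal (t powr (1 / p)) * \<psi> t) Q * ennreal (1 / t) * indicator {0<..} t) \<partial>lborel)"
    using assms(2) by (intro nn_integral_cong) (simp add: epowr_cmult mult_ac)
  also have "\<dots> = ennreal (c powr Q) * (\<integral>\<^sup>+ t\<in>{0<..}. epowr (ennreal (t powr (1 / p)) * \<psi> t) Q * ennreal (1 / t) \<partial>lborel)"
    by (rule nn_integral_cmult) measurable
  finally show ?thesis
    using False Q assms(2) by (simp add: lorentz_functional_def Q_def[symmetric] epowr_cmult powr_powr)
qed

text \<open>A Schur test. As \<open>1 / r = 1 / p - a\<close>, the tail integral times
  \<open>t powr (1 / r)\<close> is the integral of \<open>k t u\<close> against
  \<open>u powr (1 / p) * \<psi> u\<close>, where \<open>k\<close> has mass \<open>r\<close> in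
  \<open>u\<close>, and mass \<open>r / u\<close> in \<open>t\<close> with respect to
  \<open>dt / t\<close>. For finite \<open>q\<close>, Jensen contributes
  \<open>r powr (Q - 1)\<close> and Fubini another \<open>r\<close>; the root of order
  \<open>Q\<close> of the product is \<open>r\<close>.\<close>

theorem Hardy_inequality_tail:
  fixes \<psi> :: "real \<Rightarrow> ennreal"
  assumes [measurable]: "\<psi> \<in> borel_measurable borel" and q: "1 \<le> q" and r: "0 < r"
    and pr: "1 / r = 1 / p - a"
  shows "lorentz_functional r q (\<lambda>t. \<integral>\<^sup>+u\<in>{t<..}. ennreal (u powr (a - 1)) * \<psi> u \<partial>lborel)
    \<le> ennreal r * lorentz_functional p q \<psi>"
proof -
  define B where "B t = (\<integral>\<^sup>+u\<in>{t<..}. ennreal (u powr (a - 1)) * \<psi> u \<partial>lborel)" for t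
  define k where "k t u = ennreal (t powr (1 / r) * u powr (- (1 / r) - 1)) * indicator {t<..} u" for t u :: real
  define \<phi> where "\<phi> u = ennreal (u powr (1 / p)) * \<psi> u" for u
  have [measurable]: "\<phi> \<in> borel_measurable borel" unfolding \<phi>_def by measurable
  have km: "(\<lambda>(t, u). k t u) \<in> borel_measurable (lborel \<Otimes>\<^sub>M lborel)"
  proof -
    have "(\<lambda>(t, u). k t u) = (\<lambda>z. ennreal (fst z powr (1 / r) * snd z powr (- (1 / r) - 1)) * (if fst z < snd z then 1 else 0))"
      by (auto simp: k_def fun_eq_iff)
    also have "\<dots> \<in> borel_measurable (lborel \<Otimes>\<^sub>M lborel)" by measurable
    finally show ?thesis .
  qed
  note [measurable] = km
  have [measurable]: "k t \<in> borel_measurable borel" for t unfolding k_def by measurable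
  have B: "ennreal (t powr (1 / r)) * B t = (\<integral>\<^sup>+u. k t u * \<phi> u \<partial>lborel)" if t: "0 < t" for t
  proof -
    have "ennreal (t powr (1 / r)) * B t =
      (\<integral>\<^sup>+u. ennreal (t powr (1 / r)) * (ennreal (u powr (a - 1)) * \<psi> u * indicator {t<..} u) \<partial>lborel)"
      unfolding B_def by (rule nn_integral_cmult[symmetric]) measurable
    also have "\<dots> = (\<integral>\<^sup>+u. k t u * \<phi> u \<partial>lborel)"
    proof (rule nn_integral_cong)
      fix u
      have "ennreal (u powr (a - 1)) = ennreal (u powr (- (1 / r) - 1)) * ennreal (u powr (1 / p))" if "t < u"
        using t that pr by (simp flip: ennreal_mult powr_add)
      then show "ennreal (t powr (1 / r)) * (ennreal (u powr (a - 1)) * \<psi> u * indicator {t<..} u) = k t u * \<phi> u"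
        by (auto simp: k_def \<phi>_def indicator_def ennreal_mult mult_ac)
    qed
    finally show ?thesis .
  qed
  have ki: "(\<integral>\<^sup>+u. k t u \<partial>lborel) = ennreal r" if t: "0 < t" for t
  proof -
    have "(\<integral>\<^sup>+u. k t u \<partial>lborel) = (\<integral>\<^sup>+u. ennreal (t powr (1 / r)) * (ennreal (u powr (- (1 / r) - 1)) * indicator {t<..} u) \<partial>lborel)"
      by (intro nn_integral_cong) (simp add: k_def ennreal_mult mult_ac)
    also have "\<dots> = ennreal (t powr (1 / r)) * ennreal (t powr (- (1 / r)) / (1 / r))"
      using r t by (subst nn_integral_cmult, measurable, subst nn_integral_powr_tail) auto
    also have "\<dots> = ennreal r"
      using r t by (simp add: powr_minus field_simps flip: ennreal_mult)
    finally show ?thesis .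
  qed
  have ki2: "(\<integral>\<^sup>+t. k t u * (ennreal (1 / t) * indicator {0<..} t) \<partial>lborel) = ennreal r * (ennreal (1 / u) * indicator {0<..} u)" for u
  proof (cases "0 < u")
    case u: True
    have "(\<integral>\<^sup>+t. k t u * (ennreal (1 / t) * indicator {0<..} t) \<partial>lborel)
      = (\<integral>\<^sup>+t. ennreal (u powr (- (1 / r) - 1)) * (ennreal (t powr (1 / r - 1)) * indicator {0<..<u} t) \<partial>lborel)"
    proof (rule nn_integral_cong)
      fix t :: real
      show "k t u * (ennreal (1 / t) * indicator {0<..} t) =
        ennreal (u powr (- (1 / r) - 1)) * (ennreal (t powr (1 / r - 1)) * indicator {0<..<u} t)"
        by (auto simp: k_def indicator_def powr_diff[of t "1 / r" 1] ennreal_mult[symmetric] mult_ac)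
    qed
    also have "\<dots> = ennreal (u powr (- (1 / r) - 1)) * ennreal (u powr (1 / r) / (1 / r))"
      using r u by (subst nn_integral_cmult, measurable, subst nn_integral_powr_head) auto
    also have "\<dots> = ennreal (r * (1 / u))"
      using r u by (simp add: powr_minus powr_diff field_simps flip: ennreal_mult powr_add)
    also have "\<dots> = ennreal r * (ennreal (1 / u) * indicator {0<..} u)"
      using r u by (subst ennreal_mult) auto
    finally show ?thesis .
  next
    case False
    then have "(\<integral>\<^sup>+t. k t u * (ennreal (1 / t) * indicator {0<..} t) \<partial>lborel) = (\<integral>\<^sup>+t. 0 \<partial>(lborel :: real measure))"
      by (intro nn_integral_cong) (auto simp: k_def indicator_def)
    with False show ?thesis by simp
  qed
  show ?thesis
  proof (cases "q = \<infinity>")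
    case True
    let ?S = "SUP t\<in>{0<..}. \<phi> t"
    have "ennreal (t powr (1 / r)) * B t \<le> ennreal r * ?S" if t: "0 < t" for t
    proof -
      have "ennreal (t powr (1 / r)) * B t \<le> (\<integral>\<^sup>+u. k t u * ?S \<partial>lborel)"
        unfolding B[OF t] using t
        by (intro nn_integral_mono) (auto simp: k_def indicator_def intro!: mult_left_mono SUP_upper)
      also have "\<dots> = ennreal r * ?S" by (simp add: nn_integral_multc ki[OF t])
      finally show ?thesis .
    qed
    then show ?thesis
      using True by (auto simp: lorentz_functional_def B_def[symmetric] \<phi>_def[symmetric] intro!: SUP_least)
  next
    case False
    define Q where "Q = enn2real q"
    have Q: "1 \<le> Q" using q False enn2real_mono[of 1 q] by (simp add: Q_def less_top)
    let ?E = "\<lambda>u. epowr (\<phi> u) Q"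
    let ?w = "\<lambda>t::real. ennreal (1 / t) * indicator {0<..} t"
    have "(\<integral>\<^sup>+ t\<in>{0<..}. epowr (ennreal (t powr (1 / r)) * B t) Q * ennreal (1 / t) \<partial>lborel)
      \<le> (\<integral>\<^sup>+ t. ennreal (r powr (Q - 1)) * ((\<integral>\<^sup>+u. k t u * ?E u \<partial>lborel) * ?w t) \<partial>lborel)"
    proof (rule nn_integral_mono)
      fix t
      show "epowr (ennreal (t powr (1 / r)) * B t) Q * ennreal (1 / t) * indicator {0<..} t
        \<le> ennreal (r powr (Q - 1)) * ((\<integral>\<^sup>+u. k t u * ?E u \<partial>lborel) * ?w t)"
      proof (cases "0 < t")
        case True
        have "epowr (ennreal (t powr (1 / r)) * B t) Q \<le> ennreal (r powr (Q - 1)) * (\<integral>\<^sup>+u. k t u * ?E u \<partial>lborel)"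
          unfolding B[OF True] by (rule epowr_nn_integral_le[OF _ _ ki[OF True] r Q]) measurable
        then have "epowr (ennreal (t powr (1 / r)) * B t) Q * ?w t \<le> ennreal (r powr (Q - 1)) * (\<integral>\<^sup>+u. k t u * ?E u \<partial>lborel) * ?w t"
          by (rule mult_right_mono) simp
        then show ?thesis by (simp add: mult_ac)
      qed simp
    qed
    also have "\<dots> = ennreal (r powr (Q - 1)) * (\<integral>\<^sup>+ t. (\<integral>\<^sup>+u. k t u * ?E u * ?w t \<partial>lborel) \<partial>lborel)"
      by (simp add: nn_integral_cmult nn_integral_multc)
    also have "(\<integral>\<^sup>+ t. (\<integral>\<^sup>+u. k t u * ?E u * ?w t \<partial>lborel) \<partial>lborel) = (\<integral>\<^sup>+ u. (\<integral>\<^sup>+t. k t u * ?E u * ?w t \<partial>lborel) \<partial>lborel)"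
      by (rule lborel_pair.Fubini') measurable
    also have "\<dots> = (\<integral>\<^sup>+ u. ?E u * (\<integral>\<^sup>+t. k t u * ?w t \<partial>lborel) \<partial>lborel)"
    proof (rule nn_integral_cong)
      fix u
      have "(\<lambda>t. k t u) \<in> borel_measurable lborel"
        using measurable_compose[OF measurable_Pair2' km, of u] by simp
      then show "(\<integral>\<^sup>+t. k t u * ?E u * ?w t \<partial>lborel) = ?E u * (\<integral>\<^sup>+t. k t u * ?w t \<partial>lborel)"
        by (subst nn_integral_cmult[symmetric]) (auto intro!: nn_integral_cong simp: mult_ac)
    qed
    also have "\<dots> = (\<integral>\<^sup>+ u. ennreal r * (?E u * ennreal (1 / u) * indicator {0<..} u) \<partial>lborel)"
      unfolding ki2 by (intro nn_integral_cong) (simp add: mult_ac)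
    also have "\<dots> = ennreal r * (\<integral>\<^sup>+ u\<in>{0<..}. ?E u * ennreal (1 / u) \<partial>lborel)"
      by (rule nn_integral_cmult) measurable
    finally have "(\<integral>\<^sup>+ t\<in>{0<..}. epowr (ennreal (t powr (1 / r)) * B t) Q * ennreal (1 / t) \<partial>lborel)
      \<le> ennreal (r powr Q) * (\<integral>\<^sup>+ u\<in>{0<..}. ?E u * ennreal (1 / u) \<partial>lborel)"
      using r by (simp add: powr_diff mult.assoc[symmetric] flip: ennreal_mult)
    then have "epowr (\<integral>\<^sup>+ t\<in>{0<..}. epowr (ennreal (t powr (1 / r)) * B t) Q * ennreal (1 / t) \<partial>lborel) (1 / Q)
      \<le> epowr (ennreal (r powr Q) * (\<integral>\<^sup>+ u\<in>{0<..}. ?E u * ennreal (1 / u) \<partial>lborel)) (1 / Q)"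
      using Q by (intro epowr_mono) auto
    then show ?thesis
      using False Q r
      by (simp add: lorentz_functional_def Q_def[symmetric] B_def[symmetric] \<phi>_def[symmetric] epowr_cmult powr_powr)
  qed
qed

text \<open>Used in contrapositive form: a finite functional forces \<psi> to be finite at some
  \<open>t\<close>.\<close>

lemma lorentz_functional_top:
  assumes "1 \<le> q" and top: "\<And>t. 0 < t \<Longrightarrow> \<psi> t = \<infinity>"
  shows "lorentz_functional p q \<psi> = \<infinity>"
proof (cases "q = \<infinity>")
  case True
  have "ennreal (1 powr (1 / p)) * \<psi> 1 \<le> (SUP t\<in>{0<..}. ennreal (t powr (1 / p)) * \<psi> t)"
    by (rule SUP_upper) simp
  then show ?thesis using True top[of 1] by (simp add: lorentz_functional_def top.extremum_unique)
next
  case False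
  have "(\<integral>\<^sup>+ t\<in>{0<..}. epowr (ennreal (t powr (1 / p)) * \<psi> t) (enn2real q) * ennreal (1 / t) \<partial>lborel)
    = (\<integral>\<^sup>+ t. \<infinity> * indicator {0<..} t \<partial>(lborel :: real measure))"
    using top by (intro nn_integral_cong) (auto simp: indicator_def epowr_def ennreal_mult_top ennreal_top_mult)
  also have "\<dots> = \<infinity>"
  proof -
    have "\<infinity> * emeasure lborel {0<..<1::real} \<le> \<infinity> * emeasure lborel {0::real<..}"
      by (intro mult_left_mono emeasure_mono) auto
    then show ?thesis by (subst nn_integral_cmult_indicator) (auto simp: ennreal_top_mult top.extremum_unique)
  qed
  finally show ?thesis using False by (simp add: lorentz_functional_def epowr_def)
qed

lemma rearrangement_integral_mono: "mono (rearrangement_integral M F)"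
  unfolding rearrangement_integral_def
  by (intro monoI nn_integral_mono) (auto simp: indicator_def)

lemma maximal_rearrangement_eq: "maximal_rearrangement M F t = ennreal (1 / t) * rearrangement_integral M F t"
  by (simp add: maximal_rearrangement_def rearrangement_integral_def)

lemma borel_measurable_maximal_rearrangement [measurable]:
  "maximal_rearrangement M F \<in> borel_measurable borel"
proof -
  note [measurable] = borel_measurable_mono_ennreal[OF rearrangement_integral_mono]
  have "(\<lambda>t. ennreal (1 / t) * rearrangement_integral M F t) \<in> borel_measurable borel" by measurable
  then show ?thesis by (simp add: maximal_rearrangement_eq[abs_def])
qed

text \<open>
  A function that splits, for each \<open>t\<close>, into an integrable part and a bounded part is
  controlled by its \<open>K\<close>-functional.
\<close>

lemma lorentz_norm_of_splitting:
  fixes H :: "'a \<Rightarrow> ennreal"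
  assumes M: "sigma_finite_measure M" and q: "1 \<le> q" and r: "0 < r" and pr: "1 / r = 1 / p - a"
    and K: "0 \<le> K" and f: "lorentz_norm M p q f < \<infinity>"
    and split: "\<And>t. 0 < t \<Longrightarrow> \<exists>H0\<in>borel_measurable M. \<exists>b. (\<forall>x. H x \<le> H0 x + b) \<and>
      (\<integral>\<^sup>+x. H0 x \<partial>M) + ennreal t * b \<le> ennreal t *
        (ennreal K * (\<integral>\<^sup>+u\<in>{t<..}. ennreal (u powr (a - 1)) * maximal_rearrangement M f u \<partial>lborel))"
  shows "AE x in M. H x < \<infinity>"
    and "\<And>F. F \<in> borel_measurable (completion M) \<Longrightarrow> (\<And>x. ennreal (cmod (F x)) \<le> H x) \<Longrightarrow>
      lorentz_norm M r q F \<le> ennreal (K * r) * lorentz_norm M p q f"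
proof -
  define B where "B t = (\<integral>\<^sup>+u\<in>{t<..}. ennreal (u powr (a - 1)) * maximal_rearrangement M f u \<partial>lborel)" for t
  have "antimono B" unfolding B_def by (intro antimonoI nn_integral_mono) (auto simp: indicator_def)
  note [measurable] = borel_measurable_antimono_ennreal[OF this]
  have Hardy: "lorentz_functional r q B \<le> ennreal r * lorentz_norm M p q f"
    unfolding lorentz_norm_eq B_def[abs_def]
    by (rule Hardy_inequality_tail[OF _ q r pr]) measurable
  then have "lorentz_functional r q B < \<infinity>"
    using f by (auto intro: le_less_trans simp: ennreal_mult_less_top)
  \<comment> \<open>One finite value of \<open>B\<close> is enough: the splitting at that
    \<open>t\<close> dominates \<open>H\<close> by an integrable function plus a finite
    constant.\<close>
  then have "\<not> (\<forall>t>0. B t = \<infinity>)" using lorentz_functional_top[OF q, of B r] by (metis infinity_ennreal_def less_irrefl)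
  then obtain t where t: "0 < t" "B t \<noteq> \<infinity>" by blast
  from split[OF t(1)] obtain H0 b where H0: "H0 \<in> borel_measurable M" "\<And>x. H x \<le> H0 x + b"
    "(\<integral>\<^sup>+x. H0 x \<partial>M) + ennreal t * b \<le> ennreal t * (ennreal K * B t)"
    unfolding B_def by blast
  have "ennreal t * (ennreal K * B t) < \<infinity>"
    using t by (simp add: ennreal_mult_less_top less_top)
  with H0(3) have fin: "(\<integral>\<^sup>+x. H0 x \<partial>M) + ennreal t * b < \<infinity>" by (rule le_less_trans)
  then have "b < \<infinity>" using t(1) by (auto simp: ennreal_mult_less_top ennreal_add_less_top)
  have "AE x in M. H0 x \<noteq> \<infinity>"
    using fin H0(1) by (intro nn_integral_PInf_AE) auto
  then show "AE x in M. H x < \<infinity>"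
  proof eventually_elim
    case (elim x)
    then have "H0 x + b < \<infinity>" using \<open>b < \<infinity>\<close> by (simp add: less_top)
    with H0(2) show ?case by (rule le_less_trans)
  qed
  fix F assume F: "F \<in> borel_measurable (completion M)" "\<And>x. ennreal (cmod (F x)) \<le> H x"
  have "maximal_rearrangement M F t \<le> ennreal K * B t" if t: "0 < t" for t
  proof -
    from split[OF t(1)] obtain H0 b where H0: "H0 \<in> borel_measurable M" "\<And>x. H x \<le> H0 x + b"
      "(\<integral>\<^sup>+x. H0 x \<partial>M) + ennreal t * b \<le> ennreal t * (ennreal K * B t)"
      unfolding B_def by blast
    have "rearrangement_integral M F t \<le> ennreal t * (ennreal K * B t)"
    proof (cases b)
      case (real c)
      have "rearrangement_integral M F t \<le> (\<integral>\<^sup>+x. H0 x \<partial>M) + ennreal (t * c)"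
        using t real F(2) H0(2) by (intro rearrangement_integral_le[OF M F(1) H0(1)]) (auto intro: order_trans)
      also have "\<dots> \<le> ennreal t * (ennreal K * B t)" using H0(3) t real by (simp add: ennreal_mult)
      finally show ?thesis .
    next
      \<comment> \<open>An infinite \<open>b\<close> makes the right side infinite, as
        \<open>t\<close> is positive.\<close>
      case top
      then show ?thesis using H0(3) t by (simp add: ennreal_mult_top top.extremum_unique)
    qed
    then have "ennreal (1 / t) * rearrangement_integral M F t \<le> ennreal (1 / t) * (ennreal t * (ennreal K * B t))"
      by (rule mult_left_mono) simp
    also have "\<dots> = ennreal K * B t" using t by (simp add: mult.assoc[symmetric] flip: ennreal_mult)
    finally show ?thesis by (simp add: maximal_rearrangement_eq)
  qed
  then have "lorentz_norm M r q F \<le> lorentz_functional r q (\<lambda>t. ennreal K * B t)"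
    unfolding lorentz_norm_eq by (rule lorentz_functional_mono)
  also have "\<dots> = ennreal K * lorentz_functional r q B"
    by (rule lorentz_functional_cmult[OF q K]) measurable
  also have "\<dots> \<le> ennreal K * (ennreal r * lorentz_norm M p q f)"
    using Hardy by (rule mult_left_mono) simp
  also have "\<dots> = ennreal (K * r) * lorentz_norm M p q f"
    using K r by (simp add: ennreal_mult mult.assoc)
  finally show "lorentz_norm M r q F \<le> ennreal (K * r) * lorentz_norm M p q f" .
qed

section \<open>Positive measures and the weak topology\<close>

text \<open>Positivity without regularity, which is all that turning a set function into a measure
  requires.\<close>

definition positive_charge :: "('a::topological_space set \<Rightarrow> complex) \<Rightarrow> bool"
  where "positive_charge \<mu> \<longleftrightarrow> complex_borel_measure \<mu> \<and> (\<forall>E. Im (\<mu> E) = 0 \<and> 0 \<le> Re (\<mu> E))"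

lemma positive_measures_charge: "\<mu> \<in> positive_measures \<Longrightarrow> positive_charge \<mu>"
  by (simp add: positive_measures_def regular_measures_def positive_charge_def)

lemma positive_measures_regular: "\<mu> \<in> positive_measures \<Longrightarrow> \<mu> \<in> regular_measures"
  by (simp add: positive_measures_def)

lemma sets_to_measure [simp, measurable_cong]: "sets (to_measure \<mu>) = sets borel"
proof -
  have "sets borel \<subseteq> Pow UNIV" by simp
  then show ?thesis unfolding to_measure_def
    using sets.sigma_sets_eq[of borel] by (subst sets_measure_of) (auto simp: space_borel)
qed

lemma space_to_measure [simp]: "space (to_measure \<mu>) = UNIV"
  using sets_eq_imp_space_eq[OF sets_to_measure] by simp

lemma emeasure_to_measure:
  assumes "positive_charge \<mu>" "E \<in> sets borel"
  shows "emeasure (to_measure \<mu>) E = ennreal (Re (\<mu> E))"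
  unfolding to_measure_def
proof (rule emeasure_measure_of_sigma)
  have c: "(\<lambda>n. \<mu> (A n)) sums \<mu> (\<Union>n. A n)" if "range A \<subseteq> sets borel" "disjoint_family A" for A :: "nat \<Rightarrow> 'a set"
    using assms(1) that unfolding positive_charge_def complex_borel_measure_def by blast
  have nonneg: "0 \<le> Re (\<mu> E)" for E using assms(1) by (simp add: positive_charge_def)
  show "sigma_algebra UNIV (sets borel)" using sets.sigma_algebra_axioms[of borel] by simp
  show "E \<in> sets borel" by fact
  \<comment> \<open>A convergent series with constant terms has zero terms, so the empty set gets
    the value 0.\<close>
  have "(\<lambda>n::nat. \<mu> {}) sums \<mu> {}" using c[of "\<lambda>n. {}"] by (simp add: disjoint_family_on_def)
  then have "summable (\<lambda>n::nat. \<mu> {})" by (rule sums_summable)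
  then have "\<mu> {} = 0" by (simp add: summable_const_iff)
  then show "positive (sets borel) (\<lambda>E. ennreal (Re (\<mu> E)))" by (simp add: positive_def)
  show "countably_additive (sets borel) (\<lambda>E. ennreal (Re (\<mu> E)))"
    unfolding countably_additive_def
  proof (intro allI impI)
    fix A :: "nat \<Rightarrow> 'a set" assume "range A \<subseteq> sets borel" "disjoint_family A"
    from sums_Re[OF c[OF this]] show "(\<Sum>i. ennreal (Re (\<mu> (A i)))) = ennreal (Re (\<mu> (\<Union>i. A i)))"
      by (intro suminf_ennreal_eq nonneg) simp
  qed
qed

lemma finite_measure_to_measure: "positive_charge \<mu> \<Longrightarrow> finite_measure (to_measure \<mu>)"
  by (rule finite_measureI) (simp add: emeasure_to_measure)

lemma total_variation_positive:
  assumes \<mu>: "positive_charge \<mu>" and E: "E \<in> sets borel"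
  shows "total_variation \<mu> E = emeasure (to_measure \<mu>) E"
proof -
  have cm: "ennreal (cmod (\<mu> F)) = ennreal (Re (\<mu> F))" for F
    using \<mu> by (simp add: positive_charge_def cmod_eq_Re)
  have em: "(\<Sum>F\<in>P. ennreal (cmod (\<mu> F))) = emeasure (to_measure \<mu>) E"
    if P: "finite P" "disjoint P" "P \<subseteq> sets borel" "\<Union>P = E" for P
  proof -
    have "(\<Sum>F\<in>P. ennreal (cmod (\<mu> F))) = (\<Sum>F\<in>P. emeasure (to_measure \<mu>) F)"
      using P by (intro sum.cong refl) (auto simp: cm emeasure_to_measure[OF \<mu>])
    also have "\<dots> = emeasure (to_measure \<mu>) (\<Union>F\<in>P. F)"
      using P by (intro sum_emeasure) (auto simp: disjoint_family_on_def disjoint_def)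
    finally show ?thesis using P by simp
  qed
  have "{E} \<in> {P. finite P \<and> disjoint P \<and> P \<subseteq> sets borel \<and> \<Union>P = E}" using E by (simp add: disjoint_def)
  then have ne: "{P. finite P \<and> disjoint P \<and> P \<subseteq> sets borel \<and> \<Union>P = E} \<noteq> {}" by blast
  have "total_variation \<mu> E = (SUP P\<in>{P. finite P \<and> disjoint P \<and> P \<subseteq> sets borel \<and> \<Union>P = E}. emeasure (to_measure \<mu>) E)"
    unfolding total_variation_def by (intro SUP_cong refl) (use em in auto)
  also have "\<dots> = emeasure (to_measure \<mu>) E" by (rule SUP_const[OF ne])
  finally show ?thesis .
qed

lemma to_measure_compact_inner_regular:
  fixes \<mu> :: "'a::t2_space set \<Rightarrow> complex"
  assumes "\<mu> \<in> positive_measures"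
  shows "compact_inner_regular (to_measure \<mu>)"
  unfolding compact_inner_regular_def
proof (intro conjI ballI sets_to_measure)
  fix E :: "'a set" assume E: "E \<in> sets borel"
  note \<mu> = positive_measures_charge[OF assms]
  have "emeasure (to_measure \<mu>) E = total_variation \<mu> E" by (rule total_variation_positive[OF \<mu> E, symmetric])
  also have "\<dots> = (SUP C\<in>{C. compact C \<and> C \<subseteq> E}. total_variation \<mu> C)"
    using positive_measures_regular[OF assms] E unfolding regular_measures_def by blast
  also have "\<dots> = (SUP C\<in>{C. compact C \<and> C \<subseteq> E}. emeasure (to_measure \<mu>) C)"
    by (intro SUP_cong refl total_variation_positive[OF \<mu>]) (auto simp: compact_borel)
  finally show "emeasure (to_measure \<mu>) E = (SUP C\<in>{C. compact C \<and> C \<subseteq> E}. emeasure (to_measure \<mu>) C)" .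
qed

text \<open>Approximation with equality, by open sets from outside and by compact sets from inside,
  is available for finite combinations of point measures.\<close>

lemma positive_measuresI:
  fixes \<mu> :: "'a::t2_space set \<Rightarrow> complex"
  assumes \<mu>: "positive_charge \<mu>"
    and "\<And>E. E \<in> sets borel \<Longrightarrow> \<exists>U. open U \<and> E \<subseteq> U \<and> \<mu> U = \<mu> E"
    and "\<And>E. E \<in> sets borel \<Longrightarrow> \<exists>C. compact C \<and> C \<subseteq> E \<and> \<mu> C = \<mu> E"
  shows "\<mu> \<in> positive_measures"
proof -
  note tv = total_variation_positive[OF \<mu>] emeasure_to_measure[OF \<mu>]
  have mono: "total_variation \<mu> E \<le> total_variation \<mu> F" if "E \<subseteq> F" "E \<in> sets borel" "F \<in> sets borel" for E F
    using that by (simp add: total_variation_positive[OF \<mu>] emeasure_mono)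
  have "total_variation \<mu> E = (INF U\<in>{U. open U \<and> E \<subseteq> U}. total_variation \<mu> U)" if E: "E \<in> sets borel" for E
  proof (rule antisym)
    obtain U where U: "open U" "E \<subseteq> U" "\<mu> U = \<mu> E" using assms(2)[OF E] by blast
    then have "total_variation \<mu> U = total_variation \<mu> E" using E by (simp add: tv)
    then show "(INF U\<in>{U. open U \<and> E \<subseteq> U}. total_variation \<mu> U) \<le> total_variation \<mu> E"
      using U by (intro INF_lower2[of U]) auto
  qed (use E in \<open>auto intro!: INF_greatest mono\<close>)
  moreover have "total_variation \<mu> E = (SUP C\<in>{C. compact C \<and> C \<subseteq> E}. total_variation \<mu> C)" if E: "E \<in> sets borel" for E
  proof (rule antisym)
    obtain C where C: "compact C" "C \<subseteq> E" "\<mu> C = \<mu> E" using assms(3)[OF E] by blast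
    then have "total_variation \<mu> C = total_variation \<mu> E" using E by (simp add: tv compact_borel)
    then show "total_variation \<mu> E \<le> (SUP C\<in>{C. compact C \<and> C \<subseteq> E}. total_variation \<mu> C)"
      using C by (intro SUP_upper2[of C]) auto
  qed (use E in \<open>auto intro!: SUP_least mono compact_borel\<close>)
  ultimately show ?thesis
    using \<mu> unfolding positive_measures_def regular_measures_def positive_charge_def by blast
qed

lemma point_measure_sums:
  fixes A :: "nat \<Rightarrow> 'a::topological_space set"
  assumes "range A \<subseteq> sets borel" "disjoint_family A"
  shows "(\<lambda>n. point_measure x (A n)) sums point_measure x (\<Union>n. A n)"
proof (cases "x \<in> (\<Union>n. A n)")
  case True
  then obtain m where m: "x \<in> A m" by blast
  have "x \<in> A n \<longleftrightarrow> n = m" for n using m assms(2) by (auto simp: disjoint_family_on_def)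
  then have "(\<lambda>n. point_measure x (A n)) = (\<lambda>n. if n = m then 1 else 0)"
    using assms(1) by (auto simp: point_measure_def)
  moreover have "(\<Union>n. A n) \<in> sets borel" using assms(1) by auto
  ultimately show ?thesis using True sums_single[of m "\<lambda>_. 1::complex"] by (simp add: point_measure_def)
next
  case False
  then show ?thesis by (simp add: point_measure_def)
qed

definition point_combination :: "'i set \<Rightarrow> ('i \<Rightarrow> real) \<Rightarrow> ('i \<Rightarrow> 'a::topological_space) \<Rightarrow> 'a set \<Rightarrow> complex"
  where "point_combination I a y = (\<lambda>E. \<Sum>i\<in>I. of_real (a i) * point_measure (y i) E)"

lemma point_combination_positive:
  fixes y :: "'i \<Rightarrow> 'a::t2_space"
  assumes "finite I" "\<And>i. i \<in> I \<Longrightarrow> 0 \<le> a i"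
  shows "point_combination I a y \<in> positive_measures"
proof (rule positive_measuresI)
  have nonneg: "0 \<le> a i * Re (point_measure (y i) E)" if "i \<in> I" for i E
    using assms(2)[OF that] by (simp add: point_measure_def)
  have "(\<lambda>n. point_combination I a y (A n)) sums point_combination I a y (\<Union>n. A n)"
    if "range A \<subseteq> sets borel" "disjoint_family A" for A :: "nat \<Rightarrow> 'a set"
    unfolding point_combination_def by (intro sums_sum sums_mult point_measure_sums that)
  moreover have "Im (point_measure (y i) E) = 0" for i E by (simp add: point_measure_def)
  moreover have "point_combination I a y E = 0" if "E \<notin> sets borel" for E
    using that by (simp add: point_combination_def point_measure_def)
  ultimately show "positive_charge (point_combination I a y)"
    unfolding positive_charge_def complex_borel_measure_def
    by (auto simp: point_combination_def intro!: sum_nonneg nonneg)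
next
  fix E :: "'a set" assume E: "E \<in> sets borel"
  \<comment> \<open>Deleting the finitely many atoms outside \<open>E\<close> leaves an open set of
    the same measure; keeping only the atoms inside \<open>E\<close> will give the compact
    set.\<close>
  let ?U = "UNIV - (y ` I - E)"
  have U: "open ?U" using assms(1) by (intro open_Diff finite_imp_closed) auto
  then have "point_combination I a y ?U = point_combination I a y E"
    using E unfolding point_combination_def by (intro sum.cong refl) (auto simp: point_measure_def)
  with U show "\<exists>U. open U \<and> E \<subseteq> U \<and> point_combination I a y U = point_combination I a y E"
    by (intro exI[of _ ?U]) auto
  let ?C = "y ` I \<inter> E"
  have C: "compact ?C" using assms(1) by (intro finite_imp_compact) auto
  then have "point_combination I a y ?C = point_combination I a y E"
    using E compact_borel[OF C] unfolding point_combination_def by (intro sum.cong refl) (auto simp: point_measure_def)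
  with C show "\<exists>C. compact C \<and> C \<subseteq> E \<and> point_combination I a y C = point_combination I a y E"
    by (intro exI[of _ ?C]) auto
qed

lemma point_measure_positive: "point_measure (x :: 'a::t2_space) \<in> positive_measures"
  using point_combination_positive[of "{x}" "\<lambda>_. 1" "\<lambda>x. x"] by (simp add: point_combination_def)

section \<open>Integrals against finite mixtures of measures\<close>

lemma nn_integral_mixture:
  fixes f :: "'a \<Rightarrow> ennreal"
  assumes I: "finite I" and sets: "\<And>i. i \<in> I \<Longrightarrow> sets (Mi i) = sets M"
    and e: "\<And>E. E \<in> sets M \<Longrightarrow> emeasure M E = (\<Sum>i\<in>I. ennreal (c i) * emeasure (Mi i) E)"
    and f: "f \<in> borel_measurable M"
  shows "(\<integral>\<^sup>+x. f x \<partial>M) = (\<Sum>i\<in>I. ennreal (c i) * (\<integral>\<^sup>+x. f x \<partial>Mi i))"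
  using f
proof (induction rule: borel_measurable_induct)
  case (cong f g)
  have "(\<integral>\<^sup>+x. f x \<partial>M) = (\<integral>\<^sup>+x. g x \<partial>M)" using cong by (intro nn_integral_cong) auto
  moreover have "(\<integral>\<^sup>+x. f x \<partial>Mi i) = (\<integral>\<^sup>+x. g x \<partial>Mi i)" if "i \<in> I" for i
    using cong sets_eq_imp_space_eq[OF sets[OF that]] by (intro nn_integral_cong) auto
  ultimately show ?case using cong by simp
next
  case (set A)
  then show ?case using sets by (simp add: e)
next
  case (mult u d)
  have "u \<in> borel_measurable (Mi i)" if "i \<in> I" for i
    using mult sets[OF that] by (simp cong: measurable_cong_sets)
  then show ?case using mult by (simp add: nn_integral_cmult sum_distrib_left mult_ac)
next
  case (add u v)
  have "u \<in> borel_measurable (Mi i)" "v \<in> borel_measurable (Mi i)" if "i \<in> I" for i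
    using add sets[OF that] by (simp_all cong: measurable_cong_sets)
  then show ?case using add by (simp add: nn_integral_add distrib_left sum.distrib)
next
  case (seq U)
  have m: "U n \<in> borel_measurable (Mi i)" if "i \<in> I" for i n
    using seq(1) sets[OF that] by (simp cong: measurable_cong_sets)
  have "(\<integral>\<^sup>+x. (SUP n. U n) x \<partial>M) = (SUP n. \<integral>\<^sup>+x. U n x \<partial>M)"
    using seq(1,3) by (simp add: image_comp nn_integral_monotone_convergence_SUP)
  also have "\<dots> = (SUP n. \<Sum>i\<in>I. ennreal (c i) * (\<integral>\<^sup>+x. U n x \<partial>Mi i))"
    by (simp add: seq.IH)
  also have "\<dots> = (\<Sum>i\<in>I. SUP n. ennreal (c i) * (\<integral>\<^sup>+x. U n x \<partial>Mi i))"
    using seq(3) by (intro ennreal_SUP_sum)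
      (auto simp: incseq_def le_fun_def intro!: mult_left_mono nn_integral_mono)
  also have "\<dots> = (\<Sum>i\<in>I. ennreal (c i) * (\<integral>\<^sup>+x. (SUP n. U n) x \<partial>Mi i))"
    using seq(3) m by (intro sum.cong refl)
      (simp add: SUP_mult_left_ennreal[symmetric] image_comp nn_integral_monotone_convergence_SUP)
  finally show ?case .
qed

lemma integral_mixture:
  fixes f :: "'a \<Rightarrow> real"
  assumes I: "finite I" and sets: "\<And>i. i \<in> I \<Longrightarrow> sets (Mi i) = sets M"
    and c: "\<And>i. i \<in> I \<Longrightarrow> 0 \<le> c i"
    and e: "\<And>E. E \<in> sets M \<Longrightarrow> emeasure M E = (\<Sum>i\<in>I. ennreal (c i) * emeasure (Mi i) E)"
    and f: "f \<in> borel_measurable M" and bdd: "\<And>x. \<bar>f x\<bar> \<le> B"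
    and fin: "finite_measure M" "\<And>i. i \<in> I \<Longrightarrow> finite_measure (Mi i)"
  shows "(LINT x|M. f x) = (\<Sum>i\<in>I. c i * (LINT x|Mi i. f x))"
proof -
  have m: "f \<in> borel_measurable (Mi i)" if "i \<in> I" for i
    using f sets[OF that] by (simp cong: measurable_cong_sets)
  have int: "integrable (Mi i) f" if "i \<in> I" for i
    using m[OF that] bdd by (intro finite_measure.integrable_const_bound[OF fin(2)[OF that]]) auto
  have intM: "integrable M f"
    using f bdd by (intro finite_measure.integrable_const_bound[OF fin(1)]) auto
  have L: "enn2real (\<integral>\<^sup>+x. ennreal (g x) \<partial>M) = (\<Sum>i\<in>I. c i * enn2real (\<integral>\<^sup>+x. ennreal (g x) \<partial>Mi i))"
    if g: "g = f \<or> g = (\<lambda>x. - f x)" for g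
  proof -
    have "(\<integral>\<^sup>+x. ennreal (g x) \<partial>Mi i) < \<infinity>" if "i \<in> I" for i
      using int[OF that] g by (auto simp: real_integrable_def less_top)
    then have "enn2real (\<Sum>i\<in>I. ennreal (c i) * (\<integral>\<^sup>+x. ennreal (g x) \<partial>Mi i)) = (\<Sum>i\<in>I. c i * enn2real (\<integral>\<^sup>+x. ennreal (g x) \<partial>Mi i))"
      using c by (subst enn2real_sum) (auto simp: enn2real_mult ennreal_mult_less_top)
    moreover have "(\<integral>\<^sup>+x. ennreal (g x) \<partial>M) = (\<Sum>i\<in>I. ennreal (c i) * (\<integral>\<^sup>+x. ennreal (g x) \<partial>Mi i))"
      using f g by (intro nn_integral_mixture[OF I sets e]) auto
    ultimately show ?thesis by simp
  qed
  have "(LINT x|M. f x) = enn2real (\<integral>\<^sup>+x. ennreal (f x) \<partial>M) - enn2real (\<integral>\<^sup>+x. ennreal (- f x) \<partial>M)"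
    by (rule real_lebesgue_integral_def[OF intM])
  also have "\<dots> = (\<Sum>i\<in>I. c i * (enn2real (\<integral>\<^sup>+x. ennreal (f x) \<partial>Mi i) - enn2real (\<integral>\<^sup>+x. ennreal (- f x) \<partial>Mi i)))"
    using L[of f] L[of "\<lambda>x. - f x"] by (simp add: right_diff_distrib sum_subtractf)
  also have "\<dots> = (\<Sum>i\<in>I. c i * (LINT x|Mi i. f x))"
    using int by (intro sum.cong refl) (simp add: real_lebesgue_integral_def)
  finally show ?thesis .
qed

lemma integral_to_measure_combination:
  fixes f :: "'a::topological_space \<Rightarrow> real"
  assumes "finite I" "\<And>i. i \<in> I \<Longrightarrow> 0 \<le> c i" and \<mu>: "\<And>i. i \<in> I \<Longrightarrow> positive_charge (\<mu> i)"
    and \<nu>: "positive_charge (\<lambda>E. \<Sum>i\<in>I. of_real (c i) * \<mu> i E)"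
    and f: "f \<in> borel_measurable borel" and bdd: "\<And>x. \<bar>f x\<bar> \<le> B"
  shows "(LINT x|to_measure (\<lambda>E. \<Sum>i\<in>I. of_real (c i) * \<mu> i E). f x) = (\<Sum>i\<in>I. c i * (LINT x|to_measure (\<mu> i). f x))"
proof (rule integral_mixture)
  fix E assume "E \<in> sets (to_measure (\<lambda>E. \<Sum>i\<in>I. of_real (c i) * \<mu> i E))"
  then have E: "E \<in> sets borel" by simp
  show "emeasure (to_measure (\<lambda>E. \<Sum>i\<in>I. of_real (c i) * \<mu> i E)) E = (\<Sum>i\<in>I. ennreal (c i) * emeasure (to_measure (\<mu> i)) E)"
    using assms(2) \<mu> by (simp add: emeasure_to_measure[OF \<nu> E] emeasure_to_measure[OF _ E] positive_charge_def
        flip: ennreal_mult sum_ennreal)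
qed (use assms finite_measure_to_measure in auto)

lemma to_measure_point: "to_measure (point_measure (x :: 'a::t2_space)) = return borel x"
  by (rule measure_eqI)
     (auto simp: emeasure_to_measure[OF positive_measures_charge[OF point_measure_positive]] point_measure_def)

section \<open>The weak topology and density of point combinations\<close>

lemma topspace_weak_topology:
  "topspace weak_topology = (positive_measures :: ('a::topological_space set \<Rightarrow> complex) set)"
proof -
  have "positive_measures \<in> {{\<mu>\<in>positive_measures. (LINT x|to_measure \<mu>. f x) \<in> U} | (f::'a \<Rightarrow> real) U.
       continuous_on UNIV f \<and> bounded (range f) \<and> open U}"
    by (rule CollectI, rule exI[of _ "\<lambda>_. 0"], rule exI[of _ UNIV]) auto
  then show ?thesis unfolding weak_topology_def topology_generated_by_topspace by blast
qed

lemma continuous_map_weak_integral: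
  fixes f :: "'a::topological_space \<Rightarrow> real"
  assumes "continuous_on UNIV f" "bounded (range f)"
  shows "continuous_map weak_topology euclideanreal (\<lambda>\<mu>. LINT x|to_measure \<mu>. f x)"
  unfolding continuous_map_def topspace_weak_topology
proof (intro conjI allI impI)
  fix U :: "real set" assume "openin euclideanreal U"
  then show "openin weak_topology {\<mu> \<in> positive_measures. (LINT x|to_measure \<mu>. f x) \<in> U}"
    unfolding weak_topology_def using assms by (intro topology_generated_by_Basis) auto
qed auto

lemma continuous_map_point_measure:
  "continuous_map euclidean weak_topology (point_measure :: 'a::t2_space \<Rightarrow> _)"
  unfolding weak_topology_def continuous_on_generated_topo_iff
proof (intro conjI allI impI)
  fix W :: "('a set \<Rightarrow> complex) set"
  assume "W \<in> {{\<mu>\<in>positive_measures. (LINT x|to_measure \<mu>. f x) \<in> U} | (f::'a \<Rightarrow> real) U.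
       continuous_on UNIV f \<and> bounded (range f) \<and> open U}"
  then obtain f :: "'a \<Rightarrow> real" and U where W: "W = {\<mu>\<in>positive_measures. (LINT x|to_measure \<mu>. f x) \<in> U}"
    "continuous_on UNIV f" "open U" by blast
  have "f \<in> borel_measurable borel" using W(2) by (rule borel_measurable_continuous_onI)
  then have "point_measure -` W = f -` U"
    by (auto simp: W(1) point_measure_positive to_measure_point integral_return)
  then show "openin euclidean (point_measure -` W \<inter> topspace euclidean)"
    using W(2,3) by (simp add: open_vimage)
next
  show "point_measure ` topspace euclidean \<subseteq> \<Union> {{\<mu>\<in>positive_measures. (LINT x|to_measure \<mu>. f x) \<in> U} | (f::'a \<Rightarrow> real) U.
       continuous_on UNIV f \<and> bounded (range f) \<and> open U}"
    using topspace_weak_topology[where 'a = 'a] point_measure_positive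
    unfolding weak_topology_def topology_generated_by_topspace by auto
qed

text \<open>The generating sets of the weak topology form only a subbasis; this is the corresponding
  base, with finitely many test functions and one common tolerance.\<close>

definition weak_basic_nhd ::
  "('a::topological_space set \<Rightarrow> complex) set \<Rightarrow> ('a set \<Rightarrow> complex) \<Rightarrow> ('a \<Rightarrow> real) set \<Rightarrow> real \<Rightarrow> bool"
  where "weak_basic_nhd W \<mu> J \<epsilon> \<longleftrightarrow>
    finite J \<and> 0 < \<epsilon> \<and> (\<forall>f\<in>J. continuous_on UNIV f \<and> bounded (range f)) \<and>
    (\<forall>\<nu>\<in>positive_measures.
      (\<forall>f\<in>J. \<bar>(LINT x|to_measure \<nu>. f x) - (LINT x|to_measure \<mu>. f x)\<bar> < \<epsilon>) \<longrightarrow> \<nu> \<in> W)"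

lemma weak_basic_nhd_exists:
  fixes \<mu> :: "'a::topological_space set \<Rightarrow> complex"
  assumes "openin weak_topology W" "\<mu> \<in> W"
  shows "\<exists>J \<epsilon>. weak_basic_nhd W \<mu> J \<epsilon>"
  using openin_topology_generated_by[OF assms(1)[unfolded weak_topology_def]] assms(2)
proof (induction rule: generate_topology_on.induct)
  case Empty
  then show ?case by simp
next
  case (Int A B)
  then obtain J1 \<epsilon>1 J2 \<epsilon>2 where J: "weak_basic_nhd A \<mu> J1 \<epsilon>1" "weak_basic_nhd B \<mu> J2 \<epsilon>2" by blast
  have "weak_basic_nhd (A \<inter> B) \<mu> (J1 \<union> J2) (min \<epsilon>1 \<epsilon>2)"
    using J unfolding weak_basic_nhd_def by (simp add: ball_Un)
  then show ?case by blast
next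
  case (UN K)
  then obtain k where k: "k \<in> K" "\<mu> \<in> k" by blast
  from UN.IH[OF this] obtain J \<epsilon> where "weak_basic_nhd k \<mu> J \<epsilon>" by blast
  then have "weak_basic_nhd (\<Union>K) \<mu> J \<epsilon>"
    using k(1) unfolding weak_basic_nhd_def by blast
  then show ?case by blast
next
  case (Basis W)
  then obtain f :: "'a \<Rightarrow> real" and U where W: "W = {\<mu>\<in>positive_measures. (LINT x|to_measure \<mu>. f x) \<in> U}"
    "continuous_on UNIV f" "bounded (range f)" "open U" by blast
  with Basis(2) obtain \<epsilon> where \<epsilon>: "0 < \<epsilon>" "ball (LINT x|to_measure \<mu>. f x) \<epsilon> \<subseteq> U"
    by (auto elim!: openE)
  have "\<nu> \<in> W" if "\<nu> \<in> positive_measures" "\<bar>(LINT x|to_measure \<nu>. f x) - (LINT x|to_measure \<mu>. f x)\<bar> < \<epsilon>" for \<nu>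
  proof -
    have "(LINT x|to_measure \<nu>. f x) \<in> ball (LINT x|to_measure \<mu>. f x) \<epsilon>"
      using that(2) by (simp add: dist_real_def abs_minus_commute)
    with \<epsilon>(2) that(1) show ?thesis by (auto simp: W(1))
  qed
  then have "weak_basic_nhd W \<mu> {f} \<epsilon>"
    using W(2,3) \<epsilon>(1) by (simp add: weak_basic_nhd_def)
  then show ?case by blast
qed

text \<open>Quantisation: the compact carrier \<open>S\<close> is cut into finitely many pieces, on
  each of which every test function of a basic neighbourhood stays within \<epsilon> of its value at
  one point, and the mass of the piece is moved to that point.\<close>

lemma positive_measure_in_closure_of_combinations:
  fixes \<mu> :: "'a::t2_space set \<Rightarrow> complex"
  assumes \<mu>: "\<mu> \<in> positive_measures" and S: "compact S" and null: "emeasure (to_measure \<mu>) (- S) = 0"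
  shows "\<mu> \<in> weak_topology closure_of
    {point_combination {..<n} a y | (n::nat) a y. \<forall>i<n. 0 \<le> a i}"
  unfolding in_closure_of topspace_weak_topology
proof (intro conjI \<mu> allI impI, elim conjE)
  fix W assume W: "\<mu> \<in> W" "openin weak_topology W"
  let ?M = "to_measure \<mu>"
  interpret finite_measure ?M by (rule finite_measure_to_measure[OF positive_measures_charge[OF \<mu>]])
  obtain J \<epsilon>0 where "weak_basic_nhd W \<mu> J \<epsilon>0"
    using weak_basic_nhd_exists[OF W(2,1)] by blast
  then have J: "finite J" "0 < \<epsilon>0" "\<And>f. f \<in> J \<Longrightarrow> continuous_on UNIV f" "\<And>f. f \<in> J \<Longrightarrow> bounded (range f)"
    and JW: "\<And>\<nu>. \<nu> \<in> positive_measures \<Longrightarrow>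
      (\<And>f. f \<in> J \<Longrightarrow> \<bar>(LINT x|to_measure \<nu>. f x) - (LINT x|?M. f x)\<bar> < \<epsilon>0) \<Longrightarrow> \<nu> \<in> W"
    unfolding weak_basic_nhd_def by blast+
  define m where "m = measure ?M UNIV"
  have m: "0 \<le> m" by (simp add: m_def)
  \<comment> \<open>The summand 1 keeps \<epsilon> positive and
    \<open>\<epsilon> * m < \<epsilon>0\<close> strict even when the mass \<open>m\<close> is
    0.\<close>
  define \<epsilon> where "\<epsilon> = \<epsilon>0 / (m + 1)"
  have \<epsilon>: "0 < \<epsilon>" using J(2) m by (simp add: \<epsilon>_def)
  have \<epsilon>m: "\<epsilon> * m < \<epsilon>0" using J(2) m by (simp add: \<epsilon>_def field_simps)
  define V where "V x = (\<Inter>f\<in>J. {z. \<bar>f z - f x\<bar> < \<epsilon>})" for x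
  have Vo: "open (V x)" for x
    unfolding V_def using J by (intro open_INT ballI open_Collect_less continuous_intros) auto
  have "S \<subseteq> (\<Union>x\<in>S. V x)" using \<epsilon> by (auto simp: V_def)
  then obtain F where F: "F \<subseteq> S" "finite F" "S \<subseteq> (\<Union>x\<in>F. V x)"
    using compactE_image[OF S, of S V] Vo by metis
  obtain xs where xs: "set xs = F" using finite_list[OF F(2)] by blast
  define n where "n = length xs"
  define y where "y i = xs ! i" for i
  \<comment> \<open>The least index turns the cover into disjoint pieces. The alternative
    \<open>i \<ge> n\<close> makes it exist everywhere: points in no cover set get the value
    \<open>n\<close>, and they lie outside \<open>S\<close>.\<close>
  define idx where "idx z = (LEAST i. i \<ge> n \<or> z \<in> V (y i))" for z
  have [measurable]: "V x \<in> sets ?M" for x using Vo by simp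
  have idx_m[measurable]: "idx \<in> measurable ?M (count_space UNIV)"
    unfolding idx_def by measurable
  define a where "a i = measure ?M {z. idx z = i}" for i
  have idx_sets: "{z. idx z = i} \<in> sets ?M" for i
    using measurable_sets[OF idx_m, of "{i}"] by (simp add: vimage_def)
  have idx: "idx z < n" "z \<in> V (y (idx z))" if "z \<in> S" for z
  proof -
    from that F(3) xs obtain i where i: "i < n" "z \<in> V (y i)"
      by (force simp: n_def y_def in_set_conv_nth)
    then have "idx z \<le> i" unfolding idx_def by (intro Least_le) simp
    with i(1) show "idx z < n" by simp
    moreover have "idx z \<ge> n \<or> z \<in> V (y (idx z))"
      unfolding idx_def by (rule LeastI[of _ i]) (use i in simp)
    ultimately show "z \<in> V (y (idx z))" by simp
  qed
  define \<nu> where "\<nu> = point_combination {..<n} a y"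
  have a: "0 \<le> a i" for i by (simp add: a_def)
  have \<nu>: "\<nu> \<in> positive_measures" unfolding \<nu>_def by (rule point_combination_positive) (auto simp: a)
  have "\<nu> \<in> W"
  proof (rule JW[OF \<nu>])
    fix f assume f: "f \<in> J"
    have fm: "f \<in> borel_measurable borel" using J(3)[OF f] by (rule borel_measurable_continuous_onI)
    then have [measurable]: "f \<in> borel_measurable ?M" by simp
    obtain B where B: "\<And>x. \<bar>f x\<bar> \<le> B" using J(4)[OF f] by (auto simp: bounded_iff)
    have int: "integrable ?M f" using B by (intro integrable_const_bound[of _ B]) auto
    let ?g = "\<lambda>z. \<Sum>i<n. f (y i) * indicator {z. idx z = i} z"
    have intg: "integrable ?M ?g" using idx_sets by (intro Bochner_Integration.integrable_sum) (auto simp: less_top[symmetric])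
    have "(LINT x|to_measure \<nu>. f x) = (\<Sum>i<n. a i * f (y i))"
      using integral_to_measure_combination[of "{..<n}" a "\<lambda>i. point_measure (y i)" f B]
        \<nu> a B fm positive_measures_charge[OF \<nu>]
      by (simp add: \<nu>_def point_combination_def positive_measures_charge point_measure_positive to_measure_point integral_return)
    also have "\<dots> = (LINT z|?M. ?g z)"
      using idx_sets by (subst Bochner_Integration.integral_sum) (auto simp: a_def less_top[symmetric] mult.commute)
    finally have "(LINT x|to_measure \<nu>. f x) - (LINT x|?M. f x) = (LINT z|?M. ?g z - f z)"
      using int intg by simp
    moreover have "\<bar>LINT z|?M. ?g z - f z\<bar> \<le> (LINT z|?M. \<epsilon>)"
    proof (rule order_trans[OF integral_abs_bound], rule integral_mono_AE)
      have "AE z in ?M. z \<in> S"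
        using null S by (intro AE_I[of _ _ "- S"]) (auto simp: compact_imp_closed)
      then show "AE z in ?M. \<bar>?g z - f z\<bar> \<le> \<epsilon>"
      proof eventually_elim
        case (elim z)
        have "?g z = (\<Sum>i<n. if i = idx z then f (y i) else 0)" by (intro sum.cong) auto
        also have "\<dots> = f (y (idx z))" using idx(1)[OF elim] by simp
        finally show ?case using idx(2)[OF elim] f by (auto simp: V_def abs_minus_commute intro: less_imp_le)
      qed
    qed (use int intg in auto)
    ultimately show "\<bar>(LINT x|to_measure \<nu>. f x) - (LINT x|?M. f x)\<bar> < \<epsilon>0"
      using \<epsilon>m by (simp add: m_def mult.commute)
  qed
  then show "\<exists>\<nu>. \<nu> \<in> {point_combination {..<n} a y | (n::nat) a y. \<forall>i<n. 0 \<le> a i} \<and> \<nu> \<in> W"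
    using a \<nu>_def by blast
qed

text \<open>Both sides are weakly continuous in the measure and agree on combinations of point
  measures, which have \<mu> in their closure.\<close>

lemma weakly_continuous_functional_eq_integral:
  fixes L :: "('a::t2_space set \<Rightarrow> complex) \<Rightarrow> real"
  assumes L: "continuous_map weak_topology euclideanreal L"
    and lin: "\<And>(n::nat) a y. (\<And>i. i < n \<Longrightarrow> 0 \<le> a i) \<Longrightarrow>
      L (point_combination {..<n} a y) = (\<Sum>i<n. a i * L (point_measure (y i)))"
    and bdd: "\<And>x. \<bar>L (point_measure x)\<bar> \<le> B"
    and \<mu>: "\<mu> \<in> positive_measures" "compact S" "emeasure (to_measure \<mu>) (- S) = 0"
  shows "L \<mu> = (LINT x|to_measure \<mu>. L (point_measure x))"
proof -
  let ?l = "\<lambda>x. L (point_measure x)"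
  have "continuous_map euclidean euclideanreal (L \<circ> point_measure)"
    by (rule continuous_map_compose[OF continuous_map_point_measure L])
  then have c: "continuous_on UNIV ?l" by (simp add: comp_def)
  have b: "bounded (range ?l)" using bdd by (auto simp: bounded_iff)
  have m: "?l \<in> borel_measurable borel" using c by (rule borel_measurable_continuous_onI)
  show ?thesis
  proof (rule forall_in_closure_of_eq[OF positive_measure_in_closure_of_combinations[OF \<mu>] _ L continuous_map_weak_integral[OF c b]])
    fix \<nu> assume "\<nu> \<in> {point_combination {..<n} a y | (n::nat) a (y :: nat \<Rightarrow> 'a). \<forall>i<n. 0 \<le> a i}"
    then obtain n :: nat and a and y :: "nat \<Rightarrow> 'a" where \<nu>: "\<nu> = point_combination {..<n} a y" "\<And>i. i < n \<Longrightarrow> 0 \<le> a i" by blast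
    have "\<nu> \<in> positive_measures" unfolding \<nu>(1) by (rule point_combination_positive) (auto simp: \<nu>(2))
    then have "(LINT x|to_measure \<nu>. ?l x) = (\<Sum>i<n. a i * ?l (y i))"
      using integral_to_measure_combination[of "{..<n}" a "\<lambda>i. point_measure (y i)" ?l B] \<nu>(2) bdd m
      by (simp add: \<nu>(1) point_combination_def positive_measures_charge point_measure_positive to_measure_point integral_return)
    then show "L \<nu> = (LINT x|to_measure \<nu>. ?l x)"
      using lin[of n a y] \<nu> by simp
  qed simp
qed

text \<open>Linearity reaches only finite combinations of point measures; weak continuity carries
  the formula to \<mu>, so that \<open>\<Phi> \<mu>\<close> is a mixture of the images of point
  measures. This is what makes associativity of \<open>conv\<close> usable through
  integrals.\<close>

lemma integral_weakly_continuous_linear_map: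
  fixes \<Phi> :: "('a::t2_space set \<Rightarrow> complex) \<Rightarrow> 'a set \<Rightarrow> complex" and h :: "'a \<Rightarrow> real"
  assumes \<Phi>: "continuous_map weak_topology weak_topology \<Phi>"
    and linear: "\<And>\<mu> \<mu>' a b. \<mu> \<in> regular_measures \<Longrightarrow> \<mu>' \<in> regular_measures \<Longrightarrow>
      \<Phi> (\<lambda>E. a * \<mu> E + b * \<mu>' E) = (\<lambda>E. a * \<Phi> \<mu> E + b * \<Phi> \<mu>' E)"
    and one: "\<And>x. \<Phi> (point_measure x) UNIV = 1"
    and h: "continuous_on UNIV h" "bounded (range h)"
    and \<mu>: "\<mu> \<in> positive_measures" "compact S" "emeasure (to_measure \<mu>) (- S) = 0"
  shows "(LINT z|to_measure (\<Phi> \<mu>). h z) = (LINT x|to_measure \<mu>. (LINT z|to_measure (\<Phi> (point_measure x)). h z))"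
proof -
  obtain B where B: "\<And>x. \<bar>h x\<bar> \<le> B" using h(2) by (auto simp: bounded_iff)
  have hm: "h \<in> borel_measurable borel" using h(1) by (rule borel_measurable_continuous_onI)
  let ?L = "\<lambda>\<mu>. LINT z|to_measure (\<Phi> \<mu>). h z"
  have pos: "\<Phi> \<nu> \<in> positive_measures" if "\<nu> \<in> positive_measures" for \<nu>
    using continuous_map_image_subset_topspace[OF \<Phi>] that by (auto simp: topspace_weak_topology)
  have L: "continuous_map weak_topology euclideanreal ?L"
    using continuous_map_compose[OF \<Phi> continuous_map_weak_integral[OF h]] by (simp add: comp_def)
  have comb: "\<Phi> (point_combination {..<n::nat} a y) = (\<lambda>E. \<Sum>i<n. of_real (a i) * \<Phi> (point_measure (y i)) E)"
    if "\<And>i. i < n \<Longrightarrow> 0 \<le> a i" for n a y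
    using that
  proof (induction n)
    \<comment> \<open>Linearity with both coefficients 0 sends the zero measure to itself.\<close>
    case 0
    show ?case
      using linear[of "point_measure undefined" "point_measure undefined" 0 0]
        positive_measures_regular[OF point_measure_positive[of "undefined :: 'a"]]
      by (simp add: point_combination_def)
  next
    case (Suc n)
    have eq: "point_combination {..<Suc n} a y = (\<lambda>E. 1 * point_combination {..<n} a y E + of_real (a n) * point_measure (y n) E)"
      by (simp add: point_combination_def)
    have "point_combination {..<n} a y \<in> regular_measures"
      using Suc.prems by (intro positive_measures_regular point_combination_positive) auto
    then show ?case
      unfolding eq by (subst linear) (use Suc in \<open>auto simp: positive_measures_regular point_measure_positive\<close>)
  qed
  have "?L (point_combination {..<n::nat} a y) = (\<Sum>i<n. a i * ?L (point_measure (y i)))"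
    if a: "\<And>i. i < n \<Longrightarrow> 0 \<le> a i" for n a y
  proof -
    have eq: "\<Phi> (point_combination {..<n} a y) = (\<lambda>E. \<Sum>i<n. of_real (a i) * \<Phi> (point_measure (y i)) E)"
      using a by (rule comb)
    have "\<Phi> (point_combination {..<n} a y) \<in> positive_measures"
      using a by (intro pos point_combination_positive) auto
    then have "positive_charge (\<lambda>E. \<Sum>i<n. of_real (a i) * \<Phi> (point_measure (y i)) E)"
      unfolding eq by (rule positive_measures_charge)
    then show ?thesis
      unfolding eq using a B hm
      by (intro integral_to_measure_combination[of _ _ _ _ B])
         (auto intro: positive_measures_charge pos point_measure_positive)
  qed
  moreover have "\<bar>?L (point_measure x)\<bar> \<le> B" for x
  proof -
    note c = positive_measures_charge[OF pos[OF point_measure_positive[of x]]]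
    interpret prob_space "to_measure (\<Phi> (point_measure x))"
      by (rule prob_spaceI) (simp add: emeasure_to_measure[OF c] one)
    have "integrable (to_measure (\<Phi> (point_measure x))) h"
      using B hm by (intro integrable_const_bound[of _ B]) auto
    then have "\<bar>?L (point_measure x)\<bar> \<le> (LINT z|to_measure (\<Phi> (point_measure x)). B)"
      by (intro order_trans[OF integral_abs_bound] integral_mono) (use B in auto)
    then show ?thesis using prob_space by simp
  qed
  ultimately show ?thesis
    using weakly_continuous_functional_eq_integral[OF L, of B \<mu> S] \<mu> by simp
qed


section \<open>Convolution of point measures\<close>

context hypergroup
begin

definition kernel :: "'a \<Rightarrow> 'a \<Rightarrow> 'a measure"
  where "kernel x y = to_measure (conv (point_measure x) (point_measure y))"

definition supp :: "'a \<Rightarrow> 'a \<Rightarrow> 'a set"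
  where "supp x y = support (conv (point_measure x) (point_measure y))"

lemma sets_kernel [simp, measurable_cong]: "sets (kernel x y) = sets borel"
  and space_kernel [simp]: "space (kernel x y) = UNIV"
  by (simp_all add: kernel_def)

lemma emeasure_kernel:
  "E \<in> sets borel \<Longrightarrow> emeasure (kernel x y) E = ennreal (Re (conv (point_measure x) (point_measure y) E))"
  unfolding kernel_def by (rule emeasure_to_measure[OF positive_measures_charge[OF conv_point_positive]])

lemma prob_space_kernel: "prob_space (kernel x y)"
  by (rule prob_spaceI) (simp add: emeasure_kernel conv_point_prob)

lemma kernel_compact_inner_regular: "compact_inner_regular (kernel x y)"
  unfolding kernel_def by (rule to_measure_compact_inner_regular[OF conv_point_positive])

lemma translation_eq: "translation conv x f y = (\<integral>\<^sup>+z. f z \<partial>kernel x y)"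
  by (simp add: translation_def kernel_def)

lemma integrable_kernel:
  fixes f :: "'a \<Rightarrow> real"
  assumes "continuous_on UNIV f" "bounded (range f)"
  shows "integrable (kernel x y) f"
proof -
  interpret prob_space "kernel x y" by (rule prob_space_kernel)
  obtain B where "\<And>x. \<bar>f x\<bar> \<le> B" using assms(2) by (auto simp: bounded_iff)
  moreover have "f \<in> borel_measurable borel" using assms(1) by (rule borel_measurable_continuous_onI)
  ultimately show ?thesis by (intro integrable_const_bound[of _ B]) auto
qed

lemma continuous_integral_kernel:
  fixes f :: "'a \<Rightarrow> real"
  assumes "continuous_on UNIV f" "bounded (range f)"
  shows "continuous_on UNIV (\<lambda>p. LINT z|kernel (fst p) (snd p). f z)"
proof -
  have "continuous_map euclidean (prod_topology weak_topology weak_topology)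
    (\<lambda>p :: 'a \<times> 'a. (point_measure (fst p), point_measure (snd p)))"
    by (intro continuous_map_pairedI continuous_map_compose[OF _ continuous_map_point_measure, unfolded comp_def])
       (auto intro: continuous_on_fst continuous_on_snd continuous_on_id)
  from continuous_map_compose[OF continuous_map_compose[OF this conv_weakly_continuous] continuous_map_weak_integral[OF assms]]
  show ?thesis by (simp add: comp_def kernel_def)
qed

section \<open>Semicontinuity and measurability of the convolution kernel\<close>

lemma completely_regular: "completely_regular_space (euclidean :: 'a topology)"
proof (rule locally_compact_regular_imp_completely_regular_space[OF locally_compact])
  have "Hausdorff_space (euclidean :: 'a topology)"
    unfolding Hausdorff_space_def using hausdorff by (auto simp: disjnt_def)
  then show "Hausdorff_space (euclidean :: 'a topology) \<or> regular_space (euclidean :: 'a topology)" by simp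
qed

lemma Urysohn_compact_open:
  assumes "compact (C :: 'a set)" "open U" "C \<subseteq> U"
  obtains h :: "'a \<Rightarrow> real" where "continuous_on UNIV h" "bounded (range h)"
    "\<And>x. 0 \<le> h x" "\<And>x. h x \<le> 1" "\<And>x. x \<in> C \<Longrightarrow> h x = 1" "\<And>x. x \<notin> U \<Longrightarrow> h x = 0"
proof -
  obtain h :: "'a \<Rightarrow> real" where h: "continuous_map euclidean (top_of_set {0..1}) h" "h ` (- U) \<subseteq> {0}" "h ` C \<subseteq> {1}"
    using Urysohn_completely_regular_compact_closed[of 0 "1 :: real" "euclidean :: 'a topology" C "- U"]
      completely_regular assms by (auto simp: disjnt_def closed_Compl)
  have h01: "h x \<in> {0..1}" for x using h(1) by (auto simp: continuous_map_in_subtopology)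
  show thesis
  proof
    show "continuous_on UNIV h" using h(1) by (auto simp: continuous_map_in_subtopology)
    show "bounded (range h)" using h01 by (auto simp: bounded_iff intro!: exI[of _ 1])
  qed (use h01 h(2,3) in auto)
qed

text \<open>Weak continuity controls integrals of continuous functions only. A Urysohn function
  between \<open>U\<close> and a compact subset carrying enough mass transfers it to open sets as
  lower semicontinuity.\<close>

lemma open_kernel_greater:
  assumes U: "open U"
  shows "open {p. a < emeasure (kernel (fst p) (snd p)) U}"
proof (subst open_subopen, safe)
  fix x y assume a: "a < emeasure (kernel (fst (x, y)) (snd (x, y))) U"
  then obtain C where C: "compact C" "C \<subseteq> U" "a < emeasure (kernel x y) C"
    using compact_inner_regular_less[OF kernel_compact_inner_regular, of U a x y] U by auto
  obtain h :: "'a \<Rightarrow> real" where h: "continuous_on UNIV h" "bounded (range h)"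
    "\<And>x. 0 \<le> h x" "\<And>x. h x \<le> 1" "\<And>x. x \<in> C \<Longrightarrow> h x = 1" "\<And>x. x \<notin> U \<Longrightarrow> h x = 0"
    by (rule Urysohn_compact_open[OF C(1) U C(2)]) blast
  have eq: "ennreal (LINT z|kernel x y. h z) = (\<integral>\<^sup>+z. ennreal (h z) \<partial>kernel x y)" for x y
    using integrable_kernel[OF h(1,2)] h(3) by (intro nn_integral_eq_integral[symmetric]) auto
  let ?T = "{p. a < ennreal (LINT z|kernel (fst p) (snd p). h z)}"
  have "open ?T"
    by (intro open_Collect_less continuous_intros continuous_on_ennreal continuous_integral_kernel h)
  moreover have "(x, y) \<in> ?T"
  proof -
    have "emeasure (kernel x y) C = (\<integral>\<^sup>+z. indicator C z \<partial>kernel x y)"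
      using C(1) by (simp add: compact_borel)
    also have "\<dots> \<le> (\<integral>\<^sup>+z. ennreal (h z) \<partial>kernel x y)"
      using h(5) by (intro nn_integral_mono) (auto simp: indicator_def)
    finally show ?thesis using C(3) by (simp add: eq)
  qed
  moreover have "?T \<subseteq> {p. a < emeasure (kernel (fst p) (snd p)) U}"
  proof safe
    fix x y assume "a < ennreal (LINT z|kernel (fst (x, y)) (snd (x, y)). h z)"
    also have "ennreal (LINT z|kernel (fst (x, y)) (snd (x, y)). h z) \<le> (\<integral>\<^sup>+z. indicator U z \<partial>kernel x y)"
    proof -
      have "ennreal (h z) \<le> indicator U z" for z
        using h(4)[of z] h(6)[of z] by (auto simp: indicator_def)
      then show ?thesis by (simp add: eq nn_integral_mono)
    qed
    also have "\<dots> = emeasure (kernel x y) U" using U by simp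
    finally show "a < emeasure (kernel (fst (x, y)) (snd (x, y))) U" by simp
  qed
  ultimately show "\<exists>T. open T \<and> (x, y) \<in> T \<and> T \<subseteq> {p. a < emeasure (kernel (fst p) (snd p)) U}"
    by blast
qed

text \<open>Lower semicontinuity settles the open sets, an intersection-stable generator. The source
  is the Borel \<sigma>-algebra of the product space, which may exceed the product of the Borel
  \<sigma>-algebras.\<close>

lemma measurable_kernel: "(\<lambda>p. kernel (fst p) (snd p)) \<in> borel \<rightarrow>\<^sub>M subprob_algebra borel"
proof (rule measurable_subprob_algebra_generated)
  show "sets (borel :: 'a measure) = sigma_sets UNIV {S. open S}" by (simp add: borel_def)
  show "Int_stable {S :: 'a set. open S}" by (auto simp: Int_stable_def)
  fix p :: "'a \<times> 'a"
  interpret prob_space "kernel (fst p) (snd p)" by (rule prob_space_kernel)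
  show "subprob_space (kernel (fst p) (snd p))" by unfold_locales
next
  fix U :: "'a set" assume "U \<in> {S. open S}"
  then show "(\<lambda>p. emeasure (kernel (fst p) (snd p)) U) \<in> borel_measurable borel"
    by (intro borel_measurableI_greater) (auto intro!: borel_open open_kernel_greater)
next
  have "(\<lambda>p. emeasure (kernel (fst p) (snd p)) UNIV) = (\<lambda>_. 1)"
    by (simp add: emeasure_kernel conv_point_prob)
  then show "(\<lambda>p. emeasure (kernel (fst p) (snd p)) UNIV) \<in> borel_measurable borel" by simp
qed auto

lemma mem_supp_iff: "z \<in> supp x y \<longleftrightarrow> (\<forall>U. open U \<and> z \<in> U \<longrightarrow> 0 < emeasure (kernel x y) U)"
  by (simp add: supp_def support_def kernel_def total_variation_positive
      positive_measures_charge[OF conv_point_positive] cong: conj_cong imp_cong)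

lemma kernel_null:
  assumes "open U" "U \<inter> supp x y = {}"
  shows "emeasure (kernel x y) U = 0"
proof (rule locally_null_imp_null[OF kernel_compact_inner_regular assms(1)])
  fix z assume "z \<in> U"
  then have "z \<notin> supp x y" using assms(2) by auto
  then show "\<exists>V. open V \<and> z \<in> V \<and> emeasure (kernel x y) V = 0"
    by (auto simp: mem_supp_iff)
qed

lemma compact_supp: "compact (supp x y)"
  unfolding supp_def by (rule conv_point_compact)

lemma kernel_null_compl_supp: "emeasure (kernel x y) (- supp x y) = 0"
  by (rule kernel_null) (auto intro!: compact_imp_closed compact_supp)

lemma supp_upper_semicontinuous:
  assumes "supp x y \<subseteq> U" "open U"
  obtains X Y where "open X" "x \<in> X" "open Y" "y \<in> Y" "\<And>x' y'. x' \<in> X \<Longrightarrow> y' \<in> Y \<Longrightarrow> supp x' y' \<subseteq> U"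
proof -
  \<comment> \<open>With \<open>V = UNIV\<close> a generating set of the Michael topology retains
    only the upper condition \<open>L \<subseteq> U\<close>.\<close>
  let ?L = "{L :: 'a set. compact L \<and> L \<noteq> {} \<and> L \<inter> UNIV \<noteq> {} \<and> L \<subseteq> U}"
  let ?f = "\<lambda>(x, y). support (conv (point_measure x) (point_measure y))"
  have "openin michael_topology ?L"
    unfolding michael_topology_def by (rule topology_generated_by_Basis) (use assms(2) in blast)
  from openin_continuous_map_preimage[OF support_continuous this]
  have o: "open {p. ?f p \<in> ?L}" by simp
  \<comment> \<open>The points of the Michael topology are nonempty sets, so supports are
    nonempty.\<close>
  have "?f (x, y) \<in> topspace michael_topology"
    using continuous_map_image_subset_topspace[OF support_continuous] by auto
  then have "supp x y \<noteq> {}"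
    unfolding michael_topology_def topology_generated_by_topspace by (auto simp: supp_def)
  then have "(x, y) \<in> {p. ?f p \<in> ?L}"
    using assms(1) compact_supp[of x y] by (simp add: supp_def)
  then obtain X Y where "open X" "open Y" "(x, y) \<in> X \<times> Y" "X \<times> Y \<subseteq> {p. ?f p \<in> ?L}"
    by (rule open_prod_elim[OF o])
  moreover from this(4) have "supp x' y' \<subseteq> U" if "x' \<in> X" "y' \<in> Y" for x' y'
    using that by (auto simp: supp_def)
  ultimately show thesis by (intro that[of X Y]) auto
qed

lemma supp_identity: "supp x e = {x}"
proof -
  have k: "kernel x e = return borel x" by (simp add: kernel_def identity_right to_measure_point)
  show ?thesis
  proof (intro set_eqI iffI)
    fix z assume "z \<in> supp x e"
    show "z \<in> {x}"
    proof (rule ccontr)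
      assume "z \<notin> {x}"
      then have "open (- {x})" "z \<in> - {x}" by auto
      with \<open>z \<in> supp x e\<close> have "0 < emeasure (kernel x e) (- {x})" unfolding mem_supp_iff by blast
      then show False by (simp add: k)
    qed
  qed (auto simp: mem_supp_iff k)
qed

lemma point_measure_regular: "point_measure (x :: 'a) \<in> regular_measures"
  by (rule positive_measures_regular[OF point_measure_positive])

lemma integral_conv_left:
  fixes h :: "'a \<Rightarrow> real"
  assumes "continuous_on UNIV h" "bounded (range h)"
    and "\<mu> \<in> positive_measures" "compact S" "emeasure (to_measure \<mu>) (- S) = 0"
  shows "(LINT z|to_measure (conv \<mu> (point_measure u)). h z) = (LINT x|to_measure \<mu>. (LINT z|kernel x u. h z))"
  unfolding kernel_def
proof (rule integral_weakly_continuous_linear_map[OF _ _ _ assms])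
  have "continuous_map weak_topology (prod_topology weak_topology weak_topology) (\<lambda>\<mu>. (\<mu>, point_measure u))"
    by (intro continuous_map_pairedI) (auto simp: topspace_weak_topology point_measure_positive)
  from continuous_map_compose[OF this conv_weakly_continuous]
  show "continuous_map weak_topology weak_topology (\<lambda>\<mu>. conv \<mu> (point_measure u))" by (simp add: comp_def)
qed (simp_all add: conv_linear_left point_measure_regular conv_point_prob)

lemma integral_conv_right:
  fixes h :: "'a \<Rightarrow> real"
  assumes "continuous_on UNIV h" "bounded (range h)"
    and "\<mu> \<in> positive_measures" "compact S" "emeasure (to_measure \<mu>) (- S) = 0"
  shows "(LINT z|to_measure (conv (point_measure u) \<mu>). h z) = (LINT x|to_measure \<mu>. (LINT z|kernel u x. h z))"
  unfolding kernel_def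
proof (rule integral_weakly_continuous_linear_map[OF _ _ _ assms])
  have "continuous_map weak_topology (prod_topology weak_topology weak_topology) (\<lambda>\<mu>. (point_measure u, \<mu>))"
    by (intro continuous_map_pairedI) (auto simp: topspace_weak_topology point_measure_positive)
  from continuous_map_compose[OF this conv_weakly_continuous]
  show "continuous_map weak_topology weak_topology (\<lambda>\<mu>. conv (point_measure u) \<mu>)" by (simp add: comp_def)
qed (simp_all add: conv_linear_right point_measure_regular conv_point_prob)

end


section \<open>Haar measure and the involution\<close>

context hypergroup
begin

lemma emeasure_kernel_invol:
  assumes "E \<in> sets borel"
  shows "emeasure (kernel x y) (invol -` E) = emeasure (kernel (invol y) (invol x)) E"
proof -
  have "invol \<in> borel_measurable borel" using invol_continuous by (rule borel_measurable_continuous_onI)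
  from measurable_sets[OF this assms] have "invol -` E \<in> sets borel" by simp
  then show ?thesis using fun_cong[OF invol_conv, of x y E] assms by (simp add: emeasure_kernel)
qed

lemma supp_invol: "z \<in> supp x y \<Longrightarrow> invol z \<in> supp (invol y) (invol x)"
  unfolding mem_supp_iff
proof (intro allI impI, elim conjE)
  fix U assume z: "\<forall>U. open U \<and> z \<in> U \<longrightarrow> 0 < emeasure (kernel x y) U" and U: "open U" "invol z \<in> U"
  have "open (invol -` U)" using U(1) invol_continuous by (rule open_vimage)
  then have "0 < emeasure (kernel x y) (invol -` U)" using z U(2) by simp
  then show "0 < emeasure (kernel (invol y) (invol x)) U" using U(1) by (simp add: emeasure_kernel_invol)
qed

lemma integral_kernel_pos:
  fixes f :: "'a \<Rightarrow> real"
  assumes f: "continuous_on UNIV f" "bounded (range f)" "\<And>x. 0 \<le> f x" and z: "z \<in> supp x y" "0 < f z"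
  shows "0 < (LINT z|kernel x y. f z)"
proof -
  interpret prob_space "kernel x y" by (rule prob_space_kernel)
  let ?U = "{w. f z / 2 < f w}"
  have U: "open ?U" by (intro open_Collect_less continuous_intros f)
  then have "0 < emeasure (kernel x y) ?U" using z unfolding mem_supp_iff by auto
  then have "0 < measure (kernel x y) ?U" by (simp add: emeasure_eq_measure)
  with z(2) have "0 < f z / 2 * measure (kernel x y) ?U" by simp
  also have "\<dots> = (LINT w|kernel x y. f z / 2 * indicator ?U w)" using U by simp
  also have "\<dots> \<le> (LINT w|kernel x y. f w)"
  proof (rule integral_mono)
    show "integrable (kernel x y) (\<lambda>w. f z / 2 * indicator ?U w)"
      using U by (intro integrable_mult_right integrable_real_indicator) (auto simp: less_top[symmetric])
    show "f z / 2 * indicator ?U w \<le> f w" for w using f(3)[of w] by (auto simp: indicator_def)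
  qed (rule integrable_kernel[OF f(1,2)])
  finally show ?thesis .
qed

lemma continuous_integral_kernel_section:
  fixes f :: "'a \<Rightarrow> real"
  assumes "continuous_on UNIV f" "bounded (range f)"
  shows "continuous_on UNIV (\<lambda>x. LINT z|kernel x u. f z)" "continuous_on UNIV (\<lambda>x. LINT z|kernel u x. f z)"
proof -
  have "continuous_on UNIV (\<lambda>x :: 'a. (x, u))" "continuous_on UNIV (Pair u :: 'a \<Rightarrow> _)"
    by (intro continuous_intros)+
  from continuous_on_compose2[OF continuous_integral_kernel[OF assms] this(1)]
    continuous_on_compose2[OF continuous_integral_kernel[OF assms] this(2)]
  show "continuous_on UNIV (\<lambda>x. LINT z|kernel x u. f z)" "continuous_on UNIV (\<lambda>x. LINT z|kernel u x. f z)"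
    by simp_all
qed

lemma bump_function:
  assumes "open W" "x \<in> W"
  obtains h :: "'a \<Rightarrow> real" where "continuous_on UNIV h" "bounded (range h)"
    "\<And>z. 0 \<le> h z" "h x = 1" "\<And>z. z \<notin> W \<Longrightarrow> h z = 0"
proof (rule Urysohn_compact_open[of "{x}" W])
  fix h :: "'a \<Rightarrow> real"
  assume "continuous_on UNIV h" "bounded (range h)" "\<And>z. 0 \<le> h z" "\<And>z. z \<in> {x} \<Longrightarrow> h z = 1"
    "\<And>z. z \<notin> W \<Longrightarrow> h z = 0"
  then show thesis by (intro that[of h]) auto
qed (use assms in auto)

text \<open>For each \<open>x\<close> a bump function separates \<open>e\<close> from the compact
  set \<open>supp x u\<close>, and upper semicontinuity keeps nearby supports on the far side;
  compactness of \<open>S\<close> makes the neighbourhood of \<open>e\<close> uniform.\<close>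

lemma separated_nhd:
  assumes "compact S" "\<And>x. x \<in> S \<Longrightarrow> e \<notin> supp x u"
  obtains W where "open W" "e \<in> W" "\<And>x. x \<in> S \<Longrightarrow> supp x u \<inter> W = {}"
proof -
  have "\<exists>X W. open X \<and> x \<in> X \<and> open W \<and> e \<in> W \<and> (\<forall>x'\<in>X. supp x' u \<inter> W = {})" if x: "x \<in> S" for x
  proof -
    have "open (- supp x u)" using compact_supp by (simp add: compact_imp_closed open_Compl)
    moreover have "e \<in> - supp x u" using assms(2)[OF x] by simp
    ultimately obtain h :: "'a \<Rightarrow> real" where h: "continuous_on UNIV h" "h e = 1" "\<And>z. z \<notin> - supp x u \<Longrightarrow> h z = 0"
      by (rule bump_function) blast
    let ?O = "{z. h z < 1 / 2}" and ?W = "{z. 1 / 2 < h z}"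
    have o: "open ?O" "open ?W" by (intro open_Collect_less continuous_intros h)+
    have "supp x u \<subseteq> ?O" using h(3) by auto
    from supp_upper_semicontinuous[OF this o(1)] obtain X where
      X: "open X" "x \<in> X" "\<And>x'. x' \<in> X \<Longrightarrow> supp x' u \<subseteq> ?O" by metis
    have "supp x' u \<inter> ?W = {}" if "x' \<in> X" for x' using X(3)[OF that] by auto
    with X o h(2) show ?thesis by (intro exI[of _ X] exI[of _ ?W]) auto
  qed
  then have "\<forall>x\<in>S. \<exists>P. open (fst P) \<and> x \<in> fst P \<and> open (snd P) \<and> e \<in> snd P \<and> (\<forall>x'\<in>fst P. supp x' u \<inter> snd P = {})"
    by fastforce
  from bchoice[OF this] obtain P where P: "\<And>x. x \<in> S \<Longrightarrow> open (fst (P x)) \<and> x \<in> fst (P x) \<and> open (snd (P x)) \<and> e \<in> snd (P x) \<and>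
    (\<forall>x'\<in>fst (P x). supp x' u \<inter> snd (P x) = {})" by blast
  have "S \<subseteq> (\<Union>x\<in>S. fst (P x))" using P by auto
  then obtain F where F: "F \<subseteq> S" "finite F" "S \<subseteq> (\<Union>x\<in>F. fst (P x))"
    using compactE_image[OF assms(1), of S "\<lambda>x. fst (P x)"] P by metis
  show thesis
  proof
    show "open (\<Inter>x\<in>F. snd (P x))" using F P by (intro open_INT) auto
    show "e \<in> (\<Inter>x\<in>F. snd (P x))" using F P by auto
    fix x' assume "x' \<in> S"
    then obtain x where "x \<in> F" "x' \<in> fst (P x)" using F(3) by auto
    then show "supp x' u \<inter> (\<Inter>x\<in>F. snd (P x)) = {}" using P[of x] F(1) by blast
  qed
qed

text \<open>
  If \<open>u\<close> were not in the support, then the triple convolution of \<open>invol w\<close>, \<open>v\<close>, \<open>u\<close>,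
  bracketed to the left, would vanish near \<open>e\<close>; bracketed to the right, it does not.
\<close>

lemma supp_rotate:
  assumes w: "w \<in> supp v u"
  shows "u \<in> supp (invol v) w"
proof (rule ccontr)
  assume "u \<notin> supp (invol v) w"
  \<comment> \<open>The involution reverses the factors and brings the assumption into a form to
    which the axiom on \<open>e\<close> applies.\<close>
  then have nu: "invol u \<notin> supp (invol w) v"
    using supp_invol[of "invol u" "invol w" v] by (auto simp: invol_invol)
  have "e \<notin> supp x u" if "x \<in> supp (invol w) v" for x
    using that nu by (auto simp: supp_def identity_in_support_iff)
  from separated_nhd[OF compact_supp this] obtain W where W: "open W" "e \<in> W"
    "\<And>x. x \<in> supp (invol w) v \<Longrightarrow> supp x u \<inter> W = {}" by blast
  obtain h :: "'a \<Rightarrow> real" where h: "continuous_on UNIV h" "bounded (range h)" "\<And>x. 0 \<le> h x" "h e = 1" "\<And>x. x \<notin> W \<Longrightarrow> h x = 0"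
    by (rule bump_function[OF W(1,2)]) blast
  let ?\<mu> = "\<lambda>x y. conv (point_measure x) (point_measure y)"
  note conv = conv_point_positive compact_supp kernel_null_compl_supp[unfolded kernel_def]
  have "(LINT z|to_measure (conv (?\<mu> (invol w) v) (point_measure u)). h z) = (LINT x|kernel (invol w) v. (LINT z|kernel x u. h z))"
    using integral_conv_left[OF h(1,2) conv, of "invol w" v u] by (simp add: kernel_def)
  also have "\<dots> = (LINT x|kernel (invol w) v. 0)"
  proof (rule integral_cong_AE)
    have "(\<lambda>x. LINT z|kernel x u. h z) \<in> borel_measurable borel"
      by (intro borel_measurable_continuous_onI continuous_integral_kernel_section h)
    then show "(\<lambda>x. LINT z|kernel x u. h z) \<in> borel_measurable (kernel (invol w) v)" by simp
    have "AE x in kernel (invol w) v. x \<in> supp (invol w) v"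
      using kernel_null_compl_supp[of "invol w" v] compact_supp[of "invol w" v]
      by (intro AE_I[of _ _ "- supp (invol w) v"]) (auto simp: compact_imp_closed)
    then show "AE x in kernel (invol w) v. (LINT z|kernel x u. h z) = 0"
    proof eventually_elim
      case (elim x)
      have "W \<inter> supp x u = {}" using W(3)[OF elim] by auto
      then have "AE z in kernel x u. h z = 0"
        using kernel_null[OF W(1), of x u] h(5) W(1) by (intro AE_I[of _ _ W]) auto
      then show ?case by (rule integral_eq_zero_AE)
    qed
  qed simp
  finally have 0: "(LINT z|to_measure (conv (?\<mu> (invol w) v) (point_measure u)). h z) = 0" by simp
  let ?g = "\<lambda>y. LINT z|kernel (invol w) y. h z"
  \<comment> \<open>Bracketed to the right: \<open>w\<close> lies in the support of
    \<open>kernel v u\<close>, and \<open>?g w\<close> is positive because \<open>e\<close> lies in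
    \<open>supp (invol w) w\<close>.\<close>
  have "0 < (LINT y|kernel v u. ?g y)"
  proof (rule integral_kernel_pos[OF _ _ _ w])
    show "continuous_on UNIV ?g"
      by (intro continuous_integral_kernel_section h)
    obtain B where B: "\<And>x. \<bar>h x\<bar> \<le> B" using h(2) by (auto simp: bounded_iff)
    have "\<bar>?g y\<bar> \<le> B" for y
    proof -
      interpret prob_space "kernel (invol w) y" by (rule prob_space_kernel)
      have "\<bar>?g y\<bar> \<le> (LINT z|kernel (invol w) y. B)"
        by (rule order_trans[OF integral_abs_bound], rule integral_mono) (use B integrable_kernel[OF h(1,2)] in auto)
      then show ?thesis using prob_space by simp
    qed
    then show "bounded (range ?g)" by (auto simp: bounded_iff)
    show "0 \<le> ?g y" for y using h(3) by (intro Bochner_Integration.integral_nonneg) auto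
    have "e \<in> supp (invol w) w" by (simp add: supp_def identity_in_support_iff)
    then show "0 < ?g w" using h by (intro integral_kernel_pos[of h e]) auto
  qed
  also have "(LINT y|kernel v u. ?g y) = (LINT z|to_measure (conv (point_measure (invol w)) (?\<mu> v u)). h z)"
    using integral_conv_right[OF h(1,2) conv, of "invol w" v u] by (simp add: kernel_def)
  also have "\<dots> = 0"
    using 0 by (simp add: conv_assoc point_measure_regular)
  finally show False by simp
qed

text \<open>By rotation, a point \<open>w\<close> of \<open>supp v u\<close> near \<open>e\<close>
  gives \<open>u \<in> supp (invol v) w\<close>, and this support is close to
  \<open>supp (invol v) e = {invol v}\<close>, hence inside \<open>U\<close>. Compactness makes the
  choice uniform in \<open>v\<close>.\<close>

lemma kernel_null_nhd:
  assumes C: "compact C" and U: "open U" "invol ` C \<subseteq> U"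
  obtains W where "open W" "e \<in> W" "\<And>v u. v \<in> C \<Longrightarrow> u \<notin> U \<Longrightarrow> supp v u \<inter> W = {}"
proof -
  have iC: "compact (invol ` C)"
    using C by (intro compact_continuous_image continuous_on_subset[OF invol_continuous]) auto
  have "\<exists>P. open (fst P) \<and> x \<in> fst P \<and> open (snd P) \<and> e \<in> snd P \<and> (\<forall>x'\<in>fst P. \<forall>w\<in>snd P. supp x' w \<subseteq> U)"
    if "x \<in> invol ` C" for x
  proof -
    have "supp x e \<subseteq> U" using that U(2) by (simp add: supp_identity subsetD)
    from supp_upper_semicontinuous[OF this U(1)] obtain X Y where
      "open X" "x \<in> X" "open Y" "e \<in> Y" "\<And>x' y'. x' \<in> X \<Longrightarrow> y' \<in> Y \<Longrightarrow> supp x' y' \<subseteq> U" by metis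
    then show ?thesis by (intro exI[of _ "(X, Y)"]) auto
  qed
  then have "\<forall>x\<in>invol ` C. \<exists>P. open (fst P) \<and> x \<in> fst P \<and> open (snd P) \<and> e \<in> snd P \<and> (\<forall>x'\<in>fst P. \<forall>w\<in>snd P. supp x' w \<subseteq> U)"
    by blast
  from bchoice[OF this] obtain P where P: "\<And>x. x \<in> invol ` C \<Longrightarrow> open (fst (P x)) \<and> x \<in> fst (P x) \<and> open (snd (P x)) \<and> e \<in> snd (P x) \<and>
    (\<forall>x'\<in>fst (P x). \<forall>w\<in>snd (P x). supp x' w \<subseteq> U)" by blast
  have "invol ` C \<subseteq> (\<Union>x\<in>invol ` C. fst (P x))" using P by blast
  then obtain F where F: "F \<subseteq> invol ` C" "finite F" "invol ` C \<subseteq> (\<Union>x\<in>F. fst (P x))"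
    using compactE_image[OF iC, of "invol ` C" "\<lambda>x. fst (P x)"] P by metis
  show thesis
  proof
    show "open (\<Inter>x\<in>F. snd (P x))" using F P by (intro open_INT) auto
    show "e \<in> (\<Inter>x\<in>F. snd (P x))" using F P by auto
    fix v u assume v: "v \<in> C" and u: "u \<notin> U"
    then obtain x where x: "x \<in> F" "invol v \<in> fst (P x)" using F(3) by auto
    show "supp v u \<inter> (\<Inter>x\<in>F. snd (P x)) = {}"
    proof (rule ccontr)
      assume "supp v u \<inter> (\<Inter>x\<in>F. snd (P x)) \<noteq> {}"
      then obtain w where "w \<in> supp v u" "w \<in> snd (P x)" using x(1) by auto
      with supp_rotate[of w v u] P[of x] x F(1) have "u \<in> U" by blast
      with u show False by simp
    qed
  qed
qed

end

section \<open>Invariance of the Haar measure under the involution\<close>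

context commutative_hypergroup
begin

lemma kernel_commute: "kernel x y = kernel y x"
  by (simp add: kernel_def conv_point_commute)

context
  fixes M :: "'a measure"
  assumes haar: "haar_measure conv M" and sigma_finite: "sigma_finite_measure M"
begin

lemma haar_radon: "radon_measure M"
  using haar by (simp add: haar_measure_def)

lemma haar_inner_regular: "compact_inner_regular M"
  by (rule radon_measure_compact_inner_regular[OF haar_radon sigma_finite])

lemma sets_haar [measurable_cong]: "sets M = sets borel" and space_haar: "space M = UNIV"
  using compact_inner_regularD(1,2)[OF haar_inner_regular] by auto

lemma haar_invariant:
  "f \<in> borel_measurable borel \<Longrightarrow> (\<integral>\<^sup>+y. \<integral>\<^sup>+z. f z \<partial>kernel x y \<partial>M) = (\<integral>\<^sup>+y. f y \<partial>M)"
  using haar by (simp add: haar_measure_def translation_eq)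

lemma haar_invariant_emeasure:
  "E \<in> sets borel \<Longrightarrow> (\<integral>\<^sup>+y. emeasure (kernel x y) E \<partial>M) = emeasure M E"
  using haar_invariant[of "indicator E" x] by (simp add: sets_haar)

lemma emeasure_kernel_measurable:
  "E \<in> sets borel \<Longrightarrow> (\<lambda>p. emeasure (kernel (fst p) (snd p)) E) \<in> borel_measurable borel"
  by (rule measurable_compose[OF measurable_kernel measurable_emeasure_subprob_algebra])

text \<open>If \<open>W\<close> were null, invariance would make the open set of all
  \<open>y\<close> for which \<open>kernel (invol z) y\<close> charges \<open>W\<close> null. It
  contains \<open>z\<close>, so every point would have a null neighbourhood and the whole measure
  would vanish.\<close>

lemma haar_nhd_identity_pos:
  assumes W: "open W" "e \<in> W"
  shows "0 < emeasure M W"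
proof (rule ccontr)
  assume "\<not> 0 < emeasure M W"
  then have W0: "emeasure M W = 0" by (simp add: zero_less_iff_neq_zero)
  have "emeasure M UNIV = 0"
  proof (rule locally_null_imp_null[OF haar_inner_regular open_UNIV])
    fix z
    let ?V = "{y. 0 < emeasure (kernel (invol z) y) W}"
    have V: "open ?V"
      using open_vimage[OF open_kernel_greater[OF W(1), of 0], of "Pair (invol z)"]
      by (simp add: vimage_def continuous_on_Pair)
    have m: "(\<lambda>y. emeasure (kernel (invol z) y) W) \<in> borel_measurable M"
      using borel_measurable_section(2)[OF emeasure_kernel_measurable, of W "invol z"] W(1) by (simp add: sets_haar)
    have "(\<integral>\<^sup>+y. emeasure (kernel (invol z) y) W \<partial>M) = 0"
      using haar_invariant_emeasure[of W "invol z"] W(1) W0 by simp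
    then have "AE y in M. emeasure (kernel (invol z) y) W = 0"
      using m by (simp add: nn_integral_0_iff_AE)
    then have "AE y in M. y \<notin> ?V" by eventually_elim simp
    then have "emeasure M ?V = 0"
      using V AE_iff_null_sets[of ?V M] by (auto simp: sets_haar)
    moreover have "e \<in> supp (invol z) z" by (simp add: supp_def identity_in_support_iff)
    then have "z \<in> ?V" using W by (auto simp: mem_supp_iff)
    ultimately show "\<exists>V. open V \<and> z \<in> V \<and> emeasure M V = 0" using V by blast
  qed
  then show False using haar by (simp add: haar_measure_def)
qed

lemma haar_le_invol:
  assumes C: "compact C" and U: "open U" "invol ` C \<subseteq> U"
  shows "emeasure M C \<le> emeasure M U"
proof -
  obtain W1 where W1: "open W1" "e \<in> W1" "\<And>v u. v \<in> C \<Longrightarrow> u \<notin> U \<Longrightarrow> supp v u \<inter> W1 = {}"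
    by (rule kernel_null_nhd[OF C U]) blast
  \<comment> \<open>A compact neighbourhood makes the measure of \<open>W\<close> finite; being also
    positive, it can be cancelled at the end.\<close>
  obtain W2 D where W2: "open W2" "e \<in> W2" "W2 \<subseteq> D" "compact D"
    using locally_compact unfolding locally_compact_space_def by (simp del: ex_simps) blast
  define W where "W = W1 \<inter> W2"
  have W: "open W" "e \<in> W" using W1 W2 by (auto simp: W_def)
  have Wb: "W \<in> sets borel" using W by simp
  have Wpos: "emeasure M W \<noteq> 0" using haar_nhd_identity_pos[OF W] by simp
  have "emeasure M W \<le> emeasure M D"
    using W2 by (intro emeasure_mono) (auto simp: W_def sets_haar compact_borel)
  also have "\<dots> < \<infinity>"
    using haar_radon[unfolded radon_measure_def, THEN conjunct2, THEN conjunct1] W2(4) compact_borel by blast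
  finally have Wfin: "emeasure M W \<noteq> top" by simp
  have null: "emeasure (kernel v u) W = 0" if "v \<in> C" "u \<notin> U" for v u
    using W1(3)[OF that] by (intro kernel_null W) (auto simp: W_def)
  \<comment> \<open>Cutting off at \<open>U\<close> costs nothing for \<open>v \<in> C\<close>, by
    \<open>null\<close>, and makes the other order of integration produce the measure of
    \<open>U\<close>.\<close>
  define F where "F p = emeasure (kernel (fst p) (snd p)) W * indicator U (snd p)" for p
  have "(\<lambda>p :: 'a \<times> 'a. indicator U (snd p) :: ennreal) \<in> borel_measurable borel"
    using U(1) by (intro measurable_compose[OF _ borel_measurable_indicator])
      (auto intro!: borel_measurable_continuous_onI continuous_intros)
  then have F: "F \<in> borel_measurable borel"
    unfolding F_def using emeasure_kernel_measurable[OF Wb] by (rule borel_measurable_times_ennreal[rotated])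
  have Cb: "C \<in> sets M" using C by (simp add: sets_haar compact_borel)
  have "emeasure M W * emeasure M C = (\<integral>\<^sup>+v. emeasure M W * indicator C v \<partial>M)"
    using Cb by (simp add: nn_integral_cmult)
  also have "\<dots> \<le> (\<integral>\<^sup>+v. \<integral>\<^sup>+u. F (v, u) \<partial>M \<partial>M)"
  proof (rule nn_integral_mono)
    fix v
    show "emeasure M W * indicator C v \<le> (\<integral>\<^sup>+u. F (v, u) \<partial>M)"
    proof (cases "v \<in> C")
      case True
      have "emeasure M W = (\<integral>\<^sup>+u. emeasure (kernel v u) W \<partial>M)"
        by (rule haar_invariant_emeasure[OF Wb, symmetric])
      also have "\<dots> = (\<integral>\<^sup>+u. F (v, u) \<partial>M)"
        using null[OF True] by (intro nn_integral_cong) (auto simp: F_def indicator_def)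
      finally show ?thesis using True by simp
    qed simp
  qed
  also have "\<dots> = (\<integral>\<^sup>+u. \<integral>\<^sup>+v. F (v, u) \<partial>M \<partial>M)"
    using sections_swap[OF haar_inner_regular haar_inner_regular sigma_finite sigma_finite F]
    by (simp add: sections_swap_def)
  \<comment> \<open>Commutativity moves the integration variable \<open>v\<close> to the second
    argument, where invariance is stated.\<close>
  also have "\<dots> = (\<integral>\<^sup>+u. emeasure M W * indicator U u \<partial>M)"
  proof (rule nn_integral_cong)
    fix u
    have "(\<integral>\<^sup>+v. F (v, u) \<partial>M) = (\<integral>\<^sup>+v. emeasure (kernel u v) W * indicator U u \<partial>M)"
      by (simp add: F_def kernel_commute[of u])
    also have "\<dots> = (\<integral>\<^sup>+v. emeasure (kernel u v) W \<partial>M) * indicator U u"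
      using borel_measurable_section(2)[OF emeasure_kernel_measurable[OF Wb], of u]
      by (intro nn_integral_multc) (simp add: sets_haar)
    finally show "(\<integral>\<^sup>+v. F (v, u) \<partial>M) = emeasure M W * indicator U u"
      by (simp add: haar_invariant_emeasure[OF Wb])
  qed
  also have "\<dots> = emeasure M W * emeasure M U"
    using U(1) by (intro nn_integral_cmult_indicator) (simp add: sets_haar)
  finally show ?thesis using Wpos Wfin by (simp add: ennreal_mult_le_mult_iff)
qed

text \<open>Outer regularity shrinks \<open>U\<close> to the image of \<open>C\<close>. The
  resulting inequality applied to the image gives the converse, as the involution is its own
  inverse.\<close>

lemma haar_compact_invol:
  assumes C: "compact C"
  shows "emeasure M (invol ` C) = emeasure M C"
proof -
  have le: "emeasure M D \<le> emeasure M (invol ` D)" if D: "compact D" for D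
  proof -
    have "compact (invol ` D)"
      using D by (intro compact_continuous_image continuous_on_subset[OF invol_continuous]) auto
    then have "emeasure M (invol ` D) = (INF U\<in>{U. open U \<and> invol ` D \<subseteq> U}. emeasure M U)"
      using haar_radon[unfolded radon_measure_def, THEN conjunct2, THEN conjunct2, THEN conjunct1, THEN bspec] compact_borel by blast
    moreover have "emeasure M D \<le> (INF U\<in>{U. open U \<and> invol ` D \<subseteq> U}. emeasure M U)"
      by (rule INF_greatest) (use haar_le_invol[OF D] in auto)
    ultimately show ?thesis by simp
  qed
  have "invol ` invol ` C = C" by (auto simp: image_image invol_invol)
  moreover have "compact (invol ` C)"
    using C by (intro compact_continuous_image continuous_on_subset[OF invol_continuous]) auto
  ultimately show ?thesis using le[OF C] le[of "invol ` C"] by simp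
qed

lemma distr_invol: "distr M borel invol = M"
proof (rule measure_eqI)
  have m: "invol \<in> M \<rightarrow>\<^sub>M borel"
    using borel_measurable_continuous_onI[OF invol_continuous] by (simp add: sets_haar)
  have le: "emeasure M (invol -` E) \<le> emeasure M E" if E: "E \<in> sets borel" for E
  proof -
    have "invol -` E \<in> sets borel"
      using measurable_sets[OF borel_measurable_continuous_onI[OF invol_continuous] E] by simp
    then have "emeasure M (invol -` E) = (SUP C\<in>{C. compact C \<and> C \<subseteq> invol -` E}. emeasure M C)"
      by (rule compact_inner_regularD(3)[OF haar_inner_regular])
    also have "\<dots> \<le> emeasure M E"
    proof (rule SUP_least, safe)
      fix C assume C: "compact C" "C \<subseteq> invol -` E"
      have "emeasure M C = emeasure M (invol ` C)" by (simp add: haar_compact_invol[OF C(1)])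
      also have "\<dots> \<le> emeasure M E" using C E by (intro emeasure_mono) (auto simp: sets_haar)
      finally show "emeasure M C \<le> emeasure M E" .
    qed
    finally show ?thesis .
  qed
  fix E assume "E \<in> sets (distr M borel invol)"
  then have E: "E \<in> sets borel" by simp
  have iE: "invol -` E \<in> sets borel"
    using measurable_sets[OF borel_measurable_continuous_onI[OF invol_continuous] E] by simp
  have "invol -` invol -` E = E" by (auto simp: invol_invol)
  then have "emeasure M (invol -` E) = emeasure M E" using le[OF E] le[OF iE] by simp
  then show "emeasure (distr M borel invol) E = emeasure M E"
    using m E by (simp add: emeasure_distr space_haar)
qed (simp add: sets_haar)

lemma nn_integral_invol:
  assumes "f \<in> borel_measurable borel"
  shows "(\<integral>\<^sup>+y. f (invol y) \<partial>M) = (\<integral>\<^sup>+y. f y \<partial>M)"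
proof -
  have "invol \<in> M \<rightarrow>\<^sub>M borel"
    using borel_measurable_continuous_onI[OF invol_continuous] by (simp add: sets_haar)
  then have "(\<integral>\<^sup>+y. f y \<partial>distr M borel invol) = (\<integral>\<^sup>+y. f (invol y) \<partial>M)"
    using assms by (intro nn_integral_distr) auto
  then show ?thesis by (simp add: distr_invol)
qed

end

end

section \<open>Splitting the fractional integral\<close>

text \<open>As \<open>G\<close> increases, its weighted tail dominates \<open>G t\<close> times the
  tail of the weight. This later absorbs the contribution of the low layers.\<close>

lemma nn_integral_tail_ge:
  assumes G: "mono G" and a: "0 < a" "a < 1" and t: "0 < t"
  shows "G t * ennreal (t powr (a - 1) / (1 - a)) \<le> (\<integral>\<^sup>+u\<in>{t<..}. ennreal (u powr (a - 2)) * G u \<partial>lborel)"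
proof -
  have "G t * ennreal (t powr (a - 1) / (1 - a)) = G t * (\<integral>\<^sup>+u\<in>{t<..}. ennreal (u powr (a - 2)) \<partial>lborel)"
    using nn_integral_powr_tail[of "1 - a" t] a t by simp
  also have "\<dots> = (\<integral>\<^sup>+u. G t * (ennreal (u powr (a - 2)) * indicator {t<..} u) \<partial>lborel)"
    by (rule nn_integral_cmult[symmetric]) measurable
  also have "\<dots> \<le> (\<integral>\<^sup>+u\<in>{t<..}. ennreal (u powr (a - 2)) * G u \<partial>lborel)"
    using G by (intro nn_integral_mono) (auto simp: indicator_def mult.commute intro!: mult_right_mono monoD[OF G])
  finally show ?thesis .
qed

lemma ennreal_le_diff_add: "x \<le> (x - c) + (c :: ennreal)"
  by (cases "c \<le> x") (auto simp: diff_add_cancel_ennreal intro: add_increasing)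

text \<open>Minus the derivative of \<open>u powr (a - 1)\<close>, so that for \<open>v > 0\<close>
  the densities above \<open>v\<close> add up to \<open>v powr (a - 1)\<close>.\<close>

definition layer_density :: "real \<Rightarrow> real \<Rightarrow> ennreal"
  where "layer_density a u = ennreal ((1 - a) * u powr (a - 2))"

text \<open>All of \<open>{0<..}\<close> gives \<open>V powr (a - 1)\<close> where \<open>V\<close>
  is positive; the set \<open>I\<close> selects the sublevel sets that take part.\<close>

definition layers :: "('a \<Rightarrow> real) \<Rightarrow> real \<Rightarrow> real set \<Rightarrow> 'a \<Rightarrow> ennreal"
  where "layers V a I z = (\<integral>\<^sup>+u\<in>I. layer_density a u * indicator {u. V z < u} u \<partial>lborel)"

lemma measurable_layer_density [measurable]: "layer_density a \<in> borel_measurable borel"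
  unfolding layer_density_def by measurable

lemma layers_eq_powr:
  assumes a: "0 < a" "a < 1"
  shows "0 < V z \<Longrightarrow> layers V a {0<..} z = ennreal (V z powr (a - 1))"
    and "V z \<le> 0 \<Longrightarrow> layers V a {0<..} z = \<infinity>"
proof -
  have tail: "(\<integral>\<^sup>+u\<in>{t<..}. layer_density a u \<partial>lborel) = ennreal (t powr (a - 1))" if t: "0 < t" for t
  proof -
    have "(\<integral>\<^sup>+u\<in>{t<..}. layer_density a u \<partial>lborel) =
      (\<integral>\<^sup>+u. ennreal (1 - a) * (ennreal (u powr (- (1 - a) - 1)) * indicator {t<..} u) \<partial>lborel)"
      using a by (intro nn_integral_cong) (simp add: layer_density_def ennreal_mult mult.assoc)
    also have "\<dots> = ennreal (1 - a) * ennreal (t powr (- (1 - a)) / (1 - a))"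
      using a t by (subst nn_integral_cmult, measurable, subst nn_integral_powr_tail) auto
    also have "\<dots> = ennreal (t powr (a - 1))"
      using a by (simp flip: ennreal_mult)
    finally show ?thesis .
  qed
  show "layers V a {0<..} z = ennreal (V z powr (a - 1))" if "0 < V z"
  proof -
    have "layers V a {0<..} z = (\<integral>\<^sup>+u\<in>{V z<..}. layer_density a u \<partial>lborel)"
      unfolding layers_def using that by (intro nn_integral_cong) (auto simp: indicator_def)
    then show ?thesis by (simp add: tail that)
  qed
  show "layers V a {0<..} z = \<infinity>" if "V z \<le> 0"
  proof -
    have "of_nat n \<le> layers V a {0<..} z" for n
    proof (cases "n = 0")
      case False
      \<comment> \<open>Chosen so that the tail of the density beyond \<open>t\<close> is exactly
        \<open>n\<close>; the integral thus exceeds every natural number.\<close>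
      define t where "t = real n powr (1 / (a - 1))"
      have t: "0 < t" using False by (simp add: t_def)
      have "of_nat n = ennreal (t powr (a - 1))"
        using a False by (simp add: t_def powr_powr ennreal_of_nat_eq_real_of_nat)
      also have "\<dots> = (\<integral>\<^sup>+u\<in>{t<..}. layer_density a u \<partial>lborel)" by (simp add: tail t)
      also have "\<dots> \<le> layers V a {0<..} z"
        unfolding layers_def using t that by (intro nn_integral_mono) (auto simp: indicator_def)
      finally show ?thesis .
    qed simp
    then have "(SUP n. of_nat n) \<le> layers V a {0<..} z" by (intro SUP_least)
    then show ?thesis by (simp add: ennreal_SUP_of_nat_eq_top top.extremum_unique)
  qed
qed

lemma measurable_layers:
  assumes [measurable]: "V \<in> borel_measurable N" "I \<in> sets borel"
  shows "layers V a I \<in> borel_measurable N"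
proof -
  have "(\<lambda>z. \<integral>\<^sup>+u. layer_density a u * (if V z < u then 1 else 0) * indicator I u \<partial>lborel) \<in> borel_measurable N"
    by measurable
  then show ?thesis by (simp add: layers_def[abs_def] indicator_def[of "{u. _ < u}"] cong: if_cong)
qed

lemma nn_integral_layers:
  assumes N: "sigma_finite_measure N" and V[measurable]: "V \<in> borel_measurable N" and I[measurable]: "I \<in> sets borel"
  shows "(\<integral>\<^sup>+z. layers V a I z \<partial>N) = (\<integral>\<^sup>+u\<in>I. layer_density a u * emeasure N {z\<in>space N. V z < u} \<partial>lborel)"
proof -
  interpret sigma_finite_measure N by fact
  interpret P: pair_sigma_finite N lborel ..
  have "(\<integral>\<^sup>+z. layers V a I z \<partial>N) = (\<integral>\<^sup>+u. \<integral>\<^sup>+z. layer_density a u * (if V z < u then 1 else 0) * indicator I u \<partial>N \<partial>lborel)"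
    unfolding layers_def indicator_def[of "{u. _ < u}"] mem_Collect_eq
    by (subst P.Fubini') (measurable, simp add: of_bool_def)
  also have "\<dots> = (\<integral>\<^sup>+u\<in>I. layer_density a u * emeasure N {z\<in>space N. V z < u} \<partial>lborel)"
  proof (rule nn_integral_cong)
    fix u
    have "(\<integral>\<^sup>+z. layer_density a u * (if V z < u then 1 else 0) * indicator I u \<partial>N) =
      (\<integral>\<^sup>+z. (layer_density a u * indicator I u) * indicator {z\<in>space N. V z < u} z \<partial>N)"
      by (intro nn_integral_cong) (auto simp: indicator_def)
    also have "\<dots> = (layer_density a u * indicator I u) * emeasure N {z\<in>space N. V z < u}"
      by (rule nn_integral_cmult_indicator) measurable
    finally show "(\<integral>\<^sup>+z. layer_density a u * (if V z < u then 1 else 0) * indicator I u \<partial>N) =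
      layer_density a u * emeasure N {z\<in>space N. V z < u} * indicator I u" by (simp add: mult_ac)
  qed
  finally show ?thesis .
qed

context commutative_hypergroup
begin

lemma measurable_kernel_nn_integral:
  "g \<in> borel_measurable borel \<Longrightarrow> (\<lambda>p. \<integral>\<^sup>+z. g z \<partial>kernel (fst p) (snd p)) \<in> borel_measurable borel"
  by (rule measurable_compose[OF measurable_kernel nn_integral_measurable_subprob_algebra])

context
  fixes M :: "'a measure" and V :: "'a \<Rightarrow> real" and a :: real
  assumes haar: "haar_measure conv M" and sigma_finite: "sigma_finite_measure M"
    and V: "V \<in> borel_measurable borel" and level: "\<And>u. 0 < u \<Longrightarrow> emeasure M {z. V z < u} = ennreal u"
    and a: "0 < a" "a < 1"
begin

lemmas sets_M = sets_haar[OF haar sigma_finite]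
lemmas space_M = space_haar[OF haar sigma_finite]
lemmas invariant = haar_invariant[OF haar sigma_finite]

lemma measurable_invol [measurable]: "invol \<in> borel \<rightarrow>\<^sub>M borel"
  by (rule borel_measurable_continuous_onI[OF invol_continuous])

lemma measurable_M: "g \<in> borel_measurable borel \<Longrightarrow> g \<in> borel_measurable M"
  using measurable_cong_sets[OF sets_M refl] by blast

lemma nn_integral_layers_M:
  assumes I: "I \<in> sets borel" "I \<subseteq> {0<..}"
  shows "(\<integral>\<^sup>+z. layers V a I z \<partial>M) = (\<integral>\<^sup>+u\<in>I. ennreal ((1 - a) * u powr (a - 1)) \<partial>lborel)"
proof -
  have "(\<integral>\<^sup>+z. layers V a I z \<partial>M) = (\<integral>\<^sup>+u\<in>I. layer_density a u * emeasure M {z\<in>space M. V z < u} \<partial>lborel)"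
    using V I(1) by (intro nn_integral_layers[OF sigma_finite]) (auto simp: sets_M cong: measurable_cong_sets)
  also have "\<dots> = (\<integral>\<^sup>+u\<in>I. ennreal ((1 - a) * u powr (a - 1)) \<partial>lborel)"
  proof (rule nn_integral_cong)
    fix u :: real
    have "layer_density a u * ennreal u = ennreal ((1 - a) * u powr (a - 1))" if "0 < u"
    proof -
      have "u powr (a - 2) * u = u powr (a - 1)" using that by (simp add: powr_mult_base mult.commute)
      then show ?thesis using that a by (simp add: layer_density_def mult.assoc flip: ennreal_mult)
    qed
    then show "layer_density a u * emeasure M {z\<in>space M. V z < u} * indicator I u =
      ennreal ((1 - a) * u powr (a - 1)) * indicator I u"
      using I(2) by (auto simp: indicator_def level space_M)
  qed
  finally show ?thesis .
qed

lemma nn_integral_kernel_layers: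
  assumes I: "I \<in> sets borel"
  shows "(\<integral>\<^sup>+z. layers V a I z \<partial>kernel x y) = (\<integral>\<^sup>+u\<in>I. layer_density a u * emeasure (kernel x y) {z. V z < u} \<partial>lborel)"
proof -
  interpret prob_space "kernel x y" by (rule prob_space_kernel)
  have "sigma_finite_measure (kernel x y)" ..
  moreover have "V \<in> borel_measurable (kernel x y)" using V by (simp cong: measurable_cong_sets)
  ultimately show ?thesis using nn_integral_layers[of "kernel x y" V I] I by simp
qed

text \<open>
  The function \<open>y \<mapsto> kernel x y {V < u}\<close> takes values in \<open>[0, 1]\<close> and has integral \<open>u\<close>,
  as the indicator of a set of measure \<open>u\<close>.
\<close>

lemma nn_integral_sublevel_le:
  assumes F: "F \<in> borel_measurable (completion M)" and \<phi>: "\<phi> \<in> borel_measurable borel"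
    and AE: "AE y in M. ennreal (cmod (F y)) = \<phi> y" and u: "0 < u"
  shows "(\<integral>\<^sup>+y. emeasure (kernel x y) {z. V z < u} * \<phi> (invol y) \<partial>M) \<le> rearrangement_integral M F u"
proof (cases "rearrangement_integral M F u = \<infinity>")
  case False
  note [measurable] = \<phi> V
  have lev[measurable]: "{z. V z < u} \<in> sets borel" using V by measurable
  have "\<phi> \<in> borel_measurable M" using \<phi> by (rule measurable_M)
  then obtain c where
    c: "0 \<le> c" "rearrangement_integral M F u = (\<integral>\<^sup>+y. (\<phi> y - ennreal c) \<partial>M) + ennreal (u * c)"
    by (rule rearrangement_integral_split[OF sigma_finite F _ AE u False])
  have [measurable]: "(\<lambda>y. emeasure (kernel x y) {z. V z < u}) \<in> borel_measurable borel"
    using borel_measurable_section(2)[OF emeasure_kernel_measurable[OF haar sigma_finite lev], of x] by simp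
  have "(\<integral>\<^sup>+y. emeasure (kernel x y) {z. V z < u} * \<phi> (invol y) \<partial>M) \<le>
    (\<integral>\<^sup>+y. (\<phi> (invol y) - ennreal c) + emeasure (kernel x y) {z. V z < u} * ennreal c \<partial>M)"
  proof (rule nn_integral_mono)
    fix y
    interpret prob_space "kernel x y" by (rule prob_space_kernel)
    let ?m = "emeasure (kernel x y) {z. V z < u}"
    \<comment> \<open>Above the cut \<open>c\<close> the kernel mass is estimated by 1; below the
      cut it is kept, because its integral over \<open>y\<close> is \<open>u\<close>.\<close>
    have "?m * \<phi> (invol y) \<le> ?m * ((\<phi> (invol y) - ennreal c) + ennreal c)"
      by (intro mult_left_mono ennreal_le_diff_add) simp
    also have "\<dots> = ?m * (\<phi> (invol y) - ennreal c) + ?m * ennreal c" by (rule distrib_left)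
    also have "?m * (\<phi> (invol y) - ennreal c) \<le> 1 * (\<phi> (invol y) - ennreal c)"
      by (intro mult_right_mono emeasure_le_1) simp
    finally show "?m * \<phi> (invol y) \<le> (\<phi> (invol y) - ennreal c) + ?m * ennreal c" by (simp add: add_right_mono)
  qed
  also have "\<dots> = (\<integral>\<^sup>+y. (\<phi> (invol y) - ennreal c) \<partial>M) + (\<integral>\<^sup>+y. emeasure (kernel x y) {z. V z < u} \<partial>M) * ennreal c"
    by (subst nn_integral_add; (subst nn_integral_multc)?; (rule measurable_M)?) measurable
  \<comment> \<open>Invariance under the involution enters here: the excess has to be that of
    \<open>f\<close>, not of its reflection.\<close>
  also have "(\<integral>\<^sup>+y. (\<phi> (invol y) - ennreal c) \<partial>M) = (\<integral>\<^sup>+y. (\<phi> y - ennreal c) \<partial>M)"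
    by (rule nn_integral_invol[OF haar sigma_finite, of "\<lambda>y. \<phi> y - ennreal c"]) measurable
  also have "(\<integral>\<^sup>+y. emeasure (kernel x y) {z. V z < u} \<partial>M) = ennreal u"
    using haar_invariant_emeasure[OF haar sigma_finite lev] level[OF u] by simp
  finally show ?thesis using c u by (simp add: ennreal_mult)
qed simp

text \<open>The estimate for one sublevel set is integrated over \<open>u\<close>. For fixed
  \<open>x\<close> the kernel mass of \<open>{z. V z < u}\<close> is measurable in
  \<open>(y, u)\<close> for the product \<sigma>-algebra, so the ordinary Fubini theorem
  suffices.\<close>

lemma nn_integral_translated_layers_le:
  assumes F: "F \<in> borel_measurable (completion M)" and \<phi>: "\<phi> \<in> borel_measurable borel"
    and AE: "AE y in M. ennreal (cmod (F y)) = \<phi> y" and I: "I \<in> sets borel" "I \<subseteq> {0<..}"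
  shows "(\<integral>\<^sup>+y. (\<integral>\<^sup>+z. layers V a I z \<partial>kernel x y) * \<phi> (invol y) \<partial>M)
    \<le> (\<integral>\<^sup>+u\<in>I. layer_density a u * rearrangement_integral M F u \<partial>lborel)"
proof -
  note [measurable] = \<phi> V I(1)
  interpret M: sigma_finite_measure M by (rule sigma_finite)
  interpret P: pair_sigma_finite M lborel ..
  have kx: "(\<lambda>p. kernel x (fst p)) \<in> M \<Otimes>\<^sub>M lborel \<rightarrow>\<^sub>M subprob_algebra borel"
  proof -
    have "Pair x \<in> borel \<rightarrow>\<^sub>M borel" by (intro borel_measurable_continuous_onI continuous_intros)
    from measurable_compose[OF this measurable_kernel]
    have "kernel x \<in> borel \<rightarrow>\<^sub>M subprob_algebra borel" by simp
    then have "kernel x \<in> M \<rightarrow>\<^sub>M subprob_algebra borel"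
      using measurable_cong_sets[OF sets_M refl] by blast
    then show ?thesis by (rule measurable_compose[OF measurable_fst])
  qed
  have m: "(\<lambda>p. emeasure (kernel x (fst p)) {z. V z < snd p}) \<in> borel_measurable (M \<Otimes>\<^sub>M lborel)"
  proof -
    have "(\<lambda>q. snd (fst q)) \<in> (M \<Otimes>\<^sub>M lborel) \<Otimes>\<^sub>M (borel :: 'a measure) \<rightarrow>\<^sub>M (lborel :: real measure)"
      by (rule measurable_compose[OF measurable_fst measurable_snd])
    then have [measurable]: "(\<lambda>q. snd (fst q)) \<in> borel_measurable ((M \<Otimes>\<^sub>M (lborel :: real measure)) \<Otimes>\<^sub>M (borel :: 'a measure))"
      by simp
    have [measurable]: "(\<lambda>q. V (snd q)) \<in> borel_measurable ((M \<Otimes>\<^sub>M (lborel :: real measure)) \<Otimes>\<^sub>M borel)"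
      by (rule measurable_compose[OF measurable_snd V])
    have "{q \<in> space ((M \<Otimes>\<^sub>M lborel) \<Otimes>\<^sub>M borel). V (snd q) < snd (fst q)} \<in> sets ((M \<Otimes>\<^sub>M lborel) \<Otimes>\<^sub>M borel)"
      by (rule borel_measurable_less) measurable
    also have "{q \<in> space ((M \<Otimes>\<^sub>M lborel) \<Otimes>\<^sub>M borel). V (snd q) < snd (fst q)} =
      (SIGMA p:space (M \<Otimes>\<^sub>M lborel). {z. V z < snd p})"
      by (auto simp: space_pair_measure)
    finally show ?thesis by (rule emeasure_measurable_subprob_algebra2[OF _ kx])
  qed
  have [measurable]: "(\<lambda>y. \<phi> (invol y)) \<in> borel_measurable M" by (rule measurable_M) measurable
  note [measurable] = m
  have "(\<integral>\<^sup>+y. (\<integral>\<^sup>+z. layers V a I z \<partial>kernel x y) * \<phi> (invol y) \<partial>M) =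
    (\<integral>\<^sup>+y. \<integral>\<^sup>+u. layer_density a u * emeasure (kernel x y) {z. V z < u} * indicator I u * \<phi> (invol y) \<partial>lborel \<partial>M)"
  proof (rule nn_integral_cong)
    fix y
    have [measurable]: "(\<lambda>u. emeasure (kernel x y) {z. V z < u}) \<in> borel_measurable borel"
      using measurable_compose[OF measurable_Pair1' m, of y] by (simp add: space_M)
    have [measurable]: "(indicator I :: real \<Rightarrow> ennreal) \<in> borel_measurable borel"
      using I(1) by (rule borel_measurable_indicator)
    show "(\<integral>\<^sup>+z. layers V a I z \<partial>kernel x y) * \<phi> (invol y) =
      (\<integral>\<^sup>+u. layer_density a u * emeasure (kernel x y) {z. V z < u} * indicator I u * \<phi> (invol y) \<partial>lborel)"
      unfolding nn_integral_kernel_layers[OF I(1)] by (intro nn_integral_multc[symmetric]) measurable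
  qed
  also have "\<dots> = (\<integral>\<^sup>+u. \<integral>\<^sup>+y. layer_density a u * emeasure (kernel x y) {z. V z < u} * indicator I u * \<phi> (invol y) \<partial>M \<partial>lborel)"
  proof (rule P.Fubini'[symmetric])
    have "layer_density a \<in> borel_measurable lborel" "(indicator I :: real \<Rightarrow> ennreal) \<in> borel_measurable lborel"
      using I(1) by (auto intro!: borel_measurable_indicator)
    then have "(\<lambda>p. layer_density a (snd p)) \<in> borel_measurable (M \<Otimes>\<^sub>M lborel)"
      "(\<lambda>p. indicator I (snd p) :: ennreal) \<in> borel_measurable (M \<Otimes>\<^sub>M lborel)"
      by (auto intro: measurable_compose[OF measurable_snd])
    moreover have "(\<lambda>p. \<phi> (invol (fst p))) \<in> borel_measurable (M \<Otimes>\<^sub>M lborel)"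
      by (rule measurable_compose[OF measurable_fst]) fact
    ultimately show "(\<lambda>(y, u). layer_density a u * emeasure (kernel x y) {z. V z < u} * indicator I u * \<phi> (invol y))
      \<in> borel_measurable (M \<Otimes>\<^sub>M lborel)"
      using m unfolding case_prod_beta by (intro borel_measurable_times_ennreal) auto
  qed
  also have "\<dots> \<le> (\<integral>\<^sup>+u\<in>I. layer_density a u * rearrangement_integral M F u \<partial>lborel)"
  proof (rule nn_integral_mono)
    fix u :: real
    show "(\<integral>\<^sup>+y. layer_density a u * emeasure (kernel x y) {z. V z < u} * indicator I u * \<phi> (invol y) \<partial>M)
      \<le> layer_density a u * rearrangement_integral M F u * indicator I u"
    proof (cases "u \<in> I")
      case True
      then have u: "0 < u" using I(2) by auto
      have "{z. V z < u} \<in> sets borel" using V by measurable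
      then have [measurable]: "(\<lambda>y. emeasure (kernel x y) {z. V z < u}) \<in> borel_measurable borel"
        using borel_measurable_section(2)[OF emeasure_kernel_measurable[OF haar sigma_finite], of _ x] by simp
      have "(\<integral>\<^sup>+y. layer_density a u * emeasure (kernel x y) {z. V z < u} * indicator I u * \<phi> (invol y) \<partial>M) =
        (\<integral>\<^sup>+y. layer_density a u * (emeasure (kernel x y) {z. V z < u} * \<phi> (invol y)) \<partial>M)"
        using True by (simp add: mult.assoc)
      also have "\<dots> = layer_density a u * (\<integral>\<^sup>+y. emeasure (kernel x y) {z. V z < u} * \<phi> (invol y) \<partial>M)"
        by (intro nn_integral_cmult measurable_M) measurable
      also have "\<dots> \<le> layer_density a u * rearrangement_integral M F u"
        by (intro mult_left_mono nn_integral_sublevel_le F \<phi> AE u) simp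
      finally show ?thesis using True by simp
    qed simp
  qed
  finally show ?thesis .
qed

text \<open>\<open>H0\<close> pairs the layers up to \<open>t\<close> with the excess of \<phi>
  above its cut \<open>c\<close>. The layers up to \<open>t\<close> paired with \<open>c\<close>,
  and the layers beyond \<open>t\<close> paired with all of \<phi>, are bounded uniformly in
  \<open>x\<close> and make up \<open>b\<close>.\<close>

lemma riesz_splitting:
  assumes F: "F \<in> borel_measurable (completion M)" and \<phi>[measurable]: "\<phi> \<in> borel_measurable borel"
    and AE: "AE y in M. ennreal (cmod (F y)) = \<phi> y" and K: "0 < K" and t: "0 < t"
  shows "\<exists>H0\<in>borel_measurable M. \<exists>b.
    (\<forall>x. ennreal K * (\<integral>\<^sup>+y. (\<integral>\<^sup>+z. layers V a {0<..} z \<partial>kernel x y) * \<phi> (invol y) \<partial>M) \<le> H0 x + b) \<and>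
    (\<integral>\<^sup>+x. H0 x \<partial>M) + ennreal t * b \<le> ennreal t *
      (ennreal (K / a) * (\<integral>\<^sup>+u\<in>{t<..}. ennreal (u powr (a - 1)) * maximal_rearrangement M F u \<partial>lborel))"
proof -
  let ?G = "rearrangement_integral M F"
  define B where "B = (\<integral>\<^sup>+u\<in>{t<..}. ennreal (u powr (a - 2)) * ?G u \<partial>lborel)"
  have B_eq: "(\<integral>\<^sup>+u\<in>{t<..}. ennreal (u powr (a - 1)) * maximal_rearrangement M F u \<partial>lborel) = B"
    unfolding B_def
  proof (rule nn_integral_cong)
    fix u :: real
    have "ennreal (u powr (a - 1)) * ennreal (1 / u) = ennreal (u powr (a - 2))" if "0 < u"
    proof -
      have "u powr (a - 1) * (1 / u) = u powr (a - 2)"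
        using that by (simp add: powr_diff power2_eq_square)
      then show ?thesis using that by (simp flip: ennreal_mult)
    qed
    then show "ennreal (u powr (a - 1)) * maximal_rearrangement M F u * indicator {t<..} u =
      ennreal (u powr (a - 2)) * ?G u * indicator {t<..} u"
      using t by (simp add: indicator_def maximal_rearrangement_eq mult.assoc[symmetric])
  qed
  have tail: "?G t * ennreal (t powr (a - 1) / (1 - a)) \<le> B"
    unfolding B_def by (rule nn_integral_tail_ge[OF rearrangement_integral_mono a t])
  show ?thesis
  proof (cases "?G t = \<infinity>")
    \<comment> \<open>Then the tail is infinite as well, and the infinite function is an admissible
      \<open>H0\<close>.\<close>
    case True
    then have "B = \<infinity>" using tail a t by (simp add: ennreal_top_mult top.extremum_unique)
    then have "ennreal t * (ennreal (K / a) * B) = \<infinity>" using K a t by (simp add: ennreal_mult_top)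
    then show ?thesis unfolding B_eq
      by (intro bexI[of _ "\<lambda>_. \<infinity>"] exI[of _ 0]) auto
  next
    case False
    have "\<phi> \<in> borel_measurable M" using \<phi> by (rule measurable_M)
    then obtain c where
      c: "0 \<le> c" "?G t = (\<integral>\<^sup>+y. (\<phi> y - ennreal c) \<partial>M) + ennreal (t * c)"
      by (rule rearrangement_integral_split[OF sigma_finite F _ AE t False])
    define \<phi>0 where "\<phi>0 y = \<phi> y - ennreal c" for y
    have \<phi>0[measurable]: "\<phi>0 \<in> borel_measurable borel" unfolding \<phi>0_def by measurable
    define T where "T I x y = (\<integral>\<^sup>+z. layers V a I z \<partial>kernel x y)" for I x y
    have lm: "layers V a I \<in> borel_measurable borel" if "I \<in> sets borel" for I
      by (rule measurable_layers[OF V that])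
    have Tm: "(\<lambda>p. T I (fst p) (snd p)) \<in> borel_measurable borel" if "I \<in> sets borel" for I
      unfolding T_def by (rule measurable_kernel_nn_integral[OF lm[OF that]])
    have Tx: "T I x \<in> borel_measurable M" if "I \<in> sets borel" for I x
      using borel_measurable_section(2)[OF Tm[OF that], of x] by (intro measurable_M) simp
    have T_add: "T {0<..} x y = T {0<..t} x y + T {t<..} x y" for x y
    proof -
      have "layers V a {0<..} z = layers V a {0<..t} z + layers V a {t<..} z" for z
        unfolding layers_def using t
        by (subst nn_integral_add[symmetric]) (auto intro!: nn_integral_cong simp: indicator_def)
      then have "T {0<..} x y = (\<integral>\<^sup>+z. layers V a {0<..t} z + layers V a {t<..} z \<partial>kernel x y)"
        unfolding T_def by (intro nn_integral_cong)
      also have "\<dots> = T {0<..t} x y + T {t<..} x y"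
        unfolding T_def using lm by (intro nn_integral_add) (auto cong: measurable_cong_sets)
      finally show ?thesis .
    qed
    \<comment> \<open>The mass of the layers up to \<open>t\<close>; by invariance, also the mass of
      each of their translates.\<close>
    define W where "W = ennreal ((1 - a) * (t powr a / a))"
    have lW: "(\<integral>\<^sup>+z. layers V a {0<..t} z \<partial>M) = W"
    proof -
      have "(\<integral>\<^sup>+z. layers V a {0<..t} z \<partial>M) = (\<integral>\<^sup>+u\<in>{0<..t}. ennreal ((1 - a) * u powr (a - 1)) \<partial>lborel)"
        by (rule nn_integral_layers_M) auto
      also have "\<dots> = (\<integral>\<^sup>+u. ennreal (1 - a) * (ennreal (u powr (a - 1)) * indicator {0<..<t} u) \<partial>lborel)"
        using AE_lborel_singleton[of t] a
        by (intro nn_integral_cong_AE) (auto elim!: eventually_mono simp: indicator_def ennreal_mult)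
      also have "\<dots> = ennreal (1 - a) * ennreal (t powr a / a)"
        using a t by (subst nn_integral_cmult, measurable, subst nn_integral_powr_head) auto
      finally show ?thesis unfolding W_def using a by (subst ennreal_mult) auto
    qed
    have TW: "(\<integral>\<^sup>+y. T {0<..t} x y \<partial>M) = W" for x
      unfolding T_def using invariant[OF lm, of "{0<..t}" x] lW by simp
    define D where "D = (\<integral>\<^sup>+u\<in>{t<..}. layer_density a u * ?G u \<partial>lborel)"
    have D: "D = ennreal (1 - a) * B"
    proof -
      note [measurable] = borel_measurable_mono_ennreal[OF rearrangement_integral_mono[of M F]]
      show ?thesis unfolding D_def B_def layer_density_def using a
        by (subst nn_integral_cmult[symmetric]) (auto simp: ennreal_mult mult.assoc)
    qed
    define H0 where "H0 x = ennreal K * (\<integral>\<^sup>+y. T {0<..t} x y * \<phi>0 (invol y) \<partial>M)" for x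
    define b where "b = ennreal K * (ennreal c * W + D)"
    have \<phi>M: "(\<lambda>y. \<phi> (invol y)) \<in> borel_measurable M" "(\<lambda>y. \<phi>0 (invol y)) \<in> borel_measurable M"
      by (rule measurable_M, measurable)+
    have le: "ennreal K * (\<integral>\<^sup>+y. T {0<..} x y * \<phi> (invol y) \<partial>M) \<le> H0 x + b" for x
    proof -
      have "(\<integral>\<^sup>+y. T {0<..} x y * \<phi> (invol y) \<partial>M) =
        (\<integral>\<^sup>+y. T {0<..t} x y * \<phi> (invol y) \<partial>M) + (\<integral>\<^sup>+y. T {t<..} x y * \<phi> (invol y) \<partial>M)"
        unfolding T_add distrib_right using Tx \<phi>M by (intro nn_integral_add) auto
      also have "(\<integral>\<^sup>+y. T {t<..} x y * \<phi> (invol y) \<partial>M) \<le> D"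
        unfolding T_def D_def using t by (intro nn_integral_translated_layers_le F \<phi> AE) auto
      also have "(\<integral>\<^sup>+y. T {0<..t} x y * \<phi> (invol y) \<partial>M) \<le>
        (\<integral>\<^sup>+y. T {0<..t} x y * \<phi>0 (invol y) + T {0<..t} x y * ennreal c \<partial>M)"
        unfolding \<phi>0_def distrib_left[symmetric] by (intro nn_integral_mono mult_left_mono ennreal_le_diff_add) simp
      also have "\<dots> = (\<integral>\<^sup>+y. T {0<..t} x y * \<phi>0 (invol y) \<partial>M) + W * ennreal c"
        using Tx \<phi>M by (subst nn_integral_add) (auto simp: nn_integral_multc TW)
      finally have "(\<integral>\<^sup>+y. T {0<..} x y * \<phi> (invol y) \<partial>M) \<le>
        (\<integral>\<^sup>+y. T {0<..t} x y * \<phi>0 (invol y) \<partial>M) + W * ennreal c + D" by (simp add: add_mono)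
      then have "ennreal K * (\<integral>\<^sup>+y. T {0<..} x y * \<phi> (invol y) \<partial>M) \<le>
        ennreal K * ((\<integral>\<^sup>+y. T {0<..t} x y * \<phi>0 (invol y) \<partial>M) + W * ennreal c + D)"
        by (rule mult_left_mono) simp
      also have "\<dots> = H0 x + b" by (simp add: H0_def b_def distrib_left mult_ac add_ac)
      finally show ?thesis .
    qed
    let ?P = "\<lambda>p. T {0<..t} (fst p) (snd p) * \<phi>0 (invol (snd p))"
    have "(\<lambda>p :: 'a \<times> 'a. \<phi>0 (invol (snd p))) \<in> borel_measurable borel"
      by (rule measurable_compose[of snd borel borel])
        (auto intro!: borel_measurable_continuous_onI continuous_intros)
    then have "?P \<in> borel_measurable borel"
      using Tm[of "{0<..t}"] by (intro borel_measurable_times_ennreal) auto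
    \<comment> \<open>The translate is known to be Borel on the product space, not product
      measurable, so the exchange is the one for regular measures.\<close>
    from sections_swap[OF haar_inner_regular[OF haar sigma_finite] haar_inner_regular[OF haar sigma_finite] sigma_finite sigma_finite this]
    have sw: "(\<lambda>x. \<integral>\<^sup>+y. T {0<..t} x y * \<phi>0 (invol y) \<partial>M) \<in> borel_measurable borel"
      "(\<integral>\<^sup>+x. \<integral>\<^sup>+y. T {0<..t} x y * \<phi>0 (invol y) \<partial>M \<partial>M) = (\<integral>\<^sup>+y. \<integral>\<^sup>+x. T {0<..t} x y * \<phi>0 (invol y) \<partial>M \<partial>M)"
      by (simp_all add: sections_swap_def)
    have "(\<integral>\<^sup>+y. \<integral>\<^sup>+x. T {0<..t} x y * \<phi>0 (invol y) \<partial>M \<partial>M) = (\<integral>\<^sup>+y. W * \<phi>0 (invol y) \<partial>M)"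
    proof (rule nn_integral_cong)
      \<comment> \<open>Commutativity allows integration in the first variable of the kernel, with
        the same mass \<open>W\<close>.\<close>
      fix y
      have "(\<integral>\<^sup>+x. T {0<..t} x y * \<phi>0 (invol y) \<partial>M) = (\<integral>\<^sup>+x. T {0<..t} y x * \<phi>0 (invol y) \<partial>M)"
        by (simp add: T_def kernel_commute[of y])
      also have "\<dots> = W * \<phi>0 (invol y)" using Tx by (simp add: nn_integral_multc TW)
      finally show "(\<integral>\<^sup>+x. T {0<..t} x y * \<phi>0 (invol y) \<partial>M) = W * \<phi>0 (invol y)" .
    qed
    also have "\<dots> = W * (\<integral>\<^sup>+y. \<phi>0 y \<partial>M)"
      using \<phi>M by (simp add: nn_integral_cmult nn_integral_invol[OF haar sigma_finite \<phi>0])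
    finally have H0_int: "(\<integral>\<^sup>+x. H0 x \<partial>M) = ennreal K * (W * (\<integral>\<^sup>+y. \<phi>0 y \<partial>M))"
      unfolding H0_def using measurable_M[OF sw(1)] sw(2) by (simp add: nn_integral_cmult)
    \<comment> \<open>The low layers contribute \<open>W * ?G t\<close>, which \<open>tail\<close>
      converts into \<open>B\<close>; the factor is the quotient of \<open>W\<close> by
      \<open>t powr (a - 1) / (1 - a)\<close>.\<close>
    have WG: "W * ?G t \<le> ennreal ((1 - a)^2 / a * t) * B"
    proof -
      have "t * t powr (a - 1) = t powr a" using t by (simp add: powr_mult_base)
      then have "(1 - a) * (t powr a / a) = ((1 - a)^2 / a * t) * (t powr (a - 1) / (1 - a))"
        using a by (simp add: field_simps power2_eq_square)
      then have "W = ennreal ((1 - a)^2 / a * t) * ennreal (t powr (a - 1) / (1 - a))"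
        unfolding W_def using a t by (subst ennreal_mult[symmetric]) auto
      then have "W * ?G t = ennreal ((1 - a)^2 / a * t) * (?G t * ennreal (t powr (a - 1) / (1 - a)))"
        by (simp add: mult_ac)
      also have "\<dots> \<le> ennreal ((1 - a)^2 / a * t) * B" using tail by (rule mult_left_mono) simp
      finally show ?thesis .
    qed
    \<comment> \<open>By the choice of \<open>c\<close>, the two terms carrying \<open>W\<close>
      recombine to exactly \<open>W * ?G t\<close>.\<close>
    have "(\<integral>\<^sup>+x. H0 x \<partial>M) + ennreal t * b = ennreal K * (W * ?G t + ennreal t * D)"
      unfolding H0_int b_def c(2) \<phi>0_def using c(1) t by (simp add: ennreal_mult distrib_left mult_ac add_ac)
    also have "\<dots> \<le> ennreal K * (ennreal ((1 - a)^2 / a * t) * B + ennreal t * D)"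
      using WG by (intro mult_left_mono add_right_mono) auto
    also have "\<dots> = ennreal (K * ((1 - a)^2 / a * t + t * (1 - a))) * B"
    proof -
      have *: "ennreal K * (ennreal x * B + ennreal y * B) = ennreal (K * (x + y)) * B" if "0 \<le> x" "0 \<le> y" for x y
        using that K by (simp add: ennreal_mult ennreal_plus distrib_left distrib_right mult_ac)
      have "ennreal t * D = ennreal (t * (1 - a)) * B"
        unfolding D using a t by (simp add: ennreal_mult mult.assoc)
      then show ?thesis using *[of "(1 - a)^2 / a * t" "t * (1 - a)"] a t by simp
    qed
    also have "\<dots> \<le> ennreal (t * (K / a)) * B"
    proof (intro mult_right_mono ennreal_leI)
      \<comment> \<open>Low and high layers contribute \<open>(1 - a)^2 / a\<close> and
        \<open>1 - a\<close>, together \<open>(1 - a) / a\<close>, which is rounded up to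
        \<open>1 / a\<close>.\<close>
      have "(1 - a)^2 / a * t + t * (1 - a) = t * (1 - a) / a" using a by (simp add: field_simps power2_eq_square)
      also have "\<dots> \<le> t / a" using a t by (intro divide_right_mono) (auto simp: mult_le_cancel_left2)
      finally have "K * ((1 - a)^2 / a * t + t * (1 - a)) \<le> K * (t / a)" using K by (intro mult_left_mono) auto
      then show "K * ((1 - a)^2 / a * t + t * (1 - a)) \<le> t * (K / a)" by (simp add: mult_ac)
    qed simp
    also have "\<dots> = ennreal t * (ennreal (K / a) * B)" using K a t by (subst ennreal_mult) (auto simp: mult.assoc)
    finally have "(\<integral>\<^sup>+x. H0 x \<partial>M) + ennreal t * b \<le> ennreal t * (ennreal (K / a) * B)" .
    moreover have "H0 \<in> borel_measurable M"
      unfolding H0_def using measurable_M[OF sw(1)] by measurable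
    ultimately show ?thesis
      using le unfolding T_def B_eq by blast
  qed
qed

end

end

section \<open>Boundedness of the fractional integral\<close>

lemma measurable_completion_cong_AE:
  assumes g: "g \<in> M \<rightarrow>\<^sub>M N" and AE: "AE x in M. f x = g x" and sp: "\<And>x. x \<in> space M \<Longrightarrow> f x \<in> space N"
  shows "f \<in> completion M \<rightarrow>\<^sub>M N"
proof (rule measurableI)
  fix S assume S: "S \<in> sets N"
  have "AE x in completion M. x \<in> g -` S \<inter> space M \<longleftrightarrow> x \<in> f -` S \<inter> space M"
    using AE_completion[OF AE] by eventually_elim auto
  moreover have "g -` S \<inter> space M \<in> sets (completion M)" using measurable_sets[OF g S] by simp
  ultimately show "f -` S \<inter> space (completion M) \<in> sets (completion M)"
    using completion.in_sets_AE[of "g -` S \<inter> space M" "f -` S \<inter> space M" M] by simp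
qed (use sp in simp)

lemma completion_ex_borel_measurable_complex:
  fixes f :: "'a \<Rightarrow> complex"
  assumes f: "f \<in> borel_measurable (completion M)"
  shows "\<exists>h\<in>borel_measurable M. (AE x in M. f x = h x)"
proof -
  have "(\<lambda>x. Re (f x)) \<in> borel_measurable (completion M)" "(\<lambda>x. Im (f x)) \<in> borel_measurable (completion M)"
    using f by measurable
  from this[THEN completion_ex_borel_measurable_real] obtain u v where
    [measurable]: "u \<in> borel_measurable M" "v \<in> borel_measurable M"
    and AE: "AE x in M. Re (f x) = u x" "AE x in M. Im (f x) = v x" by blast
  show ?thesis
  proof (intro bexI[of _ "\<lambda>x. complex_of_real (u x) + \<i> * complex_of_real (v x)"])
    show "AE x in M. f x = complex_of_real (u x) + \<i> * complex_of_real (v x)"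
      using AE by eventually_elim (auto simp: complex_eq_iff)
  qed measurable
qed

text \<open>Sets measurable for the completion, such as the balls, are enclosed in hulls of the same
  measure from the original \<sigma>-algebra.\<close>

lemma sigma_finite_measure_completionD:
  assumes "\<And>n::nat. B n \<in> sets (completion M)" "\<And>n. emeasure (completion M) (B n) < \<infinity>" "(\<Union>n. B n) = space M"
  shows "sigma_finite_measure M"
proof
  have "\<forall>n. \<exists>A. A \<in> sets M \<and> B n \<subseteq> A \<and> emeasure (completion M) (B n) = emeasure M A"
    using completion_upper[OF assms(1)] by blast
  from choice[OF this] obtain A
    where *: "\<forall>n. A n \<in> sets M \<and> B n \<subseteq> A n \<and> emeasure (completion M) (B n) = emeasure M (A n)" ..
  have A: "A n \<in> sets M" "B n \<subseteq> A n" "emeasure M (A n) = emeasure (completion M) (B n)" for n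
    using spec[OF *, of n] by (simp_all only:)
  have "emeasure M (A n) \<noteq> \<infinity>" for n unfolding A(3) using assms(2)[of n] by (rule less_imp_neq)
  moreover have "(\<Union>n. A n) = space M"
  proof
    show "(\<Union>n. A n) \<subseteq> space M" using sets.sets_into_space[OF A(1)] by (rule UN_least)
    show "space M \<subseteq> (\<Union>n. A n)" unfolding assms(3)[symmetric] using A(2) by (intro UN_mono) auto
  qed
  ultimately show "\<exists>A. countable A \<and> A \<subseteq> sets M \<and> \<Union> A = space M \<and> (\<forall>a\<in>A. emeasure M a \<noteq> \<infinity>)"
    using A(1) by (intro exI[of _ "range A"]) auto
qed

text \<open>\<open>sections_swap\<close> makes the integrals of the positive and of the negative
  part measurable, although the integrand need not be product measurable. Their difference is the
  integral only where the section is integrable, hence the restricted claim about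
  \<open>P\<close>.\<close>

lemma borel_measurable_section_integral_real:
  fixes M1 :: "'a::t2_space measure" and M2 :: "'b::t2_space measure" and D :: "'a \<times> 'b \<Rightarrow> real"
  assumes M1: "compact_inner_regular M1" "sigma_finite_measure M1"
    and M2: "compact_inner_regular M2" "sigma_finite_measure M2" and D: "D \<in> borel_measurable borel"
  shows "\<exists>P\<in>borel_measurable borel. \<forall>x. integrable M2 (\<lambda>y. D (x, y)) \<longrightarrow> (LINT y|M2. D (x, y)) = P x"
proof -
  have "(\<lambda>p. ennreal (D p)) \<in> borel_measurable borel" "(\<lambda>p. ennreal (- D p)) \<in> borel_measurable borel"
    using D by measurable
  from this[THEN sections_swap[OF M1(1) M2(1) M1(2) M2(2)]]
  have [measurable]: "(\<lambda>x. \<integral>\<^sup>+y. ennreal (D (x, y)) \<partial>M2) \<in> borel_measurable borel"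
    "(\<lambda>x. \<integral>\<^sup>+y. ennreal (- D (x, y)) \<partial>M2) \<in> borel_measurable borel"
    by (auto simp: sections_swap_def)
  show ?thesis
    by (intro bexI[of _ "\<lambda>x. enn2real (\<integral>\<^sup>+y. ennreal (D (x, y)) \<partial>M2) - enn2real (\<integral>\<^sup>+y. ennreal (- D (x, y)) \<partial>M2)"])
       (simp_all add: real_lebesgue_integral_def)
qed

lemma borel_measurable_section_integral:
  fixes M1 :: "'a::t2_space measure" and M2 :: "'b::t2_space measure" and D :: "'a \<times> 'b \<Rightarrow> complex"
  assumes M1: "compact_inner_regular M1" "sigma_finite_measure M1"
    and M2: "compact_inner_regular M2" "sigma_finite_measure M2" and D: "D \<in> borel_measurable borel"
  shows "\<exists>P\<in>borel_measurable borel. \<forall>x. integrable M2 (\<lambda>y. D (x, y)) \<longrightarrow> (LINT y|M2. D (x, y)) = P x"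
proof -
  have "(\<lambda>p. Re (D p)) \<in> borel_measurable borel" "(\<lambda>p. Im (D p)) \<in> borel_measurable borel"
    using D by measurable
  from this[THEN borel_measurable_section_integral_real[OF M1 M2]] obtain P Q where
    [measurable]: "P \<in> borel_measurable borel" "Q \<in> borel_measurable borel"
    and P: "\<And>x. integrable M2 (\<lambda>y. Re (D (x, y))) \<Longrightarrow> (LINT y|M2. Re (D (x, y))) = P x"
    and Q: "\<And>x. integrable M2 (\<lambda>y. Im (D (x, y))) \<Longrightarrow> (LINT y|M2. Im (D (x, y))) = Q x"
    by blast
  show ?thesis
  proof (intro bexI[of _ "\<lambda>x. complex_of_real (P x) + \<i> * complex_of_real (Q x)"] allI impI)
    fix x assume i: "integrable M2 (\<lambda>y. D (x, y))"
    then show "(LINT y|M2. D (x, y)) = complex_of_real (P x) + \<i> * complex_of_real (Q x)"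
      using P[of x] Q[of x] by (simp add: complex_eq_iff)
  qed measurable
qed

context commutative_hypergroup
begin

text \<open>By invariance the mass that \<open>kernel x y\<close> gives to a null set
  \<open>Z\<close> integrates to 0 over \<open>y\<close>, so it is 0 for almost every
  \<open>y\<close>. The Riesz kernel may thus be changed on a null set before it is
  translated.\<close>

lemma AE_translation_cong:
  assumes haar: "haar_measure conv M" and sf: "sigma_finite_measure M"
    and AE: "AE z in M. k z = g z"
  shows "AE y in M. translation conv x k y = (\<integral>\<^sup>+z. g z \<partial>kernel x y)"
proof -
  note sets = sets_haar[OF haar sf]
  obtain Z where Z: "{z \<in> space M. k z \<noteq> g z} \<subseteq> Z" "emeasure M Z = 0" "Z \<in> sets M"
    using AE by (rule AE_E)
  have Zb: "Z \<in> sets borel" using Z(3) sets by simp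
  have "(\<lambda>y. emeasure (kernel x y) Z) \<in> borel_measurable borel"
    using borel_measurable_section(2)[OF emeasure_kernel_measurable[OF haar sf Zb], of x] by simp
  then have "(\<lambda>y. emeasure (kernel x y) Z) \<in> borel_measurable M"
    using measurable_cong_sets[OF sets refl] by blast
  moreover have "(\<integral>\<^sup>+y. emeasure (kernel x y) Z \<partial>M) = 0"
    using haar_invariant_emeasure[OF haar sf Zb] Z(2) by simp
  ultimately have "AE y in M. emeasure (kernel x y) Z = 0" by (simp add: nn_integral_0_iff_AE)
  then show ?thesis
  proof eventually_elim
    case (elim y)
    then have "AE z in kernel x y. k z = g z"
      using Z(1) Zb space_haar[OF haar sf] by (intro AE_I[of _ _ Z]) auto
    then show ?case unfolding translation_eq by (rule nn_integral_cong_AE)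
  qed
qed

lemma AE_invol:
  assumes haar: "haar_measure conv M" and sf: "sigma_finite_measure M" and AE: "AE y in M. P y"
  shows "AE y in M. P (invol y)"
proof -
  obtain Z where Z: "{z \<in> space M. \<not> P z} \<subseteq> Z" "emeasure M Z = 0" "Z \<in> sets M"
    using AE by (rule AE_E)
  have m: "invol \<in> M \<rightarrow>\<^sub>M borel"
    using borel_measurable_continuous_onI[OF invol_continuous] measurable_cong_sets[OF sets_haar[OF haar sf] refl] by blast
  have Zb: "Z \<in> sets borel" using Z(3) sets_haar[OF haar sf] by simp
  have "emeasure M (invol -` Z \<inter> space M) = emeasure (distr M borel invol) Z"
    by (rule emeasure_distr[OF m Zb, symmetric])
  then have "emeasure M (invol -` Z \<inter> space M) = 0" using Z(2) by (simp add: distr_invol[OF haar sf])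
  then show ?thesis
    using measurable_sets[OF m Zb] Z(1) space_haar[OF haar sf] by (intro AE_I[of _ _ "invol -` Z \<inter> space M"]) auto
qed

end

theorem theorem4p2:
  fixes conv :: "('a::t2_space set \<Rightarrow> complex) \<Rightarrow> ('a set \<Rightarrow> complex) \<Rightarrow> ('a set \<Rightarrow> complex)"
    and e :: 'a and invol :: "'a \<Rightarrow> 'a"
    and haar :: "'a measure" and \<rho> :: "'a \<Rightarrow> 'a \<Rightarrow> real"
    and N A \<alpha> p r :: real and q :: ennreal and f :: "'a \<Rightarrow> complex"
  assumes "commutative_hypergroup conv e invol"
    and "haar_measure conv haar"
    and "quasi_metric \<rho>"
    and "N > 0" and "A > 0"
    and "\<And>s. s > 0 \<Longrightarrow> {y. \<rho> e y < s} \<in> sets (completion haar) \<and>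
           emeasure (completion haar) {y. \<rho> e y < s} = ennreal (A * s powr N)"
    and "1 \<le> q" and "1 \<le> p" and "0 < \<alpha>" and "\<alpha> < N / p"
    and "1 / r = 1 / p - \<alpha> / N"
    and "f \<in> lorentz_space haar p q"
  shows "(AE x in haar. fractional_integral_converges conv e invol haar \<rho> N \<alpha> f x) \<and>
    fractional_integral conv e invol haar \<rho> N \<alpha> f \<in> lorentz_space haar r q \<and>
    lorentz_norm haar r q (fractional_integral conv e invol haar \<rho> N \<alpha> f)
      \<le> ennreal (3 * r * N / \<alpha> * A powr ((N - \<alpha>) / N)) * lorentz_norm haar p q f"
proof -
  interpret commutative_hypergroup conv e invol by fact
  note haar = assms(2) and N = \<open>N > 0\<close> and A = \<open>A > 0\<close> and ball = assms(6)
  have ballm: "{y. \<rho> e y < s} \<in> sets (completion haar)"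
    and balle: "emeasure (completion haar) {y. \<rho> e y < s} = ennreal (A * s powr N)" if "0 < s" for s
    using ball[OF that] by auto
  have \<rho>_nonneg: "0 \<le> \<rho> e y" for y using assms(3) by (simp add: quasi_metric_def)
  define a where "a = \<alpha> / N"
  have "N / p \<le> N" using N \<open>1 \<le> p\<close> by (simp add: field_simps)
  then have a: "0 < a" "a < 1" using N \<open>0 < \<alpha>\<close> \<open>\<alpha> < N / p\<close> by (auto simp: a_def)
  have "\<alpha> / N < 1 / p" using N \<open>\<alpha> < N / p\<close> by (simp add: field_simps)
  then have r: "0 < r" using assms(11) by (metis diff_gt_0_iff_gt zero_less_divide_1_iff)
  have pr: "1 / r = 1 / p - a" using assms(11) by (simp add: a_def)
  have sp: "space haar = UNIV"
    using sets_eq_imp_space_eq[OF haar[unfolded haar_measure_def radon_measure_def, THEN conjunct1, THEN conjunct1]]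
    by simp
  \<comment> \<open>The balls around \<open>e\<close> exhaust the space; the radii are
    \<open>Suc n\<close> because the volume formula is assumed for positive radii.\<close>
  have sf: "sigma_finite_measure haar"
  proof (rule sigma_finite_measure_completionD)
    show "{y. \<rho> e y < real (Suc n)} \<in> sets (completion haar)" for n by (rule ballm) simp
    show "emeasure (completion haar) {y. \<rho> e y < real (Suc n)} < \<infinity>" for n by (subst balle) auto
    show "(\<Union>n. {y. \<rho> e y < real (Suc n)}) = space haar"
    proof -
      have "\<exists>n. \<rho> e y < real (Suc n)" for y
      proof -
        obtain n where "\<rho> e y < real n" using reals_Archimedean2 by blast
        then have "\<rho> e y < real (Suc n)" by simp
        then show ?thesis ..
      qed
      then show ?thesis unfolding sp by blast
    qed
  qed
  note sets = sets_haar[OF haar sf] and ir = haar_inner_regular[OF haar sf]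
  have toM: "g \<in> borel_measurable haar \<longleftrightarrow> g \<in> borel_measurable borel" for g :: "'a \<Rightarrow> 'c::topological_space"
    using measurable_cong_sets[OF sets refl] by blast

  have "(\<lambda>y. \<rho> e y) \<in> borel_measurable (completion haar)"
  proof (rule borel_measurableI_less)
    fix s
    show "{y \<in> space (completion haar). \<rho> e y < s} \<in> sets (completion haar)"
    proof (cases "0 < s")
      case True
      with ballm show ?thesis by (simp add: sp)
    next
      case False
      then have "{y \<in> space (completion haar). \<rho> e y < s} = {}"
        using \<rho>_nonneg by (auto simp: not_less intro: order_trans)
      then show ?thesis by (simp only: sets.empty_sets)
    qed
  qed
  \<comment> \<open>The distance to \<open>e\<close> is measurable for the completion;
    \<open>R\<close> is a Borel version of it.\<close>
  from completion_ex_borel_measurable_real[OF this] obtain R where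
    R: "R \<in> borel_measurable haar" "AE y in haar. \<rho> e y = R y" by blast
  \<comment> \<open>The maximum keeps the base of the power nonnegative on the null set where
    \<open>R\<close> may be negative.\<close>
  define V where "V y = A * max 0 (R y) powr N" for y
  have V: "V \<in> borel_measurable borel"
  proof -
    have [measurable]: "R \<in> borel_measurable borel" using R(1) by (simp add: toM)
    show ?thesis unfolding V_def by measurable
  qed
  have level: "emeasure haar {z. V z < u} = ennreal u" if u: "0 < u" for u
  proof -
    \<comment> \<open>The radius of the ball with measure \<open>u\<close>.\<close>
    define s where "s = (u / A) powr (1 / N)"
    have s: "0 < s" using u A by (simp add: s_def)
    have sN: "A * s powr N = u" using u A N by (simp add: s_def powr_powr)
    have "{z. V z < u} \<in> sets borel" using V by measurable
    then have Vs: "{z. V z < u} \<in> sets haar" using sets by simp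
    then have "emeasure haar {z. V z < u} = emeasure (completion haar) {z. V z < u}" by simp
    also have "\<dots> = emeasure (completion haar) {y. \<rho> e y < s}"
    proof (rule emeasure_eq_AE)
      show "AE z in completion haar. z \<in> {z. V z < u} \<longleftrightarrow> z \<in> {y. \<rho> e y < s}"
        using AE_completion[OF R(2)]
      proof eventually_elim
        case (elim z)
        have "V z = A * \<rho> e z powr N" using \<rho>_nonneg[of z] elim by (simp add: V_def)
        moreover have "A * \<rho> e z powr N < A * s powr N \<longleftrightarrow> \<rho> e z < s"
          using A N powr_less_mono2[of N "\<rho> e z" s] powr_mono2[of N s "\<rho> e z"] s \<rho>_nonneg[of z]
          by (auto simp: not_less[symmetric])
        ultimately show ?case by (simp add: sN)
      qed
    qed (use ballm[OF s] Vs in auto)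
    also have "\<dots> = ennreal u" using balle[OF s] by (simp add: sN)
    finally show ?thesis .
  qed
  \<comment> \<open>Makes \<open>K * V z powr (a - 1)\<close> equal to the Riesz kernel where
    \<open>R\<close> is the distance and positive, because
    \<open>N * (a - 1) = \<alpha> - N\<close>.\<close>
  define K where "K = A powr (1 - a)"
  have K: "0 < K" using A by (simp add: K_def)
  define g where "g z = ennreal K * layers V a {0<..} z" for z
  have g: "g \<in> borel_measurable borel"
    unfolding g_def using measurable_layers[OF V, of "{0<..}" a] by measurable
  have "AE z in haar. riesz_kernel \<rho> e N \<alpha> z = g z"
    using R(2)
  proof eventually_elim
    case (elim z)
    show ?case
    proof (cases "\<rho> e z = 0")
      case True
      then have "V z \<le> 0" using elim by (simp add: V_def)
      then show ?thesis using True K layers_eq_powr(2)[OF a, of V z]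
        by (simp add: riesz_kernel_def g_def ennreal_mult_top)
    next
      case False
      then have pos: "0 < \<rho> e z" using \<rho>_nonneg[of z] by simp
      then have Vz: "V z = A * \<rho> e z powr N" using elim by (simp add: V_def)
      then have Vpos: "0 < V z" using A pos by simp
      have "K * V z powr (a - 1) = \<rho> e z powr (\<alpha> - N)"
      proof -
        have "N * (a - 1) = \<alpha> - N" using N by (simp add: a_def field_simps)
        then have "V z powr (a - 1) = A powr (a - 1) * \<rho> e z powr (\<alpha> - N)"
          using A pos by (simp add: Vz powr_mult powr_powr)
        moreover have "K * A powr (a - 1) = 1" using A by (simp add: K_def flip: powr_add)
        ultimately show ?thesis by (simp add: mult.assoc[symmetric])
      qed
      then show ?thesis using False K Vpos layers_eq_powr(1)[OF a, of V z]
        by (simp add: riesz_kernel_def g_def flip: ennreal_mult)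
    qed
  qed
  note tr = AE_translation_cong[OF haar sf this]
  define T where "T x y = (\<integral>\<^sup>+z. g z \<partial>kernel x y)" for x y
  have T: "(\<lambda>p. T (fst p) (snd p)) \<in> borel_measurable borel"
    unfolding T_def by (rule measurable_kernel_nn_integral[OF g])
  have Tx: "T x \<in> borel_measurable borel" for x
    using borel_measurable_section(2)[OF T, of x] by simp

  have f: "f \<in> borel_measurable (completion haar)" and fin: "lorentz_norm haar p q f < \<infinity>"
    using assms(12) by (auto simp: lorentz_space_def)
  obtain h where h: "h \<in> borel_measurable haar" "AE y in haar. f y = h y"
    using completion_ex_borel_measurable_complex[OF f] by blast
  have hb[measurable]: "h \<in> borel_measurable borel" using h(1) by (simp add: toM)
  have hi: "AE y in haar. f (invol y) = h (invol y)" by (rule AE_invol[OF haar sf h(2)])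
  have him: "(\<lambda>y. h (invol y)) \<in> borel_measurable borel"
    by (rule measurable_compose[OF borel_measurable_continuous_onI[OF invol_continuous] hb])
  define \<phi> where "\<phi> y = ennreal (cmod (h y))" for y
  have \<phi>: "\<phi> \<in> borel_measurable borel" unfolding \<phi>_def by measurable
  have f\<phi>: "AE y in haar. ennreal (cmod (f y)) = \<phi> y"
    using h(2) by eventually_elim (simp add: \<phi>_def)
  \<comment> \<open>The absolute potential, with Borel versions in place of the Riesz kernel and of
    \<open>f\<close>. It is finite exactly where the fractional integral converges, and it dominates
    the fractional integral everywhere.\<close>
  define H where "H x = ennreal K * (\<integral>\<^sup>+y. (\<integral>\<^sup>+z. layers V a {0<..} z \<partial>kernel x y) * \<phi> (invol y) \<partial>haar)" for x
  have H_eq: "H x = (\<integral>\<^sup>+y. T x y * \<phi> (invol y) \<partial>haar)" for x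
  proof -
    have lm: "layers V a {0<..} \<in> borel_measurable borel" by (rule measurable_layers[OF V]) simp
    have "T x y = ennreal K * (\<integral>\<^sup>+z. layers V a {0<..} z \<partial>kernel x y)" for y
      unfolding T_def g_def using lm by (intro nn_integral_cmult) (simp cong: measurable_cong_sets)
    moreover have "(\<lambda>y. (\<integral>\<^sup>+z. layers V a {0<..} z \<partial>kernel x y) * \<phi> (invol y)) \<in> borel_measurable haar"
      using borel_measurable_section(2)[OF measurable_kernel_nn_integral[OF lm], of x] him
      unfolding \<phi>_def toM by (intro borel_measurable_times_ennreal) auto
    ultimately show ?thesis unfolding H_def by (simp add: mult.assoc nn_integral_cmult)
  qed
  note bound = lorentz_norm_of_splitting[OF sf \<open>1 \<le> q\<close> r pr _ fin,
      of "K / a" H, unfolded H_def, OF _ riesz_splitting[OF haar sf V level a f \<phi> f\<phi> K], folded H_def]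
  have Ka: "0 \<le> K / a" using K a by simp
  have H_fin: "AE x in haar. H x < \<infinity>" by (rule bound(1)[OF Ka])

  let ?tr = "\<lambda>x. translation conv x (riesz_kernel \<rho> e N \<alpha>)"
  let ?I = "fractional_integral conv e invol haar \<rho> N \<alpha> f"
  have trm: "?tr x \<in> borel_measurable (completion haar)" for x
    using Tx[of x] tr[of x] by (intro measurable_completion_cong_AE[of "T x"]) (auto simp: toM T_def)
  have fim: "(\<lambda>y. f (invol y)) \<in> borel_measurable (completion haar)"
    using him hi by (intro measurable_completion_cong_AE[of "\<lambda>y. h (invol y)"]) (auto simp: toM)
  have conv: "fractional_integral_converges conv e invol haar \<rho> N \<alpha> f x \<longleftrightarrow> H x < \<infinity>" for x
  proof -
    have "(\<integral>\<^sup>+ y. ?tr x y * ennreal (cmod (f (invol y))) \<partial>completion haar) = H x"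
      unfolding H_eq nn_integral_completion
    proof (rule nn_integral_cong_AE)
      show "AE y in haar. ?tr x y * ennreal (cmod (f (invol y))) = T x y * \<phi> (invol y)"
        using tr[of x] hi by eventually_elim (simp add: T_def \<phi>_def)
    qed
    then show ?thesis using trm fim by (simp add: fractional_integral_converges_def)
  qed
  \<comment> \<open>A jointly Borel integrand, from which measurability of the integral in
    \<open>x\<close> follows; infinite values become 0 as in the definition of the fractional
    integral.\<close>
  define D where "D p = enn2real (T (fst p) (snd p)) *\<^sub>R h (invol (snd p))" for p
  have D: "D \<in> borel_measurable borel"
  proof -
    have "(\<lambda>p :: 'a \<times> 'a. h (invol (snd p))) \<in> borel_measurable borel"
      by (rule measurable_compose[OF _ him])
        (auto intro!: borel_measurable_continuous_onI continuous_intros)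
    moreover have "(\<lambda>p. enn2real (T (fst p) (snd p))) \<in> borel_measurable borel"
      using T by measurable
    ultimately show ?thesis unfolding D_def by (intro borel_measurable_scaleR)
  qed
  have Dx: "(\<lambda>y. D (x, y)) \<in> borel_measurable haar" for x
    unfolding toM by (rule borel_measurable_section(2)[OF D])
  have I_eq: "?I x = (LINT y|haar. D (x, y))" for x
  proof -
    have "?I x = (LINT y|completion haar. D (x, y))"
      unfolding fractional_integral_def
    proof (rule integral_cong_AE)
      show "(\<lambda>y. enn2real (?tr x y) *\<^sub>R f (invol y)) \<in> borel_measurable (completion haar)"
        using trm[of x] fim by measurable
      show "(\<lambda>y. D (x, y)) \<in> borel_measurable (completion haar)"
        by (rule measurable_completion[OF Dx])
      show "AE y in completion haar. enn2real (?tr x y) *\<^sub>R f (invol y) = D (x, y)"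
        using AE_completion[OF tr[of x]] AE_completion[OF hi] by eventually_elim (simp add: T_def D_def)
    qed
    then show ?thesis by (simp add: integral_completion[OF Dx])
  qed
  have D_le: "(\<integral>\<^sup>+y. ennreal (norm (D (x, y))) \<partial>haar) \<le> H x" for x
    unfolding H_eq
  proof (rule nn_integral_mono)
    fix y
    have "ennreal (norm (D (x, y))) = ennreal (enn2real (T x y)) * \<phi> (invol y)"
      by (simp add: D_def \<phi>_def ennreal_mult)
    also have "\<dots> \<le> T x y * \<phi> (invol y)"
      by (intro mult_right_mono) (cases "T x y", auto)
    finally show "ennreal (norm (D (x, y))) \<le> T x y * \<phi> (invol y)" .
  qed
  \<comment> \<open>Where the integrand is not integrable the integral is 0 by convention, so the
    bound holds for every \<open>x\<close>.\<close>
  have I_le: "ennreal (cmod (?I x)) \<le> H x" for x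
  proof (cases "integrable haar (\<lambda>y. D (x, y))")
    case True
    show ?thesis unfolding I_eq by (rule order_trans[OF integral_norm_bound_ennreal[OF True] D_le])
  next
    case False
    then show ?thesis unfolding I_eq by (simp add: not_integrable_integral_eq)
  qed
  obtain P where P: "P \<in> borel_measurable borel"
    "\<And>x. integrable haar (\<lambda>y. D (x, y)) \<Longrightarrow> (LINT y|haar. D (x, y)) = P x"
    using borel_measurable_section_integral[OF ir sf ir sf D] by blast
  have "AE x in haar. ?I x = P x"
    using H_fin
  proof eventually_elim
    case (elim x)
    have "integrable haar (\<lambda>y. D (x, y))"
      using Dx by (rule integrableI_bounded) (rule le_less_trans[OF D_le elim])
    then show ?case unfolding I_eq by (rule P(2))
  qed
  then have I_meas: "?I \<in> borel_measurable (completion haar)"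
    using P(1) by (intro measurable_completion_cong_AE[of P]) (auto simp: toM)
  have "lorentz_norm haar r q ?I \<le> ennreal (K / a * r) * lorentz_norm haar p q f"
    by (rule bound(2)[OF Ka _ _ I_meas I_le])
  also have "\<dots> \<le> ennreal (3 * r * N / \<alpha> * A powr ((N - \<alpha>) / N)) * lorentz_norm haar p q f"
  proof (intro mult_right_mono ennreal_leI)
    \<comment> \<open>The constant obtained is \<open>K / a * r\<close> with
      \<open>1 / a = N / \<alpha>\<close>, one third of the stated one.\<close>
    have "(N - \<alpha>) / N = 1 - a" using N by (simp add: a_def field_simps)
    then have "3 * r * N / \<alpha> * A powr ((N - \<alpha>) / N) = 3 * (K / a * r)"
      by (simp add: K_def a_def)
    moreover have "0 \<le> K / a * r" using K a r by simp
    ultimately show "K / a * r \<le> 3 * r * N / \<alpha> * A powr ((N - \<alpha>) / N)" by simp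
  qed simp
  finally have le: "lorentz_norm haar r q ?I \<le> ennreal (3 * r * N / \<alpha> * A powr ((N - \<alpha>) / N)) * lorentz_norm haar p q f" .
  also have "\<dots> < \<infinity>" using fin by (simp add: ennreal_mult_less_top)
  finally have "?I \<in> lorentz_space haar r q" using I_meas by (simp add: lorentz_space_def)
  with le H_fin show ?thesis by (simp add: conv)
qed

end
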